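(* Let $U$ be any associative commutative algebra over a field $K$ of characteristic $p\ge 0$, with derivation $\partial$. Then: (i) For any $k>0$, the algebra $(U,V^{0,1,\ldots,k})$ is homotopical $(k+1)$-Lie. Moreover, for any $\lambda_2,\lambda_3,\ldots\in K$ (and $\lambda_1=0$), the algebra $(U,\{0,\lambda_{i+1}V^{0,1,\ldots,i},\ i=1,2,\ldots\})$, i.e. $(U,\{\omega_1,\omega_2,\ldots\})$ with $\omega_1=0$ and $\omega_{i+1}=\lambda_{i+1}V^{0,1,\ldots,i}$ for $i=1,2,\ldots$, is homotopical Lie. (ii) The algebra $(U,V^{0,1,\ldots,k})$, $k>0$, is $k$-left commutative if and only if $k\ne 2$. (iii) The algebra $(U,V^{0,1,\ldots,k})$, $k>0$, is $(k+1)$-Lie if and only if one of the following conditions holds: $k=1$ and $p$ is any prime number or $0$; $k=2$ and $p=2$; $k=3$ and $p=3$; $k=4$ and $p=2$.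
   Context: For an associative commutative algebra $U$ with derivation $\partial$, the Wronskian $V^{0,1,\ldots,k}$ is the $(k+1)$-ary multiplication on $U$ given by $V^{0,1,\ldots,k}(u_0,\ldots,u_k)=\det\big(\partial^{i}u_j\big)_{0\le i,j\le k}$. For a vector space $A$, $C^n(A,A)=\mathrm{Hom}(\wedge^nA,A)$ is the space of skew-symmetric $n$-linear maps $A\times\cdots\times A\to A$. $\mathrm{Sym}_m$ is the group of permutations of $\{1,\ldots,m\}$, and $\mathrm{Sym}_{k,l}\subset \mathrm{Sym}_{k+l}$ is the set of shuffles: $\sigma(1)<\cdots<\sigma(k)$ and $\sigma(k+1)<\cdots<\sigma(k+l)$. Let $(A,\omega)$ be an algebra with $n$-ary multilinear multiplication $\omega$. - $(A,\omega)$ is $n$-Lie if $\omega$ is skew-symmetric and for all $a_1,\ldots,a_{n-1}\in A$ the map $D: a\mapsto\omega(a_1,\ldots,a_{n-1},a)$ is a derivation of $(A,\omega)$, i.e. $D(\omega(b_1,\ldots,b_n))=\sum_{i=1}^n\omega(b_1,\ldots,b_{i-1},D(b_i),b_{i+1},\ldots,b_n)$ for all $b_1,\ldots,b_n\in A$. - $(A,\omega)$ is $(n-1)$-left commutative if $\sum_{\sigma\in \mathrm{Sym}_{2n-2}}\mathrm{sign}(\sigma)\,\omega(a_{\sigma(1)},\ldots,a_{\sigma(n-1)},\omega(a_{\sigma(n)},\ldots,a_{\sigma(2n-2)},a_{2n-1}))=0$ for all $a_1,\ldots,a_{2n-1}\in A$. - $(A,\omega)$ is homotopical $n$-Lie if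 $\omega\in C^n(A,A)$ and $\sum_{\sigma\in \mathrm{Sym}_{n-1,n}}\mathrm{sign}(\sigma)\,\omega(a_{\sigma(1)},\ldots,a_{\sigma(n-1)},\omega(a_{\sigma(n)},\ldots,a_{\sigma(2n-1)}))=0$ for all $a_1,\ldots,a_{2n-1}\in A$. An algebra $(A,\{\omega_1,\omega_2,\ldots\})$ is homotopical Lie if $\omega_k\in C^k(A,A)$ for every $k\ge1$ and, for all $i,j\ge 1$ and all $a_1,\ldots,a_{i+j-1}\in A$, $\sum_{\sigma\in \mathrm{Sym}_{i-1,j}}\mathrm{sign}(\sigma)\,\omega_i(a_{\sigma(1)},\ldots,a_{\sigma(i-1)},\omega_j(a_{\sigma(i)},\ldots,a_{\sigma(i+j-1)}))=0$.
   Formalization: Part (ii) is corrected to "k-left commutative iff k≠1 and (k≠2 or p=2)", as the printed claim fails for k=1 (U=K[x], arguments 1,x,x) and for k=2, p=2; in (ii) and (iii) "is" means "for every U over K", since for one fixed U (e.g. ∂=0) "only if" fails. *)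

theory Defs
  imports "HOL-Algebra.Module" "HOL-Combinatorics.Permutations" "HOL-Computational_Algebra.Primes"
begin

definition has_characteristic :: "('k, 'm) ring_scheme \<Rightarrow> nat \<Rightarrow> bool" where
  "has_characteristic K p \<longleftrightarrow> (\<forall>m::nat. [m] \<cdot>\<^bsub>K\<^esub> \<one>\<^bsub>K\<^esub> = \<zero>\<^bsub>K\<^esub> \<longleftrightarrow> p dvd m)"

text \<open>
  Associative commutative algebras are not required to have a unit, so this is
  \<^locale>\<open>algebra\<close> with the ring axioms for the multiplication stated without it;
  the \<^const>\<open>one\<close> field of the record \<open>U\<close> is never used.
\<close>

locale assoc_comm_algebra = module K U for K (structure) and U (structure) +
  assumes mult_closed:
      "\<lbrakk>x \<in> carrier U; y \<in> carrier U\<rbrakk> \<Longrightarrow> x \<otimes>\<^bsub>U\<^esub> y \<in> carrier U"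
    and mult_assoc:
      "\<lbrakk>x \<in> carrier U; y \<in> carrier U; z \<in> carrier U\<rbrakk> \<Longrightarrow>
        (x \<otimes>\<^bsub>U\<^esub> y) \<otimes>\<^bsub>U\<^esub> z = x \<otimes>\<^bsub>U\<^esub> (y \<otimes>\<^bsub>U\<^esub> z)"
    and mult_comm:
      "\<lbrakk>x \<in> carrier U; y \<in> carrier U\<rbrakk> \<Longrightarrow> x \<otimes>\<^bsub>U\<^esub> y = y \<otimes>\<^bsub>U\<^esub> x"
    and mult_distr:
      "\<lbrakk>x \<in> carrier U; y \<in> carrier U; z \<in> carrier U\<rbrakk> \<Longrightarrow>
        (x \<oplus>\<^bsub>U\<^esub> y) \<otimes>\<^bsub>U\<^esub> z = x \<otimes>\<^bsub>U\<^esub> z \<oplus>\<^bsub>U\<^esub> y \<otimes>\<^bsub>U\<^esub> z"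
    and mult_smult:
      "\<lbrakk>c \<in> carrier K; x \<in> carrier U; y \<in> carrier U\<rbrakk> \<Longrightarrow>
        (c \<odot>\<^bsub>U\<^esub> x) \<otimes>\<^bsub>U\<^esub> y = c \<odot>\<^bsub>U\<^esub> (x \<otimes>\<^bsub>U\<^esub> y)"

locale differential_algebra = assoc_comm_algebra K U for K (structure) and U (structure) +
  fixes D :: "'c \<Rightarrow> 'c"
  assumes D_closed: "x \<in> carrier U \<Longrightarrow> D x \<in> carrier U"
    and D_add:
      "\<lbrakk>x \<in> carrier U; y \<in> carrier U\<rbrakk> \<Longrightarrow> D (x \<oplus>\<^bsub>U\<^esub> y) = D x \<oplus>\<^bsub>U\<^esub> D y"
    and D_smult:
      "\<lbrakk>c \<in> carrier K; x \<in> carrier U\<rbrakk> \<Longrightarrow> D (c \<odot>\<^bsub>U\<^esub> x) = c \<odot>\<^bsub>U\<^esub> D x"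
    and D_mult:
      "\<lbrakk>x \<in> carrier U; y \<in> carrier U\<rbrakk> \<Longrightarrow>
        D (x \<otimes>\<^bsub>U\<^esub> y) = D x \<otimes>\<^bsub>U\<^esub> y \<oplus>\<^bsub>U\<^esub> x \<otimes>\<^bsub>U\<^esub> D y"

text \<open>
  An \<open>n\<close>-ary operation is a function on lists, of which only the values on lists
  of length \<open>n\<close> matter.  The product \<open>f 0 \<cdots> f k\<close> of \<open>k + 1\<close> factors makes sense
  without a unit, so that the Wronskian can be given by the Leibniz formula for
  the determinant of the matrix with entry \<open>(D ^^ i) (us ! j)\<close> in row \<open>i\<close>, column \<open>j\<close>.
\<close>

primrec nonempty_prod :: "('u, 'm) ring_scheme \<Rightarrow> (nat \<Rightarrow> 'u) \<Rightarrow> nat \<Rightarrow> 'u" where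
  "nonempty_prod U f 0 = f 0"
| "nonempty_prod U f (Suc k) = nonempty_prod U f k \<otimes>\<^bsub>U\<^esub> f (Suc k)"

definition wronskian :: "('u, 'm) ring_scheme \<Rightarrow> ('u \<Rightarrow> 'u) \<Rightarrow> nat \<Rightarrow> 'u list \<Rightarrow> 'u" where
  "wronskian U D k us =
    (\<Oplus>\<^bsub>U\<^esub>\<sigma>\<in>{\<sigma>. \<sigma> permutes {0..k}}.
      [sign \<sigma>] \<cdot>\<^bsub>U\<^esub> nonempty_prod U (\<lambda>j. (D ^^ \<sigma> j) (us ! j)) k)"

definition multilinear ::
    "('k, 'm) ring_scheme \<Rightarrow> ('k, 'a, 'n) module_scheme \<Rightarrow> nat \<Rightarrow> ('a list \<Rightarrow> 'a) \<Rightarrow> bool" where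
  "multilinear K A n \<omega> \<longleftrightarrow>
    (\<forall>as. length as = n \<and> set as \<subseteq> carrier A \<longrightarrow>
      \<omega> as \<in> carrier A \<and>
      (\<forall>i<n. \<forall>x\<in>carrier A. \<forall>y\<in>carrier A.
        \<omega> (as[i := x \<oplus>\<^bsub>A\<^esub> y]) = \<omega> (as[i := x]) \<oplus>\<^bsub>A\<^esub> \<omega> (as[i := y])) \<and>
      (\<forall>i<n. \<forall>c\<in>carrier K. \<forall>x\<in>carrier A.
        \<omega> (as[i := c \<odot>\<^bsub>A\<^esub> x]) = c \<odot>\<^bsub>A\<^esub> \<omega> (as[i := x])))"

text \<open>
  \<open>Hom(\<And>\<^sup>n A, A)\<close>: skew-symmetry is vanishing on lists with a repeated entry, which
  in characteristic 2 is stronger than the sign rule for permuted arguments.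
\<close>

definition cochains ::
    "('k, 'm) ring_scheme \<Rightarrow> ('k, 'a, 'n) module_scheme \<Rightarrow> nat \<Rightarrow> ('a list \<Rightarrow> 'a) set" where
  "cochains K A n =
    {\<omega>. multilinear K A n \<omega> \<and>
        (\<forall>as. length as = n \<and> set as \<subseteq> carrier A \<and> \<not> distinct as \<longrightarrow> \<omega> as = \<zero>\<^bsub>A\<^esub>)}"

definition n_lie ::
    "('k, 'm) ring_scheme \<Rightarrow> ('k, 'a, 'n) module_scheme \<Rightarrow> nat \<Rightarrow> ('a list \<Rightarrow> 'a) \<Rightarrow> bool" where
  "n_lie K A n \<omega> \<longleftrightarrow>
    \<omega> \<in> cochains K A n \<and>
    (\<forall>as bs. length as = n - 1 \<and> set as \<subseteq> carrier A \<and> length bs = n \<and> set bs \<subseteq> carrier A \<longrightarrow>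
      \<omega> (as @ [\<omega> bs]) = (\<Oplus>\<^bsub>A\<^esub>i\<in>{..<n}. \<omega> (bs[i := \<omega> (as @ [bs ! i])])))"

text \<open>\<open>k\<close>-left commutativity of an operation of arity \<open>k + 1\<close>.\<close>

definition left_commutative :: "('a, 'm) ring_scheme \<Rightarrow> nat \<Rightarrow> ('a list \<Rightarrow> 'a) \<Rightarrow> bool" where
  "left_commutative A k \<omega> \<longleftrightarrow>
    (\<forall>a\<in>{1..2 * k + 1} \<rightarrow> carrier A.
      (\<Oplus>\<^bsub>A\<^esub>\<sigma>\<in>{\<sigma>. \<sigma> permutes {1..2 * k}}.
        [sign \<sigma>] \<cdot>\<^bsub>A\<^esub>
          \<omega> (map (\<lambda>i. a (\<sigma> i)) [1..<k + 1] @
             [\<omega> (map (\<lambda>i. a (\<sigma> i)) [k + 1..<2 * k + 1] @ [a (2 * k + 1)])])) = \<zero>\<^bsub>A\<^esub>)"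

definition shuffle_perms :: "nat \<Rightarrow> nat \<Rightarrow> (nat \<Rightarrow> nat) set" where
  "shuffle_perms k l =
    {\<sigma>. \<sigma> permutes {1..k + l} \<and> strict_mono_on {1..k} \<sigma> \<and> strict_mono_on {k + 1..k + l} \<sigma>}"

definition shuffle_identity ::
    "('a, 'm) ring_scheme \<Rightarrow> nat \<Rightarrow> nat \<Rightarrow> ('a list \<Rightarrow> 'a) \<Rightarrow> ('a list \<Rightarrow> 'a) \<Rightarrow> bool" where
  "shuffle_identity A i j \<omega> \<omega>' \<longleftrightarrow>
    (\<forall>a\<in>{1..i + j - 1} \<rightarrow> carrier A.
      (\<Oplus>\<^bsub>A\<^esub>\<sigma>\<in>shuffle_perms (i - 1) j.
        [sign \<sigma>] \<cdot>\<^bsub>A\<^esub>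
          \<omega> (map (\<lambda>m. a (\<sigma> m)) [1..<i] @ [\<omega>' (map (\<lambda>m. a (\<sigma> m)) [i..<i + j])])) = \<zero>\<^bsub>A\<^esub>)"

definition homotopical_n_lie ::
    "('k, 'm) ring_scheme \<Rightarrow> ('k, 'a, 'n) module_scheme \<Rightarrow> nat \<Rightarrow> ('a list \<Rightarrow> 'a) \<Rightarrow> bool" where
  "homotopical_n_lie K A n \<omega> \<longleftrightarrow> \<omega> \<in> cochains K A n \<and> shuffle_identity A n n \<omega> \<omega>"

definition homotopical_lie ::
    "('k, 'm) ring_scheme \<Rightarrow> ('k, 'a, 'n) module_scheme \<Rightarrow> (nat \<Rightarrow> 'a list \<Rightarrow> 'a) \<Rightarrow> bool" where
  "homotopical_lie K A \<omega> \<longleftrightarrow>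
    (\<forall>k\<ge>1. \<omega> k \<in> cochains K A k) \<and>
    (\<forall>i\<ge>1. \<forall>j\<ge>1. shuffle_identity A i j (\<omega> i) (\<omega> j))"

text \<open>
  Over \<open>K\<close>, an identity in finitely many arguments holds in all differential algebras
  as soon as it holds in the countably generated ones.  Those are carried by every type
  into which \<^typ>\<open>'k list\<close> injects, so over such a type \<^typ>\<open>'u\<close> quantifying over the
  algebras with elements in \<^typ>\<open>'u\<close> amounts to quantifying over all of them.
\<close>

definition large_universe :: "'k itself \<Rightarrow> 'u itself \<Rightarrow> bool" where
  "large_universe _ _ \<longleftrightarrow> (\<exists>e :: 'k list \<Rightarrow> 'u. inj e)"

end

theory Submission
  imports Defs "HOL-Library.Poly_Mapping"
begin

text \<open>
  A multilinear differential expression in \<open>a\<^sub>1, \<dots>, a\<^sub>N\<close> is encoded by its symbol, the polynomial in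
  \<open>t\<^sub>1, \<dots>, t\<^sub>N\<close> in which \<open>t\<^sub>1 ^ e\<^sub>1 \<cdots> t\<^sub>N ^ e\<^sub>N\<close> stands for the product of the
  \<open>(D ^^ e\<^sub>i) a\<^sub>i\<close>. Differentiation becomes multiplication by \<open>t\<^sub>1 + \<cdots> + t\<^sub>N\<close>, so the symbol of a
  Wronskian is a Vandermonde determinant, and that of a Wronskian nested in another one is a product of two.

  The homotopical and left-commutative identities antisymmetrize such a product in \<open>N\<close> variables. An
  antisymmetric polynomial of degree below \<open>N (N - 1) / 2\<close> vanishes, which settles the homotopical
  identities and left commutativity for \<open>k \<ge> 3\<close>. The symbol of the \<open>n\<close>-Lie identity is expanded
  in alternants by the Pieri rule; for the exceptional pairs \<open>(k, p)\<close> all coefficients turn out to be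
  divisible by \<open>p\<close>.

  Conversely, in the algebra of divided powers \<open>x\<^sub>n = x ^ n / n!\<close>, which makes sense over every field,
  the Wronskian of \<open>x\<^sub>e\<^sub>0, \<dots>, x\<^sub>e\<^sub>k\<close> is an integer multiple of a single divided power. Evaluating the
  \<open>n\<close>-Lie identity there gives \<open>p dvd k\<close>, for \<open>k \<ge> 5\<close> also \<open>p dvd (k - 1) (k - 4)\<close>, hence \<open>p = 2\<close>, and
  for \<open>k \<ge> 6\<close> that \<open>p\<close> divides a number of the parity of \<open>k - 1\<close>.
\<close>

section \<open>Alternants\<close>

text \<open>Symbols have integer coefficients whatever K is. The identities are proved over domains
  of characteristic 0, where antisymmetry forces vanishing and factorials can be cancelled; the
  characteristic p of K enters only through symbols divisible by p. As U has no unit, evaluating a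
  symbol is no ring homomorphism: it respects products for disjoint sets of variables, which
  suffices because each argument occurs once.

  The n-Lie symbol has 2k+1 variables, too many for a direct expansion. Both of its parts contain
  values of one Vandermonde determinant, viewed as a polynomial in its last variable. The k outer
  variables therefore enter only through their sum and the coefficients of that polynomial, and
  alternants in k+1 variables remain.

  Ordinary polynomials cannot refute the identities: there \<open>D ^^ p\<close> = 0 in
  characteristic p > 0, so the Wronskian vanishes for k \<ge> p. Divided powers keep every iterate
  of D nonzero. The exponents tested on them are chosen so that nearly all terms of the n-Lie
  identity contain a repeated argument; the integers that remain are, up to sign, numbers of
  standard Young tableaux.\<close>

definition alternant :: "nat \<Rightarrow> (nat \<Rightarrow> nat) \<Rightarrow> (nat \<Rightarrow> 'a::comm_ring_1) \<Rightarrow> 'a" where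
  "alternant k e z =
    (\<Sum>\<pi> | \<pi> permutes {0..k}. of_int (sign \<pi>) * (\<Prod>j\<in>{0..k}. z j ^ e (\<pi> j)))"

abbreviation vandermonde :: "nat \<Rightarrow> (nat \<Rightarrow> 'a::comm_ring_1) \<Rightarrow> 'a" where
  "vandermonde k \<equiv> alternant k id"

lemma alternant_cong:
  assumes "\<And>j. j \<le> k \<Longrightarrow> z j = z' j"
  shows "alternant k e z = alternant k e z'"
  unfolding alternant_def using assms by (auto intro!: sum.cong prod.cong)

lemma alternant_cong_exponents:
  assumes "\<And>j. j \<le> k \<Longrightarrow> e j = e' j"
  shows "alternant k e z = alternant k e' z"
proof -
  have "e (\<pi> j) = e' (\<pi> j)" if "\<pi> permutes {0..k}" "j \<in> {0..k}" for \<pi> j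
    using assms permutes_in_image[OF that(1), of j] that(2) by auto
  then show ?thesis
    unfolding alternant_def by (auto intro!: sum.cong prod.cong)
qed

lemma sign_compose_permutes:
  assumes "\<sigma> permutes P" "\<tau> permutes P" "finite P"
  shows "sign (\<sigma> \<circ> \<tau>) = sign \<sigma> * sign \<tau>"
  using assms by (intro sign_compose) (auto intro: permutes_imp_permutation)

lemma alternant_permute_exponents:
  assumes "\<tau> permutes {0..k}"
  shows "alternant k (e \<circ> \<tau>) z = of_int (sign \<tau>) * alternant k e z"
proof -
  have "alternant k e z = (\<Sum>\<pi> | \<pi> permutes {0..k}.
      of_int (sign (\<tau> \<circ> \<pi>)) * (\<Prod>j\<in>{0..k}. z j ^ e ((\<tau> \<circ> \<pi>) j)))"
    unfolding alternant_def by (rule setum_permutations_compose_left[OF assms])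
  also have "\<dots> = of_int (sign \<tau>) * alternant k (e \<circ> \<tau>) z"
    unfolding alternant_def sum_distrib_left
    by (rule sum.cong) (auto simp: sign_compose_permutes[OF assms])
  finally have "of_int (sign \<tau>) * alternant k e z =
      of_int (sign \<tau> * sign \<tau>) * alternant k (e \<circ> \<tau>) z"
    by (simp only: of_int_mult mult.assoc)
  then show ?thesis by (simp only: sign_idempotent) simp
qed

lemma alternant_permute_variables:
  assumes "\<tau> permutes {0..k}"
  shows "alternant k e (z \<circ> \<tau>) = of_int (sign \<tau>) * alternant k e z"
proof -
  have "alternant k e (z \<circ> \<tau>) = (\<Sum>\<pi> | \<pi> permutes {0..k}.
      of_int (sign (\<pi> \<circ> \<tau>)) * (\<Prod>j\<in>{0..k}. (z \<circ> \<tau>) j ^ e ((\<pi> \<circ> \<tau>) j)))"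
    unfolding alternant_def by (rule sum_permutations_compose_right[OF assms])
  also have "\<dots> = (\<Sum>\<pi> | \<pi> permutes {0..k}.
      of_int (sign \<tau>) * (of_int (sign \<pi>) * (\<Prod>j\<in>{0..k}. z j ^ e (\<pi> j))))"
  proof (rule sum.cong)
    fix \<pi> assume "\<pi> \<in> {\<pi>. \<pi> permutes {0..k}}"
    then have s: "sign (\<pi> \<circ> \<tau>) = sign \<pi> * sign \<tau>"
      by (simp add: sign_compose_permutes assms)
    have "(\<Prod>j\<in>{0..k}. (z \<circ> \<tau>) j ^ e ((\<pi> \<circ> \<tau>) j)) = (\<Prod>j\<in>{0..k}. z j ^ e (\<pi> j))"
      by (subst prod.permute[OF assms]) (simp add: o_def)
    then show "of_int (sign (\<pi> \<circ> \<tau>)) * (\<Prod>j\<in>{0..k}. (z \<circ> \<tau>) j ^ e ((\<pi> \<circ> \<tau>) j)) =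
        of_int (sign \<tau>) * (of_int (sign \<pi>) * (\<Prod>j\<in>{0..k}. z j ^ e (\<pi> j)))"
      by (simp only: s) simp
  qed simp
  finally show ?thesis by (simp add: alternant_def sum_distrib_left)
qed

text \<open>This is where characteristic 0 enters: a quantity that changes sign under an operation
  fixing it has to vanish. In characteristic 2 this fails.\<close>

lemma eq_minus_self_imp_0: "x = - x \<Longrightarrow> x = (0 :: 'a::{idom,ring_char_0})"
proof -
  assume "x = - x"
  then have "2 * x = 0" by (metis add.right_inverse mult_2)
  then show "x = 0" by simp
qed

text \<open>Exchanging the two equal exponents does not change the alternant, yet it reverses its
  sign.\<close>

lemma alternant_repeated_exponent:
  fixes z :: "nat \<Rightarrow> 'a::{idom,ring_char_0}"
  assumes "i \<le> k" "j \<le> k" "i \<noteq> j" "e i = e j"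
  shows "alternant k e z = 0"
proof -
  have "e \<circ> transpose i j = e" using assms(4) by (auto simp: transpose_def)
  moreover have "transpose i j permutes {0..k}" using assms by (intro permutes_swap_id) auto
  ultimately have "alternant k e z = - alternant k e z"
    using alternant_permute_exponents[of "transpose i j" k e z] assms(3) by (simp add: sign_swap_id)
  then show ?thesis by (rule eq_minus_self_imp_0)
qed

lemma prod_upd_exponent:
  fixes k :: nat and z :: "nat \<Rightarrow> 'a::comm_ring_1"
  assumes \<pi>: "\<pi> permutes {0..k}" and i: "i \<in> {0..k}"
  shows "(\<Prod>j\<in>{0..k}. z j ^ (e(\<pi> i := n)) (\<pi> j)) =
    z i ^ n * (\<Prod>j\<in>{0..k}-{i}. z j ^ e (\<pi> j))"
proof -
  have "\<pi> j \<noteq> \<pi> i" if "j \<noteq> i" for j using permutes_inj[OF \<pi>] that by (auto dest: injD)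
  then show ?thesis
    by (subst prod.remove[of _ i]) (use i in \<open>auto intro!: arg_cong2[where f = "(*)"] prod.cong\<close>)
qed

text \<open>The Pieri rule for the first elementary symmetric polynomial. Multiplying a monomial by
  z_i raises the exponent \<open>e (\<pi> i)\<close>, and summing over i is summing over m = \<pi>
  i.\<close>

lemma sum_variables_times_alternant:
  "(\<Sum>j\<in>{0..k}. z j) * alternant k e z = (\<Sum>m\<in>{0..k}. alternant k (e(m := Suc (e m))) z)"
proof -
  have *: "(\<Sum>m\<in>{0..k}. \<Prod>j\<in>{0..k}. z j ^ (e(m := Suc (e m))) (\<pi> j)) =
      (\<Sum>j\<in>{0..k}. z j) * (\<Prod>j\<in>{0..k}. z j ^ e (\<pi> j))" if \<pi>: "\<pi> permutes {0..k}" for \<pi>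
  proof -
    have "(\<Sum>m\<in>{0..k}. \<Prod>j\<in>{0..k}. z j ^ (e(m := Suc (e m))) (\<pi> j)) =
        (\<Sum>i\<in>{0..k}. \<Prod>j\<in>{0..k}. z j ^ (e(\<pi> i := Suc (e (\<pi> i)))) (\<pi> j))"
      by (subst sum.permute[OF \<pi>]) (simp add: o_def)
    also have "\<dots> = (\<Sum>i\<in>{0..k}. z i * (\<Prod>j\<in>{0..k}. z j ^ e (\<pi> j)))"
    proof (rule sum.cong)
      fix i assume i: "i \<in> {0..k}"
      show "(\<Prod>j\<in>{0..k}. z j ^ (e(\<pi> i := Suc (e (\<pi> i)))) (\<pi> j)) =
          z i * (\<Prod>j\<in>{0..k}. z j ^ e (\<pi> j))"
        unfolding prod_upd_exponent[OF \<pi> i] prod.remove[OF _ i, of "\<lambda>j. z j ^ e (\<pi> j)", simplified]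
        by (simp add: mult.assoc)
    qed simp
    finally show ?thesis by (simp add: sum_distrib_right)
  qed
  have "(\<Sum>m\<in>{0..k}. alternant k (e(m := Suc (e m))) z) =
      (\<Sum>\<pi> | \<pi> permutes {0..k}. of_int (sign \<pi>) *
        (\<Sum>m\<in>{0..k}. \<Prod>j\<in>{0..k}. z j ^ (e(m := Suc (e m))) (\<pi> j)))"
    unfolding alternant_def sum_distrib_left by (rule sum.swap)
  also have "\<dots> = (\<Sum>j\<in>{0..k}. z j) * alternant k e z"
    unfolding alternant_def sum_distrib_left[of "\<Sum>j\<in>{0..k}. z j"]
    by (rule sum.cong) (simp_all add: * mult_ac del: fun_upd_apply)
  finally show ?thesis by simp
qed

text \<open>The shift occurs in a single factor of each monomial, to which the binomial theorem
  applies; m is the exponent \<pi> i of that factor. Later \<open>s\<close> is the sum of the outer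
  variables and \<open>a\<close> the power of t_i supplied by the other Vandermonde factor.\<close>

lemma sum_shifted_vandermonde:
  "(\<Sum>i\<in>{0..k}. z i ^ a * vandermonde k (z(i := z i + s))) =
    (\<Sum>m\<in>{0..k}. \<Sum>r\<le>m. of_nat (m choose r) * s ^ r * alternant k (id(m := m - r + a)) z)"
proof -
  have *: "(\<Sum>i\<in>{0..k}. z i ^ a * (\<Prod>j\<in>{0..k}. (z(i := z i + s)) j ^ \<pi> j)) =
      (\<Sum>m\<in>{0..k}. \<Sum>r\<le>m. of_nat (m choose r) * s ^ r *
        (\<Prod>j\<in>{0..k}. z j ^ (id(m := m - r + a)) (\<pi> j)))" if \<pi>: "\<pi> permutes {0..k}" for \<pi>
  proof -
    have "(\<Sum>m\<in>{0..k}. \<Sum>r\<le>m. of_nat (m choose r) * s ^ r *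
          (\<Prod>j\<in>{0..k}. z j ^ (id(m := m - r + a)) (\<pi> j))) =
        (\<Sum>i\<in>{0..k}. \<Sum>r\<le>\<pi> i. of_nat (\<pi> i choose r) * s ^ r *
          (\<Prod>j\<in>{0..k}. z j ^ (id(\<pi> i := \<pi> i - r + a)) (\<pi> j)))"
      by (subst sum.permute[OF \<pi>]) (simp add: o_def)
    also have "\<dots> = (\<Sum>i\<in>{0..k}. z i ^ a * (\<Prod>j\<in>{0..k}. (z(i := z i + s)) j ^ \<pi> j))"
    proof (rule sum.cong)
      fix i assume i: "i \<in> {0..k}"
      have "(\<Prod>j\<in>{0..k}. (z(i := z i + s)) j ^ \<pi> j) =
          (z i + s) ^ \<pi> i * (\<Prod>j\<in>{0..k}-{i}. z j ^ \<pi> j)"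
        by (subst prod.remove[of _ i]) (use i in \<open>auto intro!: arg_cong2[where f = "(*)"] prod.cong\<close>)
      also have "(z i + s) ^ \<pi> i = (\<Sum>r\<le>\<pi> i. of_nat (\<pi> i choose r) * s ^ r * z i ^ (\<pi> i - r))"
        by (subst add.commute) (rule binomial_ring)
      finally have "z i ^ a * (\<Prod>j\<in>{0..k}. (z(i := z i + s)) j ^ \<pi> j) =
          (\<Sum>r\<le>\<pi> i. of_nat (\<pi> i choose r) * s ^ r *
            (z i ^ (\<pi> i - r + a) * (\<Prod>j\<in>{0..k}-{i}. z j ^ \<pi> j)))"
        unfolding power_add by (simp only: sum_distrib_left sum_distrib_right mult_ac)
      then show "(\<Sum>r\<le>\<pi> i. of_nat (\<pi> i choose r) * s ^ r *
          (\<Prod>j\<in>{0..k}. z j ^ (id(\<pi> i := \<pi> i - r + a)) (\<pi> j))) =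
          z i ^ a * (\<Prod>j\<in>{0..k}. (z(i := z i + s)) j ^ \<pi> j)"
        by (simp add: prod_upd_exponent[OF \<pi> i] del: fun_upd_apply)
    qed simp
    finally show ?thesis by simp
  qed
  have "(\<Sum>i\<in>{0..k}. z i ^ a * vandermonde k (z(i := z i + s))) =
      (\<Sum>\<pi> | \<pi> permutes {0..k}. of_int (sign \<pi>) *
        (\<Sum>i\<in>{0..k}. z i ^ a * (\<Prod>j\<in>{0..k}. (z(i := z i + s)) j ^ \<pi> j)))"
    unfolding alternant_def sum_distrib_left id_apply by (subst sum.swap) (simp add: mult_ac)
  also have "\<dots> = (\<Sum>\<pi> | \<pi> permutes {0..k}. \<Sum>m\<in>{0..k}. \<Sum>r\<le>m. of_nat (m choose r) * s ^ r *
      (of_int (sign \<pi>) * (\<Prod>j\<in>{0..k}. z j ^ (id(m := m - r + a)) (\<pi> j))))"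
    by (rule sum.cong[OF refl], simp only: mem_Collect_eq *)
      (simp add: sum_distrib_left mult_ac del: fun_upd_apply)
  also have "\<dots> = (\<Sum>m\<in>{0..k}. \<Sum>r\<le>m. \<Sum>\<pi> | \<pi> permutes {0..k}. of_nat (m choose r) * s ^ r *
      (of_int (sign \<pi>) * (\<Prod>j\<in>{0..k}. z j ^ (id(m := m - r + a)) (\<pi> j))))"
    by (subst sum.swap, rule sum.cong[OF refl], rule sum.swap)
  finally show ?thesis
    by (simp add: alternant_def sum_distrib_left)
qed

text \<open>The coefficients are, up to sign, the elementary symmetric polynomials of z_0, ..., z_k
  times their Vandermonde determinant. The recorded relation between the two highest coefficients is
  the case of z_0 + ... + z_k.\<close>

lemma vandermonde_last_variable:
  fixes z :: "nat \<Rightarrow> 'a::{idom,ring_char_0}"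
  obtains c where "\<And>x. vandermonde (Suc k) (z(Suc k := x)) = (\<Sum>n\<in>{0..Suc k}. c n * x ^ n)"
    and "c k = - ((\<Sum>j\<in>{0..k}. z j) * c (Suc k))"
proof -
  define c where "c n = (\<Sum>\<pi> | \<pi> permutes {0..Suc k} \<and> \<pi> (Suc k) = n.
    of_int (sign \<pi>) * (\<Prod>j\<in>{0..k}. z j ^ \<pi> j))" for n
  have fin: "finite {\<pi>. \<pi> permutes {0..Suc k}}" by (rule finite_permutations) simp
  have 1: "vandermonde (Suc k) (z(Suc k := x)) = (\<Sum>n\<in>{0..Suc k}. c n * x ^ n)" for x
  proof -
    have "vandermonde (Suc k) (z(Suc k := x)) = (\<Sum>\<pi> | \<pi> permutes {0..Suc k}.
        of_int (sign \<pi>) * (\<Prod>j\<in>{0..k}. z j ^ \<pi> j) * x ^ \<pi> (Suc k))"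
      unfolding alternant_def by (intro sum.cong refl) (auto simp: prod.atLeast0_atMost_Suc mult.assoc
        intro!: prod.cong)
    also have "\<dots> = (\<Sum>n\<in>{0..Suc k}. \<Sum>\<pi> | \<pi> \<in> {\<pi>. \<pi> permutes {0..Suc k}} \<and> \<pi> (Suc k) = n.
        of_int (sign \<pi>) * (\<Prod>j\<in>{0..k}. z j ^ \<pi> j) * x ^ \<pi> (Suc k))"
    proof (rule sum.group[symmetric, OF fin])
      show "(\<lambda>\<pi>. \<pi> (Suc k)) ` {\<pi>. \<pi> permutes {0..Suc k}} \<subseteq> {0..Suc k}"
      proof clarify
        fix \<pi> assume "\<pi> permutes {0..Suc k}"
        then show "\<pi> (Suc k) \<in> {0..Suc k}" using permutes_in_image[of \<pi> "{0..Suc k}" "Suc k"] by simp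
      qed
    qed simp
    also have "\<dots> = (\<Sum>n\<in>{0..Suc k}. c n * x ^ n)"
      unfolding c_def sum_distrib_right by (intro sum.cong refl) auto
    finally show ?thesis .
  qed
  have perm: "\<pi> permutes {0..k} \<longleftrightarrow> \<pi> permutes {0..Suc k} \<and> \<pi> (Suc k) = Suc k" for \<pi>
  proof
    assume *: "\<pi> permutes {0..k}"
    then have "\<pi> permutes {0..Suc k}" by (rule permutes_subset) auto
    moreover have "\<pi> (Suc k) = Suc k" using * by (rule permutes_not_in) simp
    ultimately show "\<pi> permutes {0..Suc k} \<and> \<pi> (Suc k) = Suc k" ..
  next
    assume *: "\<pi> permutes {0..Suc k} \<and> \<pi> (Suc k) = Suc k"
    show "\<pi> permutes {0..k}"
      by (rule permutes_superset[of \<pi> "{0..Suc k}"]) (use * in \<open>auto simp: le_Suc_eq\<close>)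
  qed
  have top: "c (Suc k) = vandermonde k z"
    unfolding c_def alternant_def perm by simp
  let ?t = "transpose k (Suc k)"
  have t: "?t permutes {0..Suc k}" by (intro permutes_swap_id) auto
  \<comment> \<open>Composing with the transposition turns a permutation with \<pi> (Suc k) = k into
    one that fixes Suc k. In the monomial the exponent k is traded for Suc k, and the sign
    flips.\<close>
  have "c k = (\<Sum>\<pi> | \<pi> permutes {0..k}. of_int (sign (?t \<circ> \<pi>)) * (\<Prod>j\<in>{0..k}. z j ^ (?t \<circ> \<pi>) j))"
    unfolding c_def
  proof (rule sum.reindex_bij_witness[where i = "\<lambda>\<pi>. ?t \<circ> \<pi>" and j = "\<lambda>\<pi>. ?t \<circ> \<pi>"])
    fix \<pi> assume "\<pi> \<in> {\<pi>. \<pi> permutes {0..Suc k} \<and> \<pi> (Suc k) = k}"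
    then show "?t \<circ> \<pi> \<in> {\<pi>. \<pi> permutes {0..k}}"
      unfolding perm by (auto intro: permutes_compose t)
  next
    fix \<pi> assume "\<pi> \<in> {\<pi>. \<pi> permutes {0..k}}"
    then show "?t \<circ> \<pi> \<in> {\<pi>. \<pi> permutes {0..Suc k} \<and> \<pi> (Suc k) = k}"
      unfolding perm by (auto intro: permutes_compose t)
  qed (auto simp: comp_assoc[symmetric])
  also have "\<dots> = - alternant k (id(k := Suc k)) z"
    unfolding alternant_def sum_negf[symmetric]
  proof (rule sum.cong)
    fix \<pi> assume "\<pi> \<in> {\<pi>. \<pi> permutes {0..k}}"
    then have p: "\<pi> permutes {0..k}" by simp
    then have p': "\<pi> permutes {0..Suc k}" unfolding perm by simp
    have "sign (?t \<circ> \<pi>) = - sign \<pi>"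
      using sign_compose_permutes[OF t p'] by (simp add: sign_swap_id)
    moreover have "(?t \<circ> \<pi>) j = (id(k := Suc k)) (\<pi> j)" if "j \<in> {0..k}" for j
      using permutes_in_image[OF p, of j] that by (auto simp: transpose_def)
    then have "(\<Prod>j\<in>{0..k}. z j ^ (?t \<circ> \<pi>) j) = (\<Prod>j\<in>{0..k}. z j ^ (id(k := Suc k)) (\<pi> j))"
      by (intro prod.cong) auto
    ultimately show "of_int (sign (?t \<circ> \<pi>)) * (\<Prod>j\<in>{0..k}. z j ^ (?t \<circ> \<pi>) j) =
        - (of_int (sign \<pi>) * (\<Prod>j\<in>{0..k}. z j ^ (id(k := Suc k)) (\<pi> j)))"
      by (simp only:) simp
  qed simp
  also have "alternant k (id(k := Suc k)) z = (\<Sum>j\<in>{0..k}. z j) * vandermonde k z"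
  proof -
    \<comment> \<open>In the Pieri rule only raising the largest exponent survives: raising m < k
      produces m + 1 a second time.\<close>
    have "alternant k (id(m := Suc (id m))) z = 0" if "m < k" for m
      using that by (intro alternant_repeated_exponent[of m k "Suc m"]) auto
    then have "(\<Sum>m\<in>{0..<k}. alternant k (id(m := Suc (id m))) z) = 0"
      by (intro sum.neutral) auto
    then show ?thesis
      unfolding sum_variables_times_alternant
      by (simp add: atLeastLessThanSuc_atLeastAtMost[symmetric])
  qed
  finally show ?thesis using 1 top by (intro that[of c]) auto
qed

section \<open>Antisymmetrization of polynomials of small degree\<close>

text \<open>Variables outside \<open>P\<close> count as constants, hence the arbitrary ring elements as coefficients.\<close>

inductive polynomial_of_degree :: "nat set \<Rightarrow> nat \<Rightarrow> ((nat \<Rightarrow> 'a::comm_ring_1) \<Rightarrow> 'a) \<Rightarrow> bool"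
  for P where
  monomial: "sum e P \<le> n \<Longrightarrow> polynomial_of_degree P n (\<lambda>z. c * (\<Prod>m\<in>P. z m ^ e m))"
| add: "polynomial_of_degree P n f \<Longrightarrow> polynomial_of_degree P n g \<Longrightarrow>
    polynomial_of_degree P n (\<lambda>z. f z + g z)"

lemma polynomial_of_degree_const: "polynomial_of_degree P n (\<lambda>z. c)"
  using monomial[of "\<lambda>_. 0" P n c] by simp

lemma polynomial_of_degree_var:
  assumes "finite P" "m \<in> P"
  shows "polynomial_of_degree P 1 (\<lambda>z. z m)"
proof -
  have "(\<Prod>i\<in>P. z i ^ (if i = m then 1 else 0)) = z m" for z :: "nat \<Rightarrow> 'a"
  proof -
    have "(\<Prod>i\<in>P. z i ^ (if i = m then 1 else 0)) = (\<Prod>i\<in>P. if i = m then z i else 1)"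
      by (rule prod.cong) auto
    then show ?thesis using assms by simp
  qed
  then show ?thesis
    using monomial[of "\<lambda>i. if i = m then 1 else 0" P 1 "1 :: 'a"] assms
    by (simp only: mult_1_left) simp
qed

lemma polynomial_of_degree_sum:
  assumes "\<And>i. i \<in> I \<Longrightarrow> polynomial_of_degree P n (f i)"
  shows "polynomial_of_degree P n (\<lambda>z. \<Sum>i\<in>I. f i z)"
  using assms
  by (induction I rule: infinite_finite_induct) (auto intro: polynomial_of_degree_const add)

lemma polynomial_of_degree_mult:
  assumes "polynomial_of_degree P m f" "polynomial_of_degree P n g"
  shows "polynomial_of_degree P (m + n) (\<lambda>z. f z * g z)"
  using assms(1)
proof induction
  case (monomial e m c)
  note e = this
  from assms(2) show ?case
  proof induction
    case (monomial e' n c')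
    have "polynomial_of_degree P (m + n) (\<lambda>z. c * c' * (\<Prod>i\<in>P. z i ^ (e i + e' i)))"
      using e monomial by (intro polynomial_of_degree.monomial) (simp add: sum.distrib)
    then show ?case by (simp add: power_add prod.distrib mult_ac)
  next
    case (add n f g)
    then show ?case by (simp add: distrib_left polynomial_of_degree.add)
  qed
next
  case (add m f g)
  then show ?case by (simp add: distrib_right polynomial_of_degree.add)
qed

lemma polynomial_of_degree_power:
  assumes "polynomial_of_degree P 1 f"
  shows "polynomial_of_degree P n (\<lambda>z. f z ^ n)"
proof (induction n)
  case 0
  show ?case by (simp add: polynomial_of_degree_const)
next
  case (Suc n)
  show ?case using polynomial_of_degree_mult[OF assms Suc] by simp
qed

lemma polynomial_of_degree_prod:
  assumes "finite J" "\<And>j. j \<in> J \<Longrightarrow> polynomial_of_degree P (d j) (f j)"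
  shows "polynomial_of_degree P (sum d J) (\<lambda>z. \<Prod>j\<in>J. f j z)"
  using assms
  by (induction J rule: finite_induct) (auto intro: polynomial_of_degree_const polynomial_of_degree_mult)

lemma polynomial_of_degree_vandermonde:
  assumes "\<And>j. j \<le> k \<Longrightarrow> polynomial_of_degree P 1 (\<lambda>z. f z j)"
  shows "polynomial_of_degree P (\<Sum>{0..k}) (\<lambda>z. vandermonde k (f z))"
  unfolding alternant_def
proof (rule polynomial_of_degree_sum)
  fix \<pi> assume "\<pi> \<in> {\<pi>. \<pi> permutes {0..k}}"
  then have \<pi>: "\<pi> permutes {0..k}" by simp
  have "polynomial_of_degree P (sum \<pi> {0..k}) (\<lambda>z. \<Prod>j\<in>{0..k}. f z j ^ id (\<pi> j))"
    by (rule polynomial_of_degree_prod) (auto intro: polynomial_of_degree_power assms)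
  moreover have "sum \<pi> {0..k} = \<Sum>{0..k}"
    using sum.permute[OF \<pi>, of id] by (simp add: o_def)
  ultimately show "polynomial_of_degree P (\<Sum>{0..k})
      (\<lambda>z. of_int (sign \<pi>) * (\<Prod>j\<in>{0..k}. f z j ^ id (\<pi> j)))"
    using polynomial_of_degree_mult[OF polynomial_of_degree_const[of P 0]] by fastforce
qed

text \<open>A lies in {0..Max A}, so its maximum is at least |A| - 1. Removing the maximum gives the
  induction.\<close>

lemma sum_lessThan_card_le_sum: "finite A \<Longrightarrow> \<Sum>{..<card A} \<le> \<Sum>(A :: nat set)"
proof (induction "card A" arbitrary: A)
  case (Suc n)
  then have ne: "A \<noteq> {}" by auto
  have "A \<subseteq> {..Max A}" using Suc.prems by auto
  then have "card A \<le> card {..Max A}" by (intro card_mono) auto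
  then have m: "n \<le> Max A" using Suc.hyps(2) by simp
  have cd: "card (A - {Max A}) = n" using Suc ne by simp
  have "\<Sum>{..<card A} = n + \<Sum>{..<n}" using Suc.hyps(2)[symmetric] by (simp add: lessThan_Suc)
  also have "\<dots> \<le> Max A + \<Sum>(A - {Max A})"
    using Suc.hyps(1)[of "A - {Max A}"] Suc.prems m cd by simp
  also have "\<dots> = \<Sum>A" using Suc.prems ne by (simp add: sum.remove[of A "Max A" "\<lambda>x. x"])
  finally show ?case .
qed auto

text \<open>Distinct exponents on P add up to at least 0 + 1 + ... + (|P| - 1), so in each monomial
  of smaller degree two variables have equal exponents. Transposing these two reverses the sign of
  the sum while preserving the monomials.\<close>

lemma antisymmetrization_eq_0:
  fixes f :: "(nat \<Rightarrow> 'a::{idom,ring_char_0}) \<Rightarrow> 'a"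
  assumes P: "finite P" and f: "polynomial_of_degree P n f" and n: "n < \<Sum>{..<card P}"
  shows "(\<Sum>\<sigma> | \<sigma> permutes P. of_int (sign \<sigma>) * f (z \<circ> \<sigma>)) = 0"
  using f n
proof induction
  case (monomial e n c)
  then have "\<not> inj_on e P"
    using sum_lessThan_card_le_sum[of "e ` P"] P by (auto simp: card_image sum.reindex)
  then obtain i j where ij: "i \<in> P" "j \<in> P" "i \<noteq> j" "e i = e j" by (auto simp: inj_on_def)
  let ?t = "transpose i j"
  let ?g = "\<lambda>\<sigma>. c * (\<Prod>m\<in>P. (z \<circ> \<sigma>) m ^ e m)"
  have t: "?t permutes P" using ij by (intro permutes_swap_id)
  have "(\<Sum>\<sigma> | \<sigma> permutes P. of_int (sign \<sigma>) * ?g \<sigma>) =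
      (\<Sum>\<sigma> | \<sigma> permutes P. of_int (sign (\<sigma> \<circ> ?t)) * ?g (\<sigma> \<circ> ?t))"
    by (rule sum_permutations_compose_right[OF t])
  also have "\<dots> = (\<Sum>\<sigma> | \<sigma> permutes P. - (of_int (sign \<sigma>) * ?g \<sigma>))"
  proof (rule sum.cong)
    fix \<sigma> assume "\<sigma> \<in> {\<sigma>. \<sigma> permutes P}"
    then have s: "sign (\<sigma> \<circ> ?t) = - sign \<sigma>"
      using sign_compose_permutes[of \<sigma> P ?t] t P ij by (simp add: sign_swap_id)
    have "e (?t m) = e m" for m using ij by (auto simp: transpose_def)
    then have "(\<Prod>m\<in>P. (z \<circ> (\<sigma> \<circ> ?t)) m ^ e m) = (\<Prod>m\<in>P. (z \<circ> \<sigma>) m ^ e m)"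
      by (subst (2) prod.permute[OF t]) (simp add: o_def)
    then show "of_int (sign (\<sigma> \<circ> ?t)) * ?g (\<sigma> \<circ> ?t) = - (of_int (sign \<sigma>) * ?g \<sigma>)"
      by (simp only: s) simp
  qed simp
  finally show ?case unfolding sum_negf by (rule eq_minus_self_imp_0)
next
  case (add n f g)
  then show ?case by (simp add: distrib_left sum.distrib)
qed

section \<open>Shuffles\<close>

lemma strict_mono_on_eq_nth_sorted_list:
  fixes s :: "nat \<Rightarrow> nat"
  assumes "strict_mono_on {a..<a + n} s"
  shows "map s [a..<a + n] = sorted_list_of_set (s ` {a..<a + n})"
proof -
  have "sorted_wrt (<) (map s [a..<a + n])"
    using assms by (auto simp: sorted_wrt_map strict_mono_on_def intro: sorted_wrt_mono_rel[OF _ sorted_wrt_upt])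
  then show ?thesis
    by (metis image_set atLeastLessThan_upt sorted_list_of_set.idem_if_sorted_distinct strict_sorted_iff)
qed

text \<open>Both maps are the increasing enumeration of their common image.\<close>

lemma strict_mono_on_unique:
  fixes s s' :: "nat \<Rightarrow> nat"
  assumes "strict_mono_on {a..b} s" "strict_mono_on {a..b} s'" "s ` {a..b} = s' ` {a..b}" "x \<in> {a..b}"
  shows "s x = s' x"
proof -
  have *: "{a..b} = {a..<a + (Suc b - a)}" using assms(4) by auto
  have "map s [a..<a + (Suc b - a)] = map s' [a..<a + (Suc b - a)]"
    using strict_mono_on_eq_nth_sorted_list[of a "Suc b - a" s]
      strict_mono_on_eq_nth_sorted_list[of a "Suc b - a" s'] assms unfolding * by simp
  then show ?thesis using assms(4) by (auto simp: map_eq_conv)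
qed

lemma ex_strict_mono_on_bij_betw:
  fixes A :: "nat set"
  assumes "finite A" "card A = n"
  shows "\<exists>f. bij_betw f {a..<a + n} A \<and> strict_mono_on {a..<a + n} (f :: nat \<Rightarrow> nat)"
proof (intro exI conjI)
  let ?f = "\<lambda>m. sorted_list_of_set A ! (m - a)"
  have len: "length (sorted_list_of_set A) = n" using assms by simp
  show mono: "strict_mono_on {a..<a + n} ?f"
    by (rule strict_mono_onI, rule sorted_wrt_nth_less[of "(<)"])
      (use assms in auto)
  have "?f ` {a..<a + n} = (!) (sorted_list_of_set A) ` {..<n}"
  proof -
    have "(\<lambda>m. m - a) ` {a..<a + n} = {..<n}"
      by (auto simp: image_iff intro!: bexI[of _ "_ + a"])
    then show ?thesis by (metis image_image)
  qed
  also have "\<dots> = A" using assms len nth_image[of n "sorted_list_of_set A"] by (simp add: lessThan_atLeast0)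
  finally show "bij_betw ?f {a..<a + n} A"
    using strict_mono_on_imp_inj_on[OF mono] by (simp add: bij_betw_def)
qed

text \<open>Shuffles represent the left cosets of Sym_k x Sym_l in Sym_{k+l}: a coset is determined
  by the images of the two blocks, and exactly one of its members is increasing on both.\<close>

lemma shuffle_decomposition:
  fixes k l :: nat
  shows "bij_betw (\<lambda>(s, \<pi>, \<rho>). s \<circ> (\<pi> \<circ> \<rho>))
    (shuffle_perms k l \<times> {\<pi>. \<pi> permutes {1..k}} \<times> {\<rho>. \<rho> permutes {k + 1..k + l}})
    {\<sigma>. \<sigma> permutes {1..k + l}}"
proof (rule bij_betw_imageI)
  let ?A = "{1..k}" and ?B = "{k + 1..k + l}" and ?N = "{1..k + l}"
  let ?S = "shuffle_perms k l \<times> {\<pi>. \<pi> permutes ?A} \<times> {\<rho>. \<rho> permutes ?B}"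
  have sub: "?A \<subseteq> ?N" "?B \<subseteq> ?N" by auto
  have imA: "(\<pi> \<circ> \<rho>) ` ?A = ?A" and imB: "(\<pi> \<circ> \<rho>) ` ?B = ?B"
    if \<pi>: "\<pi> permutes ?A" and \<rho>: "\<rho> permutes ?B" for \<pi> \<rho>
  proof -
    have "\<rho> x = x" if "x \<in> ?A" for x using permutes_not_in[OF \<rho>] that by simp
    then have "\<rho> ` ?A = ?A" by (auto simp: image_iff)
    then show "(\<pi> \<circ> \<rho>) ` ?A = ?A" using permutes_image[OF \<pi>] by (simp only: image_comp[symmetric])
    have "\<pi> x = x" if "x \<in> ?B" for x using permutes_not_in[OF \<pi>] that by simp
    then have "\<pi> ` ?B = ?B" by (auto simp: image_iff)
    then show "(\<pi> \<circ> \<rho>) ` ?B = ?B" using permutes_image[OF \<rho>] by (simp only: image_comp[symmetric])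
  qed
  show "inj_on (\<lambda>(s, \<pi>, \<rho>). s \<circ> (\<pi> \<circ> \<rho>)) ?S"
  proof (rule inj_onI, clarify)
    fix s \<pi> \<rho> s' \<pi>' \<rho>'
    assume s: "s \<in> shuffle_perms k l" and s': "s' \<in> shuffle_perms k l"
      and \<pi>: "\<pi> permutes ?A" and \<rho>: "\<rho> permutes ?B" and \<pi>': "\<pi>' permutes ?A" and \<rho>': "\<rho>' permutes ?B"
      and eq: "s \<circ> (\<pi> \<circ> \<rho>) = s' \<circ> (\<pi>' \<circ> \<rho>')"
    \<comment> \<open>The images of the blocks do not depend on the factors \<pi> and \<rho>, and an
      increasing map is determined by its image.\<close>
    have "s ` ?A = s' ` ?A"
      using imA[OF \<pi> \<rho>] imA[OF \<pi>' \<rho>'] eq by (metis image_comp)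
    moreover have "s ` ?B = s' ` ?B"
      using imB[OF \<pi> \<rho>] imB[OF \<pi>' \<rho>'] eq by (metis image_comp)
    ultimately have "s x = s' x" if "x \<in> ?N" for x
      using s s' strict_mono_on_unique[of 1 k s s' x] strict_mono_on_unique[of "k + 1" "k + l" s s' x] that
      by (cases "x \<le> k") (auto simp: shuffle_perms_def)
    moreover have "s x = s' x" if "x \<notin> ?N" for x
    proof -
      have "s permutes ?N" "s' permutes ?N" using s s' by (auto simp: shuffle_perms_def)
      then show ?thesis using permutes_not_in[OF _ that] by metis
    qed
    ultimately have "s = s'" by blast
    moreover have "inj s" using s permutes_inj by (auto simp: shuffle_perms_def)
    ultimately have eq': "\<pi> \<circ> \<rho> = \<pi>' \<circ> \<rho>'" using eq by (metis (no_types, lifting) comp_apply ext injD)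
    have "\<rho> x = x" "\<rho>' x = x" if "x \<notin> ?B" for x using \<rho> \<rho>' that by (auto dest: permutes_not_in)
    moreover have "\<pi> x = x" "\<pi>' x = x" if "x \<notin> ?A" for x using \<pi> \<pi>' that by (auto dest: permutes_not_in)
    moreover have "\<rho> x \<notin> ?A" "\<rho>' x \<notin> ?A" if "x \<in> ?B" for x
      using permutes_in_image[OF \<rho>, of x] permutes_in_image[OF \<rho>', of x] that by auto
    ultimately have "\<rho> x = \<rho>' x" for x using fun_cong[OF eq', of x] by (metis comp_apply)
    then have "\<rho> = \<rho>'" by blast
    moreover from this have "\<pi> = \<pi>'"
      using eq' permutes_surj[OF \<rho>'] by (metis comp_assoc comp_id surj_iff)
    ultimately show "s = s' \<and> (\<pi>, \<rho>) = (\<pi>', \<rho>')" using \<open>s = s'\<close> by simp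
  qed
  show "(\<lambda>(s, \<pi>, \<rho>). s \<circ> (\<pi> \<circ> \<rho>)) ` ?S = {\<sigma>. \<sigma> permutes ?N}"
  proof (intro equalityI subsetI)
    fix \<sigma> assume "\<sigma> \<in> (\<lambda>(s, \<pi>, \<rho>). s \<circ> (\<pi> \<circ> \<rho>)) ` ?S"
    then obtain s \<pi> \<rho> where "\<sigma> = s \<circ> (\<pi> \<circ> \<rho>)" "s permutes ?N" "\<pi> permutes ?A" "\<rho> permutes ?B"
      by (auto simp: shuffle_perms_def)
    then show "\<sigma> \<in> {\<sigma>. \<sigma> permutes ?N}"
      using permutes_subset[OF _ sub(1), of \<pi>] permutes_subset[OF _ sub(2), of \<rho>]
      by (simp add: permutes_compose)
  next
    fix \<sigma> assume "\<sigma> \<in> {\<sigma>. \<sigma> permutes ?N}"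
    then have \<sigma>: "\<sigma> permutes ?N" by simp
    have cA: "card (\<sigma> ` ?A) = k" and cB: "card (\<sigma> ` ?B) = l"
      using permutes_inj_on[OF \<sigma>] by (auto simp: card_image)
    obtain f where f: "bij_betw f ?A (\<sigma> ` ?A)" "strict_mono_on ?A f"
      using ex_strict_mono_on_bij_betw[OF _ cA, of 1] by (auto simp: atLeastLessThanSuc_atLeastAtMost)
    obtain g where g: "bij_betw g ?B (\<sigma> ` ?B)" "strict_mono_on ?B g"
      using ex_strict_mono_on_bij_betw[OF _ cB, of "k + 1"] by (auto simp: atLeastLessThanSuc_atLeastAtMost)
    \<comment> \<open>The representative enumerates \<sigma>(A) and \<sigma>(B) in increasing
      order.\<close>
    define s where "s x = (if x \<in> ?A then f x else if x \<in> ?B then g x else x)" for x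
    have sA: "bij_betw s ?A (\<sigma> ` ?A)" using f(1) by (rule bij_betw_cong[THEN iffD1, rotated]) (auto simp: s_def)
    have sB: "bij_betw s ?B (\<sigma> ` ?B)" using g(1) by (rule bij_betw_cong[THEN iffD1, rotated]) (auto simp: s_def)
    have AB: "?A \<union> ?B = ?N" by auto
    have "\<sigma> ` ?A \<inter> \<sigma> ` ?B = {}" by (simp add: image_Int[OF permutes_inj[OF \<sigma>], symmetric])
    then have "bij_betw s (?A \<union> ?B) (\<sigma> ` ?A \<union> \<sigma> ` ?B)" by (rule bij_betw_combine[OF sA sB])
    then have "bij_betw s ?N ?N" using permutes_image[OF \<sigma>] by (simp only: AB image_Un[symmetric])
    then have sN: "s permutes ?N" by (rule bij_imp_permutes) (auto simp: s_def)
    have "strict_mono_on ?A s" "strict_mono_on ?B s"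
      using f(2) g(2) by (auto simp: s_def strict_mono_on_def)
    with sN have sh: "s \<in> shuffle_perms k l" by (simp add: shuffle_perms_def)
    \<comment> \<open>As s and \<sigma> agree on the images of the blocks, \<tau> preserves each
      block and splits into \<pi> and \<rho>.\<close>
    define \<tau> where "\<tau> = Hilbert_Choice.inv s \<circ> \<sigma>"
    have \<tau>: "\<tau> permutes ?N" unfolding \<tau>_def by (intro permutes_compose \<sigma> permutes_inv sN)
    have \<tau>A: "\<tau> ` ?A = ?A"
      using sA permutes_inj[OF sN] unfolding \<tau>_def bij_betw_def by (metis image_comp image_inv_f_f)
    have \<tau>B: "\<tau> ` ?B = ?B"
      using sB permutes_inj[OF sN] unfolding \<tau>_def bij_betw_def by (metis image_comp image_inv_f_f)
    define \<pi> where "\<pi> x = (if x \<in> ?A then \<tau> x else x)" for x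
    define \<rho> where "\<rho> x = (if x \<in> ?B then \<tau> x else x)" for x
    have "bij_betw \<tau> ?A ?A" using \<tau>A permutes_inj_on[OF \<tau>] by (simp add: bij_betw_def)
    then have "bij_betw \<pi> ?A ?A" by (rule bij_betw_cong[THEN iffD1, rotated]) (simp add: \<pi>_def)
    then have \<pi>: "\<pi> permutes ?A" by (rule bij_imp_permutes) (auto simp: \<pi>_def)
    have "bij_betw \<tau> ?B ?B" using \<tau>B permutes_inj_on[OF \<tau>] by (simp add: bij_betw_def)
    then have "bij_betw \<rho> ?B ?B" by (rule bij_betw_cong[THEN iffD1, rotated]) (simp add: \<rho>_def)
    then have \<rho>: "\<rho> permutes ?B" by (rule bij_imp_permutes) (auto simp: \<rho>_def)
    have "\<tau> x = (\<pi> \<circ> \<rho>) x" for x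
    proof -
      consider "x \<in> ?A" | "x \<in> ?B" | "x \<notin> ?N" by fastforce
      then show ?thesis
      proof cases
        case 2
        then have "\<tau> x \<in> ?B" using \<tau>B by blast
        then show ?thesis using 2 by (simp add: \<pi>_def \<rho>_def)
      next
        case 3
        then show ?thesis using permutes_not_in[OF \<tau> 3] by (auto simp: \<pi>_def \<rho>_def)
      qed (simp add: \<pi>_def \<rho>_def)
    qed
    then have "\<tau> = \<pi> \<circ> \<rho>" by (rule ext)
    moreover have "s \<circ> \<tau> = \<sigma>"
      unfolding \<tau>_def by (simp add: comp_assoc[symmetric] permutes_inv_o[OF sN])
    ultimately have "\<sigma> = s \<circ> (\<pi> \<circ> \<rho>)" by simp
    then show "\<sigma> \<in> (\<lambda>(s, \<pi>, \<rho>). s \<circ> (\<pi> \<circ> \<rho>)) ` ?S"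
      using sh \<pi> \<rho> by (intro image_eqI[of _ _ "(s, \<pi>, \<rho>)"]) auto
  qed
qed

text \<open>Each coset of Sym_k x Sym_l contributes k! l! equal terms. In characteristic 0 the sum
  over shuffles therefore vanishes together with the full antisymmetrization, for which the degree
  argument is available.\<close>

lemma sum_permutations_eq_sum_shuffles:
  fixes g :: "(nat \<Rightarrow> nat) \<Rightarrow> 'a::{idom,ring_char_0}"
  assumes 1: "\<And>\<sigma> \<pi>. \<sigma> permutes {1..k + l} \<Longrightarrow> \<pi> permutes {1..k} \<Longrightarrow> g (\<sigma> \<circ> \<pi>) = g \<sigma>"
    and 2: "\<And>\<sigma> \<rho>. \<sigma> permutes {1..k + l} \<Longrightarrow> \<rho> permutes {k + 1..k + l} \<Longrightarrow> g (\<sigma> \<circ> \<rho>) = g \<sigma>"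
  shows "(\<Sum>\<sigma> | \<sigma> permutes {1..k + l}. g \<sigma>) = fact k * fact l * (\<Sum>s\<in>shuffle_perms k l. g s)"
proof -
  let ?A = "{\<pi>. \<pi> permutes {1..k}}" and ?B = "{\<rho>. \<rho> permutes {k + 1..k + l}}"
  have "(\<Sum>\<sigma> | \<sigma> permutes {1..k + l}. g \<sigma>) =
      (\<Sum>(s, \<pi>, \<rho>)\<in>shuffle_perms k l \<times> ?A \<times> ?B. g (s \<circ> (\<pi> \<circ> \<rho>)))"
    by (subst sum.reindex_bij_betw[OF shuffle_decomposition, symmetric]) (simp add: case_prod_unfold)
  also have "\<dots> = (\<Sum>(s, \<pi>, \<rho>)\<in>shuffle_perms k l \<times> ?A \<times> ?B. g s)"
  proof (rule sum.cong, simp, clarify)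
    fix s \<pi> \<rho>
    assume s: "s \<in> shuffle_perms k l" and \<pi>: "\<pi> permutes {1..k}" and \<rho>: "\<rho> permutes {k + 1..k + l}"
    then have "s permutes {1..k + l}" by (simp add: shuffle_perms_def)
    moreover from this have "s \<circ> \<pi> permutes {1..k + l}"
      using permutes_subset[OF \<pi>, of "{1..k + l}"] by (intro permutes_compose) auto
    ultimately show "g (s \<circ> (\<pi> \<circ> \<rho>)) = g s" using 1[of s \<pi>] 2[of "s \<circ> \<pi>" \<rho>] \<pi> \<rho> by (simp add: comp_assoc)
  qed
  also have "\<dots> = fact k * fact l * (\<Sum>s\<in>shuffle_perms k l. g s)"
  proof -
    have "card ?A = fact k" "card ?B = fact l" by (auto intro!: card_permutations)
    then have "of_nat (card (?A \<times> ?B)) = (fact k * fact l :: 'a)"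
      by (simp only: card_cartesian_product of_nat_mult of_nat_fact)
    then show ?thesis
      by (simp only: sum.cartesian_product'[of "\<lambda>x. g (fst x)" "shuffle_perms k l" "?A \<times> ?B"]
          sum_constant case_prod_unfold fst_conv sum_distrib_left)
  qed
  finally show ?thesis .
qed

section \<open>Symbols of nested Wronskians and their antisymmetrizations\<close>

lemma map_permutation_diff:
  fixes c n :: nat
  assumes "\<pi> permutes {c..<c + n}"
  shows "map_permutation {c..<c + n} (\<lambda>x. x - c) \<pi> permutes {0..<n}"
    and "sign (map_permutation {c..<c + n} (\<lambda>x. x - c) \<pi>) = sign \<pi>"
    and "j < n \<Longrightarrow> c + map_permutation {c..<c + n} (\<lambda>x. x - c) \<pi> j = \<pi> (c + j)"
proof -
  have inj: "inj_on (\<lambda>x. x - c) {c..<c + n}" by (auto simp: inj_on_def)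
  have im: "(\<lambda>x. x - c) ` {c..<c + n} = {0..<n}" by (auto simp: image_iff intro!: bexI[of _ "c + _"])
  show "map_permutation {c..<c + n} (\<lambda>x. x - c) \<pi> permutes {0..<n}"
    using map_permutation_permutes[OF _ assms, of "\<lambda>x. x - c" "{0..<n}"] inj im by (simp add: bij_betw_def)
  show "sign (map_permutation {c..<c + n} (\<lambda>x. x - c) \<pi>) = sign \<pi>"
    using inj assms by (intro sign_map_permutation) auto
  assume "j < n"
  then have "c + j \<in> {c..<c + n}" by simp
  then have "map_permutation {c..<c + n} (\<lambda>x. x - c) \<pi> j = \<pi> (c + j) - c" "\<pi> (c + j) \<ge> c"
    using map_permutation_apply[OF inj, of "c + j" \<pi>] permutes_in_image[OF assms, of "c + j"] by auto
  then show "c + map_permutation {c..<c + n} (\<lambda>x. x - c) \<pi> j = \<pi> (c + j)" by simp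
qed

text \<open>The symbol of \<open>V (a\<^sub>1, \<dots>, a\<^sub>k, V (a\<^sub>k\<^sub>+\<^sub>1, \<dots>, a\<^sub>k\<^sub>+\<^sub>q\<^sub>+\<^sub>1))\<close>.\<close>

definition nested_vandermonde :: "nat \<Rightarrow> nat \<Rightarrow> (nat \<Rightarrow> 'a::comm_ring_1) \<Rightarrow> 'a" where
  "nested_vandermonde k q z =
    vandermonde k (\<lambda>j. if j < k then z (Suc j) else \<Sum>m\<in>{k + 1..k + q + 1}. z m) *
    vandermonde q (\<lambda>m. z (k + 1 + m))"

text \<open>The permutation acts on the first k arguments of the outer determinant; its last
  argument and the inner determinant involve other variables.\<close>

lemma nested_vandermonde_permute_outer:
  assumes \<pi>: "\<pi> permutes {1..k}"
  shows "nested_vandermonde k q (z \<circ> \<pi>) = of_int (sign \<pi>) * nested_vandermonde k q z"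
proof -
  have \<pi>': "\<pi> permutes {1..<1 + k}" using \<pi> by (simp add: atLeastLessThanSuc_atLeastAtMost)
  note m = map_permutation_diff[OF \<pi>']
  let ?p = "map_permutation {1..<1 + k} (\<lambda>x. x - 1) \<pi>"
  have p: "?p permutes {0..k}" by (rule permutes_subset[OF m(1)]) auto
  have fix1: "\<pi> x = x" if "x > k" for x using permutes_not_in[OF \<pi>] that by auto
  let ?f = "\<lambda>z j. if j < k then z (Suc j) else \<Sum>m\<in>{k + 1..k + q + 1}. z m"
  have "vandermonde k (?f (z \<circ> \<pi>)) = vandermonde k (?f z \<circ> ?p)"
  proof (rule alternant_cong)
    fix j assume "j \<le> k"
    show "?f (z \<circ> \<pi>) j = (?f z \<circ> ?p) j"
    proof (cases "j < k")
      case True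
      then have "?p j < k" using permutes_in_image[OF m(1), of j] by auto
      then show ?thesis using True m(3)[OF True] by simp
    next
      case False
      then have "?p j = j" using permutes_not_in[OF m(1), of j] by auto
      then show ?thesis using False by (auto simp: fix1 intro!: sum.cong)
    qed
  qed
  also have "\<dots> = of_int (sign \<pi>) * vandermonde k (?f z)"
    using alternant_permute_variables[OF p] m(2) by simp
  finally show ?thesis unfolding nested_vandermonde_def by (simp add: fix1 mult.assoc)
qed

text \<open>The outer determinant sees the inner variables only through their symmetric sum, so the
  sign comes from the inner determinant alone.\<close>

lemma nested_vandermonde_permute_inner:
  assumes \<pi>: "\<pi> permutes {k + 1..k + q + 1}"
  shows "nested_vandermonde k q (z \<circ> \<pi>) = of_int (sign \<pi>) * nested_vandermonde k q z"
proof -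
  have \<pi>': "\<pi> permutes {k + 1..<k + 1 + (q + 1)}" using \<pi> by (simp add: atLeastLessThanSuc_atLeastAtMost)
  note m = map_permutation_diff[OF \<pi>']
  let ?p = "map_permutation {k + 1..<k + 1 + (q + 1)} (\<lambda>x. x - (k + 1)) \<pi>"
  have p: "?p permutes {0..q}" using m(1) by (simp add: atLeastLessThanSuc_atLeastAtMost)
  have fix1: "\<pi> x = x" if "x \<le> k" for x using permutes_not_in[OF \<pi>] that by auto
  have sum: "(\<Sum>m\<in>{k + 1..k + q + 1}. (z \<circ> \<pi>) m) = (\<Sum>m\<in>{k + 1..k + q + 1}. z m)"
    by (rule sum.permute[OF \<pi>, symmetric])
  have "vandermonde q (\<lambda>m. (z \<circ> \<pi>) (k + 1 + m)) = vandermonde q ((\<lambda>m. z (k + 1 + m)) \<circ> ?p)"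
    by (rule alternant_cong) (use m(3) in simp)
  also have "\<dots> = of_int (sign \<pi>) * vandermonde q (\<lambda>m. z (k + 1 + m))"
    using alternant_permute_variables[OF p] m(2) by simp
  moreover have "vandermonde k (\<lambda>j. if j < k then (z \<circ> \<pi>) (Suc j) else \<Sum>m\<in>{k + 1..k + q + 1}. (z \<circ> \<pi>) m) =
      vandermonde k (\<lambda>j. if j < k then z (Suc j) else \<Sum>m\<in>{k + 1..k + q + 1}. z m)"
    unfolding sum by (rule alternant_cong) (auto simp: fix1)
  ultimately show ?thesis unfolding nested_vandermonde_def by (simp only:) (simp only: mult_ac)
qed

lemma polynomial_of_degree_nested_vandermonde:
  fixes f :: "nat \<Rightarrow> (nat \<Rightarrow> 'a::comm_ring_1) \<Rightarrow> 'a"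
  assumes "\<And>m. polynomial_of_degree P 1 (f m)"
  shows "polynomial_of_degree P (\<Sum>{0..k} + \<Sum>{0..q}) (\<lambda>z. nested_vandermonde k q (\<lambda>m. f m z))"
  unfolding nested_vandermonde_def
proof (rule polynomial_of_degree_mult)
  show "polynomial_of_degree P (\<Sum>{0..k}) (\<lambda>z. vandermonde k
      (\<lambda>j. if j < k then f (Suc j) z else \<Sum>m\<in>{k + 1..k + q + 1}. f m z))"
  proof (rule polynomial_of_degree_vandermonde)
    fix j
    show "polynomial_of_degree P 1 (\<lambda>z. if j < k then f (Suc j) z else \<Sum>m\<in>{k + 1..k + q + 1}. f m z)"
    proof (cases "j < k")
      case False
      then show ?thesis using polynomial_of_degree_sum[of "{k + 1..k + q + 1}" P 1 f] assms by simp
    qed (use assms in simp)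
  qed
  show "polynomial_of_degree P (\<Sum>{0..q}) (\<lambda>z. vandermonde q (\<lambda>m. f (k + 1 + m) z))"
    by (rule polynomial_of_degree_vandermonde) (rule assms)
qed

lemma gauss_sum_double: "2 * \<Sum>{0..n::nat} = n * (n + 1)"
  by (induction n) (auto simp: sum.atLeast0_atMost_Suc)

lemma nested_vandermonde_antisymmetrization:
  fixes z :: "nat \<Rightarrow> 'a::{idom,ring_char_0}"
  assumes deg: "\<Sum>{0..k} + \<Sum>{0..q} < \<Sum>{..<n}"
  shows "(\<Sum>\<sigma> | \<sigma> permutes {1..n}. of_int (sign \<sigma>) * nested_vandermonde k q (z \<circ> \<sigma>)) = 0"
proof -
  let ?P = "{1..n}"
  \<comment> \<open>Variables outside {1..n} are frozen at their values in z and count as constants.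
    Left commutativity requires this, since its argument 2k + 1 is not permuted.\<close>
  let ?f = "\<lambda>w. nested_vandermonde k q (\<lambda>m. if m \<in> ?P then w m else z m)"
  have "polynomial_of_degree ?P (\<Sum>{0..k} + \<Sum>{0..q}) ?f"
  proof (rule polynomial_of_degree_nested_vandermonde)
    fix m
    show "polynomial_of_degree ?P 1 (\<lambda>w. if m \<in> ?P then w m else z m)"
      by (cases "m \<in> ?P") (auto intro: polynomial_of_degree_var[simplified] polynomial_of_degree_const)
  qed
  then have "(\<Sum>\<sigma> | \<sigma> permutes ?P. of_int (sign \<sigma>) * ?f (z \<circ> \<sigma>)) = 0"
    by (rule antisymmetrization_eq_0[rotated]) (use deg in auto)
  moreover have "(\<lambda>m. if m \<in> ?P then (z \<circ> \<sigma>) m else z m) = z \<circ> \<sigma>" if "\<sigma> permutes ?P" for \<sigma>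
    using permutes_not_in[OF that] by (auto simp: fun_eq_iff)
  ultimately show ?thesis by simp
qed

text \<open>The degree k(k+1)/2 + q(q+1)/2 falls short of (k+q)(k+q+1)/2 by kq, so the full
  antisymmetrization is zero. It equals k! (q+1)! times the sum over shuffles.\<close>

lemma nested_vandermonde_shuffle_sum:
  fixes z :: "nat \<Rightarrow> 'a::{idom,ring_char_0}"
  assumes "k > 0" "q > 0"
  shows "(\<Sum>\<sigma>\<in>shuffle_perms k (q + 1). of_int (sign \<sigma>) * nested_vandermonde k q (z \<circ> \<sigma>)) = 0"
proof -
  let ?g = "\<lambda>\<sigma>. of_int (sign \<sigma>) * nested_vandermonde k q (z \<circ> \<sigma>)"
  have "(\<Sum>\<sigma> | \<sigma> permutes {1..k + (q + 1)}. ?g \<sigma>) =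
      fact k * fact (q + 1) * (\<Sum>s\<in>shuffle_perms k (q + 1). ?g s)"
  proof (rule sum_permutations_eq_sum_shuffles)
    fix \<sigma> \<pi> assume \<sigma>: "\<sigma> permutes {1..k + (q + 1)}"
    have inv: "?g (\<sigma> \<circ> \<pi>) = ?g \<sigma>" if "\<pi> permutes {1..k + (q + 1)}"
      and "nested_vandermonde k q ((z \<circ> \<sigma>) \<circ> \<pi>) = of_int (sign \<pi>) * nested_vandermonde k q (z \<circ> \<sigma>)"
    proof -
      have "?g (\<sigma> \<circ> \<pi>) = of_int (sign \<sigma> * (sign \<pi> * sign \<pi>)) * nested_vandermonde k q (z \<circ> \<sigma>)"
        using that sign_compose_permutes[OF \<sigma> that(1)] by (simp only: comp_assoc of_int_mult mult.assoc) simp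
      then show ?thesis by (simp only: sign_idempotent mult_1_right)
    qed
    show "?g (\<sigma> \<circ> \<pi>) = ?g \<sigma>" if \<pi>: "\<pi> permutes {1..k}"
      by (rule inv, rule permutes_subset[OF \<pi>], simp, rule nested_vandermonde_permute_outer[OF \<pi>])
    show "?g (\<sigma> \<circ> \<pi>) = ?g \<sigma>" if \<pi>: "\<pi> permutes {k + 1..k + (q + 1)}"
      by (rule inv, rule permutes_subset[OF \<pi>], simp, rule nested_vandermonde_permute_inner)
        (use \<pi> in \<open>simp add: add.assoc\<close>)
  qed
  moreover have "(\<Sum>\<sigma> | \<sigma> permutes {1..k + (q + 1)}. ?g \<sigma>) = 0"
  proof (rule nested_vandermonde_antisymmetrization)
    have "k * q > 0" using assms by simp
    then have "2 * (\<Sum>{0..k} + \<Sum>{0..q}) < 2 * \<Sum>{0..k + q}"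
      unfolding distrib_left gauss_sum_double by (simp add: algebra_simps)
    then show "\<Sum>{0..k} + \<Sum>{0..q} < \<Sum>{..<k + (q + 1)}"
      by (simp add: lessThan_Suc_atMost atLeast0AtMost)
  qed
  ultimately have "fact k * fact (q + 1) * (\<Sum>s\<in>shuffle_perms k (q + 1). ?g s) = 0" by simp
  then show ?thesis by (simp only: mult_eq_0_iff fact_nonzero) simp
qed

text \<open>The degree k(k+1) lies below the threshold k(2k-1) precisely for k > 2. At k = 2 both
  are 6, and the antisymmetrization is not zero.\<close>

lemma nested_vandermonde_left_commutative:
  fixes z :: "nat \<Rightarrow> 'a::{idom,ring_char_0}"
  assumes "k \<ge> 3"
  shows "(\<Sum>\<sigma> | \<sigma> permutes {1..2 * k}. of_int (sign \<sigma>) * nested_vandermonde k k (z \<circ> \<sigma>)) = 0"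
proof (rule nested_vandermonde_antisymmetrization)
  obtain m where m: "k = m + 3" using assms by (metis add.commute le_Suc_ex)
  have "{..<2 * k} = {0..2 * k - 1}" using assms by auto
  then have "2 * \<Sum>{..<2 * k} = (2 * k - 1) * (2 * k)"
    using gauss_sum_double[of "2 * k - 1"] assms by simp
  moreover have "k * (k + 1) + k * (k + 1) < (2 * k - 1) * (2 * k)"
    unfolding m by (simp add: algebra_simps)
  ultimately show "\<Sum>{0..k} + \<Sum>{0..k} < \<Sum>{..<2 * k}"
    using gauss_sum_double[of k] by linarith
qed

text \<open>Composing with the transposition of the two outer arguments leaves each summand unchanged.\<close>

lemma nested_vandermonde_left_commutative_2:
  fixes z :: "nat \<Rightarrow> 'a::comm_ring_1"
  shows "2 dvd (\<Sum>\<sigma> | \<sigma> permutes {1..4}. of_int (sign \<sigma>) * nested_vandermonde 2 2 (z \<circ> \<sigma>))"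
proof -
  let ?g = "\<lambda>\<sigma>. of_int (sign \<sigma>) * nested_vandermonde 2 2 (z \<circ> \<sigma>)" and ?t = "transpose 1 (2::nat)"
  \<comment> \<open>The order of \<sigma> 1 and \<sigma> 2 selects one permutation from each pair
    \<sigma>, \<sigma> \<circ> t, so the whole sum is twice the part over \<open>?A\<close>.\<close>
  let ?A = "{\<sigma>. \<sigma> permutes {1..4::nat} \<and> \<sigma> 1 < \<sigma> 2}" and ?B = "{\<sigma>. \<sigma> permutes {1..4::nat} \<and> \<sigma> 2 < \<sigma> 1}"
  have t: "?t permutes {1..2}" by (intro permutes_swap_id) auto
  then have t4: "?t permutes {1..4}" by (rule permutes_subset) auto
  have fin: "finite {\<sigma>. \<sigma> permutes {1..4::nat}}" by (rule finite_permutations) simp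
  have "\<sigma> 1 \<noteq> \<sigma> 2" if "\<sigma> permutes {1..4::nat}" for \<sigma>
    using permutes_inj[OF that] by (simp add: inj_eq)
  then have "{\<sigma>. \<sigma> permutes {1..4}} = ?A \<union> ?B"
    using linorder_neqE_nat by blast
  moreover have "?A \<inter> ?B = {}" using less_asym by blast
  moreover have "finite ?A" "finite ?B" by (rule finite_subset[OF _ fin], blast)+
  ultimately have "(\<Sum>\<sigma> | \<sigma> permutes {1..4}. ?g \<sigma>) = sum ?g ?A + sum ?g ?B"
    by (simp only: sum.union_disjoint)
  also have "sum ?g ?B = sum ?g ?A"
  proof (rule sum.reindex_bij_witness[where i = "\<lambda>\<sigma>. \<sigma> \<circ> ?t" and j = "\<lambda>\<sigma>. \<sigma> \<circ> ?t"])
    fix \<sigma> assume "\<sigma> \<in> ?B"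
    then have \<sigma>: "\<sigma> permutes {1..4}" by simp
    have "sign (\<sigma> \<circ> ?t) = - sign \<sigma>"
      using sign_compose_permutes[OF \<sigma> t4] by (simp add: sign_swap_id)
    then show "?g (\<sigma> \<circ> ?t) = ?g \<sigma>"
      using nested_vandermonde_permute_outer[OF t, of 2 "z \<circ> \<sigma>"] by (simp add: sign_swap_id comp_assoc)
  qed (auto simp: comp_assoc intro: permutes_compose[OF t4[unfolded One_nat_def]])
  finally show ?thesis by (simp add: mult_2[symmetric] comp_def)
qed

section \<open>The symbol of the \<open>n\<close>-Lie identity\<close>

text \<open>The variables s_0, ..., s_{k-1} belong to the fixed arguments a_1, ..., a_k and t_0,
  ..., t_k to b_1, ..., b_{k+1}. The minuend is the symbol of V (a, V (b)). In the i-th term the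
  inner factor V (a, b_i) has the variables s and t_i, and the outer one sees t_i together with all
  of s.\<close>

definition lie_defect :: "nat \<Rightarrow> (nat \<Rightarrow> 'a::comm_ring_1) \<Rightarrow> (nat \<Rightarrow> 'a) \<Rightarrow> 'a" where
  "lie_defect k s t =
    vandermonde k (s(k := \<Sum>j\<in>{0..k}. t j)) * vandermonde k t -
    (\<Sum>i\<in>{0..k}. vandermonde k (t(i := t i + (\<Sum>j\<in>{0..<k}. s j))) * vandermonde k (s(k := t i)))"

text \<open>What multiplies c_n in the defect once V(s_0, ..., s_{k-1}, x) is written as the sum of
  the c_n x^n: the value x = t_0 + ... + t_k yields the minuend, the values x = t_i yield the double
  sum by \<open>sum_shifted_vandermonde\<close>.\<close>

definition lie_defect_coeff :: "nat \<Rightarrow> 'a::comm_ring_1 \<Rightarrow> (nat \<Rightarrow> 'a) \<Rightarrow> nat \<Rightarrow> 'a" where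
  "lie_defect_coeff k s t n = (\<Sum>j\<in>{0..k}. t j) ^ n * vandermonde k t -
    (\<Sum>m\<in>{0..k}. \<Sum>r\<le>m. of_nat (m choose r) * s ^ r * alternant k (id(m := m - r + n)) t)"

text \<open>The defect is the sum of c_n times \<open>lie_defect_coeff\<close>. Because c_k = - S
  c_{k+1}, the two highest terms merge, and divisibility is asked only of their combination.\<close>

lemma dvd_lie_defect:
  fixes s t :: "nat \<Rightarrow> 'a::{idom,ring_char_0}" and k :: nat
  defines "S \<equiv> \<Sum>j\<in>{0..k}. s j"
  assumes low: "\<And>n. n < k \<Longrightarrow> p dvd lie_defect_coeff (Suc k) S t n"
    and top: "p dvd lie_defect_coeff (Suc k) S t (Suc k) - S * lie_defect_coeff (Suc k) S t k"
  shows "p dvd lie_defect (Suc k) s t"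
proof -
  obtain c where c: "\<And>x. vandermonde (Suc k) (s(Suc k := x)) = (\<Sum>n\<in>{0..Suc k}. c n * x ^ n)"
    and ck: "c k = - (S * c (Suc k))"
    unfolding S_def using vandermonde_last_variable[where z = s and k = k] by metis
  let ?T = "\<Sum>j\<in>{0..Suc k}. t j" and ?G = "lie_defect_coeff (Suc k) S t"
  have S: "(\<Sum>j\<in>{0..<Suc k}. s j) = S" by (simp add: S_def atLeastLessThanSuc_atLeastAtMost)
  have "(\<Sum>i\<in>{0..Suc k}. vandermonde (Suc k) (t(i := t i + S)) * vandermonde (Suc k) (s(Suc k := t i))) =
      (\<Sum>n\<in>{0..Suc k}. c n * (\<Sum>i\<in>{0..Suc k}. t i ^ n * vandermonde (Suc k) (t(i := t i + S))))"
    unfolding c sum_distrib_left by (subst sum.swap) (intro sum.cong refl, simp only: mult_ac)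
  then have "lie_defect (Suc k) s t = (\<Sum>n\<in>{0..Suc k}. c n * ?G n)"
    unfolding lie_defect_def lie_defect_coeff_def S sum_shifted_vandermonde c
    by (simp only: sum_distrib_right right_diff_distrib sum_subtractf mult.assoc)
  also have "\<dots> = (\<Sum>n\<in>{0..<k}. c n * ?G n) + c (Suc k) * (?G (Suc k) - S * ?G k)"
    by (simp add: sum.atLeast0_atMost_Suc atLeastLessThanSuc_atLeastAtMost[symmetric] ck algebra_simps)
  finally show ?thesis
    using low top by (auto intro!: dvd_add dvd_sum)
qed

section \<open>Straightening alternants with three, four or five exponents\<close>

lemma alternant_upd_eq_neg:
  fixes z :: "nat \<Rightarrow> 'a::{idom,ring_char_0}"
  assumes "i < length es" "j < length es" "i \<noteq> j" "length es = Suc k"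
  shows "alternant k ((!) (es[i := es ! j, j := es ! i])) z = - alternant k ((!) es) z"
proof -
  have "alternant k ((!) (es[i := es ! j, j := es ! i])) z = alternant k ((!) es \<circ> transpose i j) z"
    by (rule alternant_cong_exponents) (use assms in \<open>auto simp: nth_list_update transpose_def\<close>)
  also have "\<dots> = - alternant k ((!) es) z"
    using assms by (subst alternant_permute_exponents) (auto intro!: permutes_swap_id simp: sign_swap_id)
  finally show ?thesis .
qed

lemma alternant_swap_adjacent:
  fixes z :: "nat \<Rightarrow> 'a::{idom,ring_char_0}"
  assumes "length xs + length ys + 2 = Suc k"
  shows "alternant k ((!) (xs @ a # b # ys)) z = - alternant k ((!) (xs @ b # a # ys)) z"
  using alternant_upd_eq_neg[of "length xs" "xs @ b # a # ys" "Suc (length xs)" k z] assms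
  by (simp add: list_update_append nth_append)

lemma alternant_eq_adjacent:
  fixes z :: "nat \<Rightarrow> 'a::{idom,ring_char_0}"
  assumes "length xs + length ys + 2 = Suc k"
  shows "alternant k ((!) (xs @ a # a # ys)) z = 0"
  using alternant_swap_adjacent[OF assms, of a a z] by (rule eq_minus_self_imp_0)

lemma alternant_eq_list:
  "alternant k e z = alternant k ((!) (map e [0..<Suc k])) z"
  by (rule alternant_cong_exponents) (simp del: upt_Suc)

text \<open>With the exponents as separate arguments, sorting them at the cost of a sign becomes
  rewriting. The same holds for four and five exponents.\<close>

definition alternant3 :: "(nat \<Rightarrow> 'a::comm_ring_1) \<Rightarrow> nat \<Rightarrow> nat \<Rightarrow> nat \<Rightarrow> 'a" where
  "alternant3 z a b c = alternant 2 ((!) [a, b, c]) z"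

definition alternant4 :: "(nat \<Rightarrow> 'a::comm_ring_1) \<Rightarrow> nat \<Rightarrow> nat \<Rightarrow> nat \<Rightarrow> nat \<Rightarrow> 'a" where
  "alternant4 z a b c d = alternant 3 ((!) [a, b, c, d]) z"

definition alternant5 :: "(nat \<Rightarrow> 'a::comm_ring_1) \<Rightarrow> nat \<Rightarrow> nat \<Rightarrow> nat \<Rightarrow> nat \<Rightarrow> nat \<Rightarrow> 'a" where
  "alternant5 z a b c d e = alternant 4 ((!) [a, b, c, d, e]) z"

lemma alternant_eq_alternant3: "alternant 2 e z = alternant3 z (e 0) (e 1) (e 2)"
  unfolding alternant3_def by (subst alternant_eq_list) (simp add: upt_rec numeral_eq_Suc)

lemma alternant_eq_alternant4: "alternant 3 e z = alternant4 z (e 0) (e 1) (e 2) (e 3)"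
  unfolding alternant4_def by (subst alternant_eq_list) (simp add: upt_rec numeral_eq_Suc)

lemma alternant_eq_alternant5: "alternant 4 e z = alternant5 z (e 0) (e 1) (e 2) (e 3) (e 4)"
  unfolding alternant5_def by (subst alternant_eq_list) (simp add: upt_rec numeral_eq_Suc)

text \<open>The guards orient the sign rule, so that rewriting is a terminating bubble sort which
  ends in increasing exponents or in 0.\<close>

lemma alternant3_sort:
  fixes z :: "nat \<Rightarrow> 'a::{idom,ring_char_0}"
  shows "b < a \<Longrightarrow> alternant3 z a b c = - alternant3 z b a c"
    and "c < b \<Longrightarrow> alternant3 z a b c = - alternant3 z a c b"
    and "alternant3 z a a c = 0" and "alternant3 z a b b = 0"
  unfolding alternant3_def
  using alternant_swap_adjacent[of "[]" "[c]" 2] alternant_swap_adjacent[of "[a]" "[]" 2]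
    alternant_eq_adjacent[of "[]" "[c]" 2] alternant_eq_adjacent[of "[a]" "[]" 2]
  by simp_all

lemma alternant4_sort:
  fixes z :: "nat \<Rightarrow> 'a::{idom,ring_char_0}"
  shows "b < a \<Longrightarrow> alternant4 z a b c d = - alternant4 z b a c d"
    and "c < b \<Longrightarrow> alternant4 z a b c d = - alternant4 z a c b d"
    and "d < c \<Longrightarrow> alternant4 z a b c d = - alternant4 z a b d c"
    and "alternant4 z a a c d = 0" and "alternant4 z a b b d = 0" and "alternant4 z a b c c = 0"
  unfolding alternant4_def
  using alternant_swap_adjacent[of "[]" "[c, d]" 3] alternant_swap_adjacent[of "[a]" "[d]" 3]
    alternant_swap_adjacent[of "[a, b]" "[]" 3]
    alternant_eq_adjacent[of "[]" "[c, d]" 3] alternant_eq_adjacent[of "[a]" "[d]" 3]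
    alternant_eq_adjacent[of "[a, b]" "[]" 3]
  by simp_all

lemma alternant5_sort:
  fixes z :: "nat \<Rightarrow> 'a::{idom,ring_char_0}"
  shows "b < a \<Longrightarrow> alternant5 z a b c d e = - alternant5 z b a c d e"
    and "c < b \<Longrightarrow> alternant5 z a b c d e = - alternant5 z a c b d e"
    and "d < c \<Longrightarrow> alternant5 z a b c d e = - alternant5 z a b d c e"
    and "e < d \<Longrightarrow> alternant5 z a b c d e = - alternant5 z a b c e d"
    and "alternant5 z a a c d e = 0" and "alternant5 z a b b d e = 0"
    and "alternant5 z a b c c e = 0" and "alternant5 z a b c d d = 0"
  unfolding alternant5_def
  using alternant_swap_adjacent[of "[]" "[c, d, e]" 4] alternant_swap_adjacent[of "[a]" "[d, e]" 4]
    alternant_swap_adjacent[of "[a, b]" "[e]" 4] alternant_swap_adjacent[of "[a, b, c]" "[]" 4]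
    alternant_eq_adjacent[of "[]" "[c, d, e]" 4] alternant_eq_adjacent[of "[a]" "[d, e]" 4]
    alternant_eq_adjacent[of "[a, b]" "[e]" 4] alternant_eq_adjacent[of "[a, b, c]" "[]" 4]
  by simp_all

section \<open>The n-Lie defect for k = 1, 2, 3, 4\<close>

lemma atLeast0AtMost_numerals:
  "{0..Suc 0} = {0, 1}" "{0..2::nat} = {0, 1, 2}" "{0..3::nat} = {0, 1, 2, 3}" "{0..4::nat} = {0, 1, 2, 3, 4}"
  by auto

lemma atMost_numerals:
  "{..0::nat} = {0}" "{..Suc 0} = {0, 1}" "{..2::nat} = {0, 1, 2}" "{..3::nat} = {0, 1, 2, 3}"
  "{..4::nat} = {0, 1, 2, 3, 4}"
  by auto

lemma sum_times_alternant3: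
  "(\<Sum>j\<in>{0..2}. z j) * alternant3 z a b c =
    alternant3 z (Suc a) b c + alternant3 z a (Suc b) c + alternant3 z a b (Suc c)"
  using sum_variables_times_alternant[of z 2 "(!) [a, b, c]"]
  unfolding alternant_eq_alternant3 by (simp add: atLeast0AtMost_numerals add.assoc)

lemma sum_times_alternant4:
  "(\<Sum>j\<in>{0..3}. z j) * alternant4 z a b c d =
    alternant4 z (Suc a) b c d + alternant4 z a (Suc b) c d +
    alternant4 z a b (Suc c) d + alternant4 z a b c (Suc d)"
  using sum_variables_times_alternant[of z 3 "(!) [a, b, c, d]"]
  unfolding alternant_eq_alternant4 by (simp add: atLeast0AtMost_numerals add.assoc)

lemma sum_times_alternant5:
  "(\<Sum>j\<in>{0..4}. z j) * alternant5 z a b c d e =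
    alternant5 z (Suc a) b c d e + alternant5 z a (Suc b) c d e +
    alternant5 z a b (Suc c) d e + alternant5 z a b c (Suc d) e + alternant5 z a b c d (Suc e)"
  using sum_variables_times_alternant[of z 4 "(!) [a, b, c, d, e]"]
  unfolding alternant_eq_alternant5 by (simp add: atLeast0AtMost_numerals add.assoc)

text \<open>For k = 1 the operation is the Lie bracket u D(v) - v D(u), and the identity is the
  Jacobi identity. Hence no condition on p arises.\<close>

lemma lie_defect_1:
  fixes s t :: "nat \<Rightarrow> 'a::{idom,ring_char_0}"
  shows "lie_defect 1 s t = 0"
proof -
  have V: "vandermonde 1 z = z 1 - z 0" for z :: "nat \<Rightarrow> 'a"
  proof -
    have "{p. p permutes {0..1::nat}} = {id, transpose 0 1}"
      using permutes_doubleton_iff[of _ 0 "1::nat"] by (auto simp: atLeast0AtMost_numerals)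
    moreover have "id \<noteq> transpose 0 (1::nat)" by (metis id_apply transpose_apply_first zero_neq_one)
    ultimately show ?thesis
      by (simp add: alternant_def sign_swap_id atLeast0AtMost_numerals)
  qed
  show ?thesis unfolding lie_defect_def V by (simp add: atLeast0AtMost_numerals algebra_simps)
qed


lemma choose_small:
  "(2 choose Suc 0) = 2" "(3 choose Suc 0) = 3" "(3 choose 2) = 3"
  "(4 choose Suc 0) = 4" "(4 choose 2) = 6" "(4 choose 3) = 4"
  by (simp_all add: numeral_eq_Suc)


text \<open>For n = 0 all terms with r > 0 repeat an exponent, which leaves V(t) - (k+1) V(t) = - k
  V(t); the same happens for k = 3 and 4. The second equation is the combination required by
  \<open>dvd_lie_defect\<close>, obtained from the Pieri rule and straightening.\<close>

lemma lie_defect_coeff_2: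
  fixes t :: "nat \<Rightarrow> 'a::{idom,ring_char_0}"
  shows "lie_defect_coeff 2 S t 0 = 2 * (- alternant3 t 0 1 2)"
    and "lie_defect_coeff 2 S t 2 - S * lie_defect_coeff 2 S t 1 =
    2 * (alternant3 t 0 2 3 + S ^ 2 * alternant3 t 0 1 2 - S * alternant3 t 0 1 3)"
proof -
  \<comment> \<open>T stays an atom, so that every product with it is resolved by the Pieri rule and
    never expanded into variables.\<close>
  define T where "T = (\<Sum>j\<in>{0..2}. t j)"
  note expand = atLeast0AtMost_numerals atMost_numerals choose_small power2_eq_square
  note normalize = mult.assoc sum_times_alternant3[of t, folded T_def] alternant3_sort distrib_left
    right_diff_distrib mult.left_commute[of T "numeral _"] numeral_2_eq_2[symmetric]
  show "lie_defect_coeff 2 S t 0 = 2 * (- alternant3 t 0 1 2)"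
    unfolding lie_defect_coeff_def T_def[symmetric]
    by (simp add: expand del: fun_upd_apply, simp add: alternant_eq_alternant3, (simp add: normalize)?)
      (simp add: algebra_simps)?
  show "lie_defect_coeff 2 S t 2 - S * lie_defect_coeff 2 S t 1 =
    2 * (alternant3 t 0 2 3 + S ^ 2 * alternant3 t 0 1 2 - S * alternant3 t 0 1 3)"
    unfolding lie_defect_coeff_def T_def[symmetric]
    by (simp add: expand del: fun_upd_apply, simp add: alternant_eq_alternant3, (simp add: normalize)?)
      (simp add: algebra_simps)?
qed

lemma dvd_lie_defect_2:
  fixes s t :: "nat \<Rightarrow> 'a::{idom,ring_char_0}"
  shows "2 dvd lie_defect 2 s t"
proof -
  let ?S = "(\<Sum>j\<in>{0..1}. s j)"
  have "2 dvd lie_defect (Suc 1) s t"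
  proof (rule dvd_lie_defect)
    fix n :: nat assume "n < 1"
    then have "n = 0" by auto
    then show "2 dvd lie_defect_coeff (Suc 1) ?S t n"
      using lie_defect_coeff_2[of ?S t, THEN dvdI] by (auto simp: numeral_2_eq_2[symmetric])
  next
    show "2 dvd lie_defect_coeff (Suc 1) ?S t (Suc 1) - ?S * lie_defect_coeff (Suc 1) ?S t 1"
      using lie_defect_coeff_2(2)[of ?S t, THEN dvdI] by (simp add: numeral_2_eq_2[symmetric])
  qed
  then show ?thesis by (simp add: numeral_2_eq_2[symmetric])
qed

lemma lie_defect_coeff_3:
  fixes t :: "nat \<Rightarrow> 'a::{idom,ring_char_0}"
  shows "lie_defect_coeff 3 S t 0 = 3 * (- alternant4 t 0 1 2 3)"
    and "lie_defect_coeff 3 S t 1 = 3 * (- (2 * S * alternant4 t 0 1 2 3))"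
    and "lie_defect_coeff 3 S t 3 - S * lie_defect_coeff 3 S t 2 =
    3 * (alternant4 t 0 1 3 5 + S ^ 3 * alternant4 t 0 1 2 3 - S * alternant4 t 0 1 2 5)"
proof -
  define T where "T = (\<Sum>j\<in>{0..3}. t j)"
  note expand = atLeast0AtMost_numerals atMost_numerals choose_small power2_eq_square power3_eq_cube
  note normalize = mult.assoc sum_times_alternant4[of t, folded T_def] alternant4_sort distrib_left
    right_diff_distrib mult.left_commute[of T "numeral _"] numeral_2_eq_2[symmetric]
  show "lie_defect_coeff 3 S t 0 = 3 * (- alternant4 t 0 1 2 3)"
    unfolding lie_defect_coeff_def T_def[symmetric]
    by (simp add: expand del: fun_upd_apply, simp add: alternant_eq_alternant4, (simp add: normalize)?)
      (simp add: algebra_simps)?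
  show "lie_defect_coeff 3 S t 1 = 3 * (- (2 * S * alternant4 t 0 1 2 3))"
    unfolding lie_defect_coeff_def T_def[symmetric]
    by (simp add: expand del: fun_upd_apply, simp add: alternant_eq_alternant4, (simp add: normalize)?)
      (simp add: algebra_simps)?
  show "lie_defect_coeff 3 S t 3 - S * lie_defect_coeff 3 S t 2 =
    3 * (alternant4 t 0 1 3 5 + S ^ 3 * alternant4 t 0 1 2 3 - S * alternant4 t 0 1 2 5)"
    unfolding lie_defect_coeff_def T_def[symmetric]
    by (simp add: expand del: fun_upd_apply, simp add: alternant_eq_alternant4, (simp add: normalize)?)
      (simp add: algebra_simps)?
qed

lemma dvd_lie_defect_3:
  fixes s t :: "nat \<Rightarrow> 'a::{idom,ring_char_0}"
  shows "3 dvd lie_defect 3 s t"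
proof -
  let ?S = "(\<Sum>j\<in>{0..2}. s j)"
  have "3 dvd lie_defect (Suc 2) s t"
  proof (rule dvd_lie_defect)
    fix n :: nat assume "n < 2"
    then have "n = 0 \<or> n = 1" by auto
    then show "3 dvd lie_defect_coeff (Suc 2) ?S t n"
      using lie_defect_coeff_3[of ?S t, THEN dvdI] by (auto simp: numeral_2_eq_2[symmetric])
  next
    show "3 dvd lie_defect_coeff (Suc 2) ?S t (Suc 2) - ?S * lie_defect_coeff (Suc 2) ?S t 2"
      using lie_defect_coeff_3(3)[of ?S t, THEN dvdI] by (simp add: numeral_2_eq_2[symmetric])
  qed
  then show ?thesis by (simp add: numeral_2_eq_2[symmetric])
qed

text \<open>The coefficient for n = 0 is - 4 V(t), so that 2 is the only prime in question. All the
  remaining expressions turn out to be even as well.\<close>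

lemma lie_defect_coeff_4:
  fixes t :: "nat \<Rightarrow> 'a::{idom,ring_char_0}"
  shows "lie_defect_coeff 4 S t 0 = 2 * (- (2 * alternant5 t 0 1 2 3 4))"
    and "lie_defect_coeff 4 S t 1 = 2 * (- (5 * S * alternant5 t 0 1 2 3 4))"
    and "lie_defect_coeff 4 S t 2 = 2 * (alternant5 t 0 1 2 4 5 - 2 * S * alternant5 t 0 1 2 3 5 - 5 * S ^ 2 * alternant5 t 0 1 2 3 4)"
    and "lie_defect_coeff 4 S t 4 - S * lie_defect_coeff 4 S t 3 =
    2 * (alternant5 t 0 1 2 5 6 + alternant5 t 0 1 3 4 6 + alternant5 t 0 2 3 4 5 + 2 * alternant5 t 0 1 2 4 7 +
      S ^ 3 * alternant5 t 0 1 2 3 5 + 2 * S ^ 4 * alternant5 t 0 1 2 3 4 -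
      S * alternant5 t 0 1 3 4 5 - 2 * S * alternant5 t 0 1 2 3 7 - S ^ 2 * alternant5 t 0 1 2 3 6)"
proof -
  define T where "T = (\<Sum>j\<in>{0..4}. t j)"
  note expand = atLeast0AtMost_numerals atMost_numerals choose_small power2_eq_square power3_eq_cube power4_eq_xxxx
  note normalize = mult.assoc sum_times_alternant5[of t, folded T_def] alternant5_sort distrib_left
    right_diff_distrib mult.left_commute[of T "numeral _"] numeral_2_eq_2[symmetric]
  show "lie_defect_coeff 4 S t 0 = 2 * (- (2 * alternant5 t 0 1 2 3 4))"
    unfolding lie_defect_coeff_def T_def[symmetric]
    by (simp add: expand del: fun_upd_apply, simp add: alternant_eq_alternant5, (simp add: normalize)?)
      (simp add: algebra_simps)?
  show "lie_defect_coeff 4 S t 1 = 2 * (- (5 * S * alternant5 t 0 1 2 3 4))"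
    unfolding lie_defect_coeff_def T_def[symmetric]
    by (simp add: expand del: fun_upd_apply, simp add: alternant_eq_alternant5, (simp add: normalize)?)
      (simp add: algebra_simps)?
  show "lie_defect_coeff 4 S t 2 = 2 * (alternant5 t 0 1 2 4 5 - 2 * S * alternant5 t 0 1 2 3 5 - 5 * S ^ 2 * alternant5 t 0 1 2 3 4)"
    unfolding lie_defect_coeff_def T_def[symmetric]
    by (simp add: expand del: fun_upd_apply, simp add: alternant_eq_alternant5, (simp add: normalize)?)
      (simp add: algebra_simps)?
  show "lie_defect_coeff 4 S t 4 - S * lie_defect_coeff 4 S t 3 =
    2 * (alternant5 t 0 1 2 5 6 + alternant5 t 0 1 3 4 6 + alternant5 t 0 2 3 4 5 + 2 * alternant5 t 0 1 2 4 7 +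
      S ^ 3 * alternant5 t 0 1 2 3 5 + 2 * S ^ 4 * alternant5 t 0 1 2 3 4 -
      S * alternant5 t 0 1 3 4 5 - 2 * S * alternant5 t 0 1 2 3 7 - S ^ 2 * alternant5 t 0 1 2 3 6)"
    unfolding lie_defect_coeff_def T_def[symmetric]
    by (simp add: expand del: fun_upd_apply, simp add: alternant_eq_alternant5, (simp add: normalize)?)
      (simp add: algebra_simps)?
qed

lemma dvd_lie_defect_4:
  fixes s t :: "nat \<Rightarrow> 'a::{idom,ring_char_0}"
  shows "2 dvd lie_defect 4 s t"
proof -
  let ?S = "(\<Sum>j\<in>{0..3}. s j)"
  have "2 dvd lie_defect (Suc 3) s t"
  proof (rule dvd_lie_defect)
    fix n :: nat assume "n < 3"
    then have "n = 0 \<or> n = 1 \<or> n = 2" by auto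
    then show "2 dvd lie_defect_coeff (Suc 3) ?S t n"
      using lie_defect_coeff_4[of ?S t, THEN dvdI] by (auto simp: numeral_2_eq_2[symmetric])
  next
    show "2 dvd lie_defect_coeff (Suc 3) ?S t (Suc 3) - ?S * lie_defect_coeff (Suc 3) ?S t 3"
      using lie_defect_coeff_4(4)[of ?S t, THEN dvdI] by (simp add: numeral_2_eq_2[symmetric])
  qed
  then show ?thesis by (simp add: numeral_2_eq_2[symmetric])
qed

section \<open>Symbols of multilinear differential expressions\<close>

text \<open>
  Adjoining a unit to the multiplicative semigroup of \<open>U\<close> makes products over arbitrary
  finite index sets available.
\<close>

definition adjoin_unit :: "('u, 'm) ring_scheme \<Rightarrow> 'u option monoid" where
  "adjoin_unit U = \<lparr>carrier = insert None (Some ` carrier U),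
    monoid.mult = (\<lambda>x y. case x of None \<Rightarrow> y | Some a \<Rightarrow>
      (case y of None \<Rightarrow> x | Some b \<Rightarrow> Some (a \<otimes>\<^bsub>U\<^esub> b))),
    one = None\<rparr>"

text \<open>Meaningful for finite nonempty S only: the empty product is the adjoined unit
  \<open>None\<close>, at which \<open>the\<close> is unspecified.\<close>

definition set_prod :: "('u, 'm) ring_scheme \<Rightarrow> ('i \<Rightarrow> 'u) \<Rightarrow> 'i set \<Rightarrow> 'u" where
  "set_prod U f S = the (finprod (adjoin_unit U) (\<lambda>s. Some (f s)) S)"

section \<open>Symbols as integer polynomials in finitely many variables\<close>

type_synonym symbol = "(nat \<Rightarrow>\<^sub>0 nat) \<Rightarrow>\<^sub>0 int"

definition var :: "nat \<Rightarrow> symbol" where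
  "var s = frag_of (Poly_Mapping.single s 1)"

text \<open>Evaluation over S disregards the exponents of variables outside S. This confinement is
  what lets products of symbols match products of values.\<close>

definition vars_in :: "nat set \<Rightarrow> symbol \<Rightarrow> bool" where
  "vars_in S c \<longleftrightarrow> Poly_Mapping.keys c \<subseteq> {e. Poly_Mapping.keys e \<subseteq> S}"

lemma vars_in_0 [simp]: "vars_in S 0" by (simp add: vars_in_def)

lemma vars_in_1 [simp]: "vars_in S 1" by (simp add: vars_in_def)

lemma vars_in_var: "s \<in> S \<Longrightarrow> vars_in S (var s)" by (simp add: vars_in_def var_def)

lemma vars_in_add: "vars_in S c \<Longrightarrow> vars_in S d \<Longrightarrow> vars_in S (c + d)"
  unfolding vars_in_def using Poly_Mapping.keys_add[of c d] by blast

lemma vars_in_mult: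
  assumes "vars_in S c" "vars_in S d"
  shows "vars_in S (c * d)"
  unfolding vars_in_def
proof
  fix e assume "e \<in> Poly_Mapping.keys (c * d)"
  then obtain e1 e2 where "e = e1 + e2" "e1 \<in> Poly_Mapping.keys c" "e2 \<in> Poly_Mapping.keys d"
    using keys_mult[of c d] by blast
  then show "e \<in> {e. Poly_Mapping.keys e \<subseteq> S}"
    using assms Poly_Mapping.keys_add[of e1 e2] unfolding vars_in_def by blast
qed

lemma vars_in_sum: "(\<And>i. i \<in> I \<Longrightarrow> vars_in S (f i)) \<Longrightarrow> vars_in S (\<Sum>i\<in>I. f i)"
  by (induction I rule: infinite_finite_induct) (auto intro: vars_in_add)

lemma vars_in_prod: "(\<And>i. i \<in> I \<Longrightarrow> vars_in S (f i)) \<Longrightarrow> vars_in S (\<Prod>i\<in>I. f i)"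
  by (induction I rule: infinite_finite_induct) (auto intro: vars_in_mult)

lemma vars_in_power: "vars_in S c \<Longrightarrow> vars_in S (c ^ n)"
  by (induction n) (auto intro: vars_in_mult)

lemma vars_in_of_int: "vars_in S (of_int n)"
  unfolding vars_in_def single_of_int[symmetric] by (simp add: keys_single)

lemma vars_in_mono: "vars_in S c \<Longrightarrow> S \<subseteq> T \<Longrightarrow> vars_in T c"
  unfolding vars_in_def by blast

lemma vars_in_vandermonde: "(\<And>j. j \<le> k \<Longrightarrow> vars_in S (z j)) \<Longrightarrow> vars_in S (vandermonde k z)"
  unfolding alternant_def
  by (intro vars_in_sum vars_in_mult vars_in_of_int vars_in_prod vars_in_power) auto

lemma lookup_of_int_mult: "Poly_Mapping.lookup (of_int n * c) e = n * Poly_Mapping.lookup (c :: symbol) e"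
proof -
  have "of_int n * c = Poly_Mapping.map ((*) n) c"
    unfolding mult_map_scale_conv_mult by (simp only: single_of_int[symmetric] of_int_eq_id id_apply)
  then show ?thesis by (simp add: Poly_Mapping.map.rep_eq when_def)
qed

text \<open>This and the next two lemmas serve D, multiplication by an element of U or of K, and the
  Wronskian as a function of one argument.\<close>

lemma (in abelian_group) additive_zero:
  assumes "\<phi> \<in> carrier G \<rightarrow> carrier G"
    and "\<And>x y. x \<in> carrier G \<Longrightarrow> y \<in> carrier G \<Longrightarrow> \<phi> (x \<oplus> y) = \<phi> x \<oplus> \<phi> y"
  shows "\<phi> \<zero> = \<zero>"
proof -
  have c: "\<phi> \<zero> \<in> carrier G" using assms(1) by auto
  have "\<phi> \<zero> \<oplus> \<phi> \<zero> = \<phi> \<zero>" using assms(2)[of \<zero> \<zero>] by simp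
  then show ?thesis using c by simp
qed

lemma (in abelian_group) additive_finsum:
  assumes \<phi>: "\<phi> \<in> carrier G \<rightarrow> carrier G"
    and add: "\<And>x y. x \<in> carrier G \<Longrightarrow> y \<in> carrier G \<Longrightarrow> \<phi> (x \<oplus> y) = \<phi> x \<oplus> \<phi> y"
    and f: "f \<in> A \<rightarrow> carrier G"
  shows "\<phi> (\<Oplus>i\<in>A. f i) = (\<Oplus>i\<in>A. \<phi> (f i))"
  using f
proof (induction A rule: infinite_finite_induct)
  case (insert x A)
  moreover from this have "(\<lambda>i. \<phi> (f i)) \<in> A \<rightarrow> carrier G" "\<phi> (f x) \<in> carrier G"
    using \<phi> by (auto simp: Pi_iff)
  ultimately show ?case by (simp add: add)
qed (use additive_zero[OF \<phi> add] in auto)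

lemma (in abelian_group) additive_int_pow:
  assumes \<phi>: "\<phi> \<in> carrier G \<rightarrow> carrier G"
    and add: "\<And>x y. x \<in> carrier G \<Longrightarrow> y \<in> carrier G \<Longrightarrow> \<phi> (x \<oplus> y) = \<phi> x \<oplus> \<phi> y"
    and x: "x \<in> carrier G"
  shows "\<phi> ([n] \<cdot> x) = [(n::int)] \<cdot> \<phi> x"
proof -
  have nat: "\<phi> ([m] \<cdot> x) = [m] \<cdot> \<phi> x" for m :: nat
    using \<phi> x by (induction m) (auto simp: add additive_zero[OF \<phi> add])
  have minus: "\<phi> (\<ominus> y) = \<ominus> \<phi> y" if y: "y \<in> carrier G" for y
  proof -
    have "\<phi> (\<ominus> y) \<oplus> \<phi> y = \<zero>"
      using add[of "\<ominus> y" y] y additive_zero[OF \<phi> add] by (simp add: l_neg)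
    then show ?thesis using \<phi> y by (intro minus_equality[symmetric]) auto
  qed
  show ?thesis
    by (cases "n \<ge> 0") (use x in \<open>auto simp: add_pow_int_ge add_pow_int_lt nat minus\<close>)
qed

section \<open>Unit-free products and the evaluation of symbols\<close>

context differential_algebra
begin

lemma comm_monoid_adjoin_unit: "comm_monoid (adjoin_unit U)"
  by (rule comm_monoidI)
    (auto simp: adjoin_unit_def mult_assoc mult_closed split: option.splits intro: mult_comm)

lemma adjoin_unit_simps:
  "Some x \<in> carrier (adjoin_unit U) \<longleftrightarrow> x \<in> carrier U"
  "Some x \<otimes>\<^bsub>adjoin_unit U\<^esub> Some y = Some (x \<otimes>\<^bsub>U\<^esub> y)"
  by (auto simp: adjoin_unit_def)

lemma finprod_adjoin_unit:
  assumes "finite S" "S \<noteq> {}" "f \<in> S \<rightarrow> carrier U"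
  shows "finprod (adjoin_unit U) (\<lambda>s. Some (f s)) S = Some (set_prod U f S)"
    and "set_prod U f S \<in> carrier U"
proof -
  interpret A: comm_monoid "adjoin_unit U" by (rule comm_monoid_adjoin_unit)
  have "\<exists>x\<in>carrier U. finprod (adjoin_unit U) (\<lambda>s. Some (f s)) S = Some x"
    using assms
  proof (induction S rule: finite_ne_induct)
    case (singleton s)
    then show ?case using A.finprod_insert[of "{}" s "\<lambda>s. Some (f s)"]
      by (simp add: adjoin_unit_simps)
  next
    case (insert s S)
    then obtain x where x: "x \<in> carrier U" "finprod (adjoin_unit U) (\<lambda>s. Some (f s)) S = Some x" by auto
    have "finprod (adjoin_unit U) (\<lambda>s. Some (f s)) (insert s S) = Some (f s \<otimes>\<^bsub>U\<^esub> x)"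
      using insert x by (subst A.finprod_insert) (auto simp: adjoin_unit_simps)
    then show ?case using x insert by (auto intro: mult_closed)
  qed
  then show "finprod (adjoin_unit U) (\<lambda>s. Some (f s)) S = Some (set_prod U f S)"
    "set_prod U f S \<in> carrier U"
    by (auto simp: set_prod_def)
qed

lemma set_prod_singleton: "f s \<in> carrier U \<Longrightarrow> set_prod U f {s} = f s"
proof -
  interpret A: comm_monoid "adjoin_unit U" by (rule comm_monoid_adjoin_unit)
  assume "f s \<in> carrier U"
  then show ?thesis
    unfolding set_prod_def using A.finprod_insert[of "{}" s "\<lambda>s. Some (f s)"]
    by (simp add: adjoin_unit_simps)
qed

lemma set_prod_Un:
  assumes "finite S" "S \<noteq> {}" "finite T" "T \<noteq> {}" "S \<inter> T = {}" "f \<in> S \<union> T \<rightarrow> carrier U"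
  shows "set_prod U f (S \<union> T) = set_prod U f S \<otimes>\<^bsub>U\<^esub> set_prod U f T"
proof -
  interpret A: comm_monoid "adjoin_unit U" by (rule comm_monoid_adjoin_unit)
  have f: "f \<in> S \<rightarrow> carrier U" "f \<in> T \<rightarrow> carrier U" using assms by auto
  have "finprod (adjoin_unit U) (\<lambda>s. Some (f s)) (S \<union> T) =
      Some (set_prod U f S) \<otimes>\<^bsub>adjoin_unit U\<^esub> Some (set_prod U f T)"
    using assms finprod_adjoin_unit[OF _ _ f(1)] finprod_adjoin_unit[OF _ _ f(2)]
    by (subst A.finprod_Un_disjoint) (auto simp: adjoin_unit_simps)
  then show ?thesis by (simp add: set_prod_def adjoin_unit_simps)
qed

lemma set_prod_cong:
  assumes "\<And>s. s \<in> S \<Longrightarrow> f s = g s" "\<And>s. s \<in> S \<Longrightarrow> g s \<in> carrier U"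
  shows "set_prod U f S = set_prod U g S"
proof -
  interpret A: comm_monoid "adjoin_unit U" by (rule comm_monoid_adjoin_unit)
  show ?thesis
    unfolding set_prod_def using assms
    by (intro arg_cong[where f = the] A.finprod_cong') (auto simp: adjoin_unit_simps)
qed

lemma set_prod_insert:
  assumes "finite S" "S \<noteq> {}" "s \<notin> S" "f \<in> insert s S \<rightarrow> carrier U"
  shows "set_prod U f (insert s S) = f s \<otimes>\<^bsub>U\<^esub> set_prod U f S"
  using set_prod_Un[of "{s}" S f] set_prod_singleton[of f s] assms by auto

lemma mult_left_additive:
  assumes "x \<in> carrier U"
  shows "(\<lambda>y. x \<otimes>\<^bsub>U\<^esub> y) \<in> carrier U \<rightarrow> carrier U"
    and "y \<in> carrier U \<Longrightarrow> z \<in> carrier U \<Longrightarrow>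
      x \<otimes>\<^bsub>U\<^esub> (y \<oplus>\<^bsub>U\<^esub> z) = x \<otimes>\<^bsub>U\<^esub> y \<oplus>\<^bsub>U\<^esub> x \<otimes>\<^bsub>U\<^esub> z"
  using assms by (auto simp: mult_closed mult_comm[of x] mult_distr)

lemma D_set_prod:
  assumes "finite S" "S \<noteq> {}" "f \<in> S \<rightarrow> carrier U"
  shows "D (set_prod U f S) = (\<Oplus>\<^bsub>U\<^esub>s\<in>S. set_prod U (f(s := D (f s))) S)"
  using assms
proof (induction S rule: finite_ne_induct)
  case (singleton s)
  then show ?case by (simp add: set_prod_singleton D_closed)
next
  case (insert x S)
  have f: "f x \<in> carrier U" "f \<in> S \<rightarrow> carrier U" using insert by auto
  have upd: "f(s := D (f s)) \<in> insert x S \<rightarrow> carrier U" if "s \<in> insert x S" for s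
    using insert.prems that by (auto simp: Pi_iff D_closed)
  have S: "set_prod U f S \<in> carrier U" using insert f by (intro finprod_adjoin_unit) auto
  have upd_S: "set_prod U (f(s := D (f s))) S \<in> carrier U" if "s \<in> insert x S" for s
    using insert upd[OF that] by (intro finprod_adjoin_unit) auto
  have 1: "set_prod U (f(x := D (f x))) (insert x S) = D (f x) \<otimes>\<^bsub>U\<^esub> set_prod U f S"
  proof -
    have "set_prod U (f(x := D (f x))) S = set_prod U f S"
      by (rule set_prod_cong) (use insert.hyps f in auto)
    then show ?thesis using insert upd[of x] by (subst set_prod_insert) auto
  qed
  have 2: "set_prod U (f(s := D (f s))) (insert x S) = f x \<otimes>\<^bsub>U\<^esub> set_prod U (f(s := D (f s))) S"
    if "s \<in> S" for s
    using insert upd[of s] that by (subst set_prod_insert) auto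
  have "D (set_prod U f (insert x S)) =
      D (f x) \<otimes>\<^bsub>U\<^esub> set_prod U f S \<oplus>\<^bsub>U\<^esub> f x \<otimes>\<^bsub>U\<^esub> (\<Oplus>\<^bsub>U\<^esub>s\<in>S. set_prod U (f(s := D (f s))) S)"
    using insert f S by (simp add: set_prod_insert D_mult del: fun_upd_apply)
  also have "f x \<otimes>\<^bsub>U\<^esub> (\<Oplus>\<^bsub>U\<^esub>s\<in>S. set_prod U (f(s := D (f s))) S) =
      (\<Oplus>\<^bsub>U\<^esub>s\<in>S. f x \<otimes>\<^bsub>U\<^esub> set_prod U (f(s := D (f s))) S)"
    using mult_left_additive[OF f(1)] upd_S by (intro M.additive_finsum) auto
  also have "\<dots> = (\<Oplus>\<^bsub>U\<^esub>s\<in>S. set_prod U (f(s := D (f s))) (insert x S))"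
    using 2 upd_S f by (intro M.finsum_cong') (auto simp: mult_closed)
  finally show ?case
    using insert 1 2 upd_S f S
    by (subst M.finsum_insert) (auto simp: mult_closed D_closed)
qed

lemma funpow_D_closed: "x \<in> carrier U \<Longrightarrow> (D ^^ n) x \<in> carrier U"
  by (induction n) (auto simp: D_closed)

text \<open>S cannot be read off from e: a variable with exponent 0 still contributes the factor
  \<open>a s\<close>, as every argument occurs exactly once in a multilinear expression.\<close>

definition monomial_value :: "(nat \<Rightarrow> 'c) \<Rightarrow> nat set \<Rightarrow> (nat \<Rightarrow>\<^sub>0 nat) \<Rightarrow> 'c" where
  "monomial_value a S e = set_prod U (\<lambda>s. (D ^^ Poly_Mapping.lookup e s) (a s)) S"

definition symbol_value :: "(nat \<Rightarrow> 'c) \<Rightarrow> nat set \<Rightarrow> symbol \<Rightarrow> 'c" where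
  "symbol_value a S c =
    (\<Oplus>\<^bsub>U\<^esub>e\<in>Poly_Mapping.keys c. [Poly_Mapping.lookup c e] \<cdot>\<^bsub>U\<^esub> monomial_value a S e)"

end

locale symbol_evaluation = differential_algebra +
  fixes a :: "nat \<Rightarrow> 'c"
  assumes a_closed: "a s \<in> carrier U"
begin

lemma monomial_value_closed: "finite S \<Longrightarrow> S \<noteq> {} \<Longrightarrow> monomial_value a S e \<in> carrier U"
  unfolding monomial_value_def by (intro finprod_adjoin_unit) (auto simp: funpow_D_closed a_closed)

lemma monomial_value_mult:
  assumes "finite S" "S \<noteq> {}" "finite T" "T \<noteq> {}" "S \<inter> T = {}"
    and "Poly_Mapping.keys e \<subseteq> S" "Poly_Mapping.keys e' \<subseteq> T"
  shows "monomial_value a S e \<otimes>\<^bsub>U\<^esub> monomial_value a T e' = monomial_value a (S \<union> T) (e + e')"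
proof -
  have "Poly_Mapping.lookup e' s = 0" if "s \<in> S" for s
    using that assms by (auto simp: not_in_keys_iff_lookup_eq_zero[symmetric])
  moreover have "Poly_Mapping.lookup e s = 0" if "s \<in> T" for s
    using that assms by (auto simp: not_in_keys_iff_lookup_eq_zero[symmetric])
  ultimately show ?thesis
    unfolding monomial_value_def using assms
    by (subst set_prod_Un) (auto simp: funpow_D_closed a_closed lookup_add
      intro!: arg_cong2[where f = "monoid.mult U"] set_prod_cong)
qed

lemma D_monomial_value:
  assumes "finite S" "S \<noteq> {}"
  shows "D (monomial_value a S e) =
    (\<Oplus>\<^bsub>U\<^esub>s\<in>S. monomial_value a S (Poly_Mapping.single s 1 + e))"
  unfolding monomial_value_def using assms
  by (subst D_set_prod) (auto simp: funpow_D_closed a_closed D_closed lookup_add lookup_single when_def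
    intro!: M.finsum_cong' set_prod_cong finprod_adjoin_unit)

lemma symbol_value_closed: "finite S \<Longrightarrow> S \<noteq> {} \<Longrightarrow> symbol_value a S c \<in> carrier U"
  unfolding symbol_value_def by (intro M.finsum_closed) (auto simp: monomial_value_closed)

lemma symbol_value_superset:
  assumes "finite S" "S \<noteq> {}" "finite A" "Poly_Mapping.keys c \<subseteq> A"
  shows "symbol_value a S c =
    (\<Oplus>\<^bsub>U\<^esub>e\<in>A. [Poly_Mapping.lookup c e] \<cdot>\<^bsub>U\<^esub> monomial_value a S e)"
  unfolding symbol_value_def using assms
  by (intro M.add.finprod_mono_neutral_cong_left)
    (auto simp: monomial_value_closed not_in_keys_iff_lookup_eq_zero add_pow_int_ge)

lemma symbol_value_0 [simp]: "symbol_value a S 0 = \<zero>\<^bsub>U\<^esub>"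
  by (simp add: symbol_value_def)

lemma symbol_value_frag_of:
  "finite S \<Longrightarrow> S \<noteq> {} \<Longrightarrow> symbol_value a S (frag_of e) = monomial_value a S e"
  by (simp add: symbol_value_def keys_frag_of monomial_value_closed)

lemma symbol_value_add:
  assumes "finite S" "S \<noteq> {}"
  shows "symbol_value a S (c + d) = symbol_value a S c \<oplus>\<^bsub>U\<^esub> symbol_value a S d"
proof -
  let ?A = "Poly_Mapping.keys c \<union> Poly_Mapping.keys d"
  note * = symbol_value_superset[OF assms, of ?A]
  have "symbol_value a S (c + d) =
      (\<Oplus>\<^bsub>U\<^esub>e\<in>?A. [Poly_Mapping.lookup (c + d) e] \<cdot>\<^bsub>U\<^esub> monomial_value a S e)"
    using Poly_Mapping.keys_add[of c d] by (intro *) auto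
  also have "\<dots> = (\<Oplus>\<^bsub>U\<^esub>e\<in>?A. [Poly_Mapping.lookup c e] \<cdot>\<^bsub>U\<^esub> monomial_value a S e \<oplus>\<^bsub>U\<^esub>
      [Poly_Mapping.lookup d e] \<cdot>\<^bsub>U\<^esub> monomial_value a S e)"
    using assms by (intro M.finsum_cong') (auto simp: monomial_value_closed lookup_add M.add.int_pow_mult)
  also have "\<dots> = symbol_value a S c \<oplus>\<^bsub>U\<^esub> symbol_value a S d"
    using assms by (subst M.finsum_addf) (auto simp: monomial_value_closed *)
  finally show ?thesis .
qed

lemma symbol_value_of_int_mult:
  assumes "finite S" "S \<noteq> {}"
  shows "symbol_value a S (of_int n * c) = [n] \<cdot>\<^bsub>U\<^esub> symbol_value a S c"
proof -
  have "symbol_value a S (of_int n * c) =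
      (\<Oplus>\<^bsub>U\<^esub>e\<in>Poly_Mapping.keys c. [Poly_Mapping.lookup (of_int n * c) e] \<cdot>\<^bsub>U\<^esub> monomial_value a S e)"
    using assms by (intro symbol_value_superset) (auto simp: in_keys_iff lookup_of_int_mult)
  also have "\<dots> = (\<Oplus>\<^bsub>U\<^esub>e\<in>Poly_Mapping.keys c. [n] \<cdot>\<^bsub>U\<^esub> ([Poly_Mapping.lookup c e] \<cdot>\<^bsub>U\<^esub> monomial_value a S e))"
    using assms by (intro M.finsum_cong')
      (auto simp: monomial_value_closed lookup_of_int_mult M.add.int_pow_pow mult.commute[of n])
  also have "\<dots> = [n] \<cdot>\<^bsub>U\<^esub> symbol_value a S c"
    unfolding symbol_value_def using assms
    by (intro M.additive_finsum[symmetric]) (auto simp: monomial_value_closed M.add.int_pow_distrib)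
  finally show ?thesis .
qed

lemma symbol_value_diff:
  assumes "finite S" "S \<noteq> {}"
  shows "symbol_value a S (c - d) = symbol_value a S c \<ominus>\<^bsub>U\<^esub> symbol_value a S d"
proof -
  have "symbol_value a S (c - d) = symbol_value a S (c + of_int (-1) * d)" by simp
  also have "\<dots> = symbol_value a S c \<oplus>\<^bsub>U\<^esub> [(-1::int)] \<cdot>\<^bsub>U\<^esub> symbol_value a S d"
    by (simp only: symbol_value_add[OF assms] symbol_value_of_int_mult[OF assms])
  finally show ?thesis
    using assms by (simp add: M.add.int_pow_neg symbol_value_closed a_minus_def)
qed

lemma symbol_value_sum:
  assumes "finite S" "S \<noteq> {}"
  shows "symbol_value a S (\<Sum>i\<in>I. f i) = (\<Oplus>\<^bsub>U\<^esub>i\<in>I. symbol_value a S (f i))"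
  by (induction I rule: infinite_finite_induct)
    (auto simp: symbol_value_add symbol_value_closed assms)

text \<open>Bilinearity reduces the claim to monomials. Disjointness is essential there: a common
  variable s would yield two factors derived from \<open>a s\<close> on the left and one on the
  right.\<close>

lemma symbol_value_mult:
  assumes S: "finite S" "S \<noteq> {}" and T: "finite T" "T \<noteq> {}" and disj: "S \<inter> T = {}"
    and c: "vars_in S c" and d: "vars_in T d"
  shows "symbol_value a S c \<otimes>\<^bsub>U\<^esub> symbol_value a T d = symbol_value a (S \<union> T) (c * d)"
proof -
  have ST: "finite (S \<union> T)" "S \<union> T \<noteq> {}" using S T by auto
  note closed = symbol_value_closed[OF S] symbol_value_closed[OF T] symbol_value_closed[OF ST]
  have diff_l: "(x \<ominus>\<^bsub>U\<^esub> y) \<otimes>\<^bsub>U\<^esub> z = x \<otimes>\<^bsub>U\<^esub> z \<ominus>\<^bsub>U\<^esub> y \<otimes>\<^bsub>U\<^esub> z"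
    if "x \<in> carrier U" "y \<in> carrier U" "z \<in> carrier U" for x y z
  proof -
    have "(x \<ominus>\<^bsub>U\<^esub> y) \<otimes>\<^bsub>U\<^esub> z \<oplus>\<^bsub>U\<^esub> y \<otimes>\<^bsub>U\<^esub> z = (x \<ominus>\<^bsub>U\<^esub> y \<oplus>\<^bsub>U\<^esub> y) \<otimes>\<^bsub>U\<^esub> z"
      using that by (simp add: mult_distr)
    also have "x \<ominus>\<^bsub>U\<^esub> y \<oplus>\<^bsub>U\<^esub> y = x"
      using that by (simp add: a_minus_def M.a_assoc M.l_neg)
    finally show ?thesis
      using that mult_closed by (metis M.a_comm M.minus_closed M.add.inv_solve_right a_minus_def)
  qed
  show ?thesis
    using c unfolding vars_in_def
  proof (induction c rule: frag_induction)
    case zero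
    have "\<zero>\<^bsub>U\<^esub> \<otimes>\<^bsub>U\<^esub> x = \<zero>\<^bsub>U\<^esub>" if "x \<in> carrier U" for x
      using M.additive_zero[OF mult_left_additive[OF that]] that by (simp add: mult_comm[of "\<zero>\<^bsub>U\<^esub>"])
    then show ?case by (simp add: closed)
  next
    case (one e)
    show ?case
      using d unfolding vars_in_def
    proof (induction d rule: frag_induction)
      case zero
      show ?case using M.additive_zero[OF mult_left_additive[OF closed(1)]] by simp
    next
      case (one e')
      then show ?case
        using \<open>e \<in> _\<close> S T disj ST
        by (simp add: symbol_value_frag_of monomial_value_mult mult_single)
    next
      case (diff d d')
      then show ?case
        using S T ST by (simp add: symbol_value_diff right_diff_distrib diff_l closed
          mult_comm[OF closed(1)])
    qed
  next
    case (diff c c')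
    then show ?case
      using S T ST by (simp add: symbol_value_diff left_diff_distrib diff_l closed)
  qed
qed

lemma D_symbol_value:
  assumes S: "finite S" "S \<noteq> {}"
  shows "D (symbol_value a S c) = symbol_value a S ((\<Sum>s\<in>S. var s) * c)"
proof -
  have D_zero: "D \<zero>\<^bsub>U\<^esub> = \<zero>\<^bsub>U\<^esub>" by (rule M.additive_zero) (auto simp: D_closed D_add)
  have D_diff: "D (x \<ominus>\<^bsub>U\<^esub> y) = D x \<ominus>\<^bsub>U\<^esub> D y" if "x \<in> carrier U" "y \<in> carrier U" for x y
  proof -
    have "D (x \<ominus>\<^bsub>U\<^esub> y) \<oplus>\<^bsub>U\<^esub> D y = D (x \<ominus>\<^bsub>U\<^esub> y \<oplus>\<^bsub>U\<^esub> y)"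
      using that by (simp add: D_add)
    also have "x \<ominus>\<^bsub>U\<^esub> y \<oplus>\<^bsub>U\<^esub> y = x"
      using that by (simp add: a_minus_def M.a_assoc M.l_neg)
    finally show ?thesis
      using that D_closed by (metis M.a_comm M.minus_closed M.add.inv_solve_right a_minus_def)
  qed
  have "Poly_Mapping.keys c \<subseteq> UNIV" by simp
  then show ?thesis
  proof (induction c rule: frag_induction)
    case (one e)
    have "symbol_value a S ((\<Sum>s\<in>S. var s) * frag_of e) =
        symbol_value a S (\<Sum>s\<in>S. frag_of (Poly_Mapping.single s 1 + e))"
      by (simp add: sum_distrib_right var_def mult_single)
    also have "\<dots> = (\<Oplus>\<^bsub>U\<^esub>s\<in>S. monomial_value a S (Poly_Mapping.single s 1 + e))"
      using S by (simp add: symbol_value_sum symbol_value_frag_of)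
    finally show ?case using S by (simp add: symbol_value_frag_of D_monomial_value)
  next
    case (diff c d)
    then show ?case using S by (simp add: symbol_value_diff right_diff_distrib D_diff symbol_value_closed)
  qed (simp add: D_zero)
qed

lemma funpow_D_symbol_value:
  assumes "finite S" "S \<noteq> {}"
  shows "(D ^^ n) (symbol_value a S c) = symbol_value a S ((\<Sum>s\<in>S. var s) ^ n * c)"
  using assms by (induction n) (auto simp: D_symbol_value mult.assoc)

lemma nonempty_prod_symbol_value:
  assumes "\<And>j. j \<le> k \<Longrightarrow> finite (S j)" "\<And>j. j \<le> k \<Longrightarrow> S j \<noteq> {}" "\<And>j. j \<le> k \<Longrightarrow> vars_in (S j) (c j)"
    and "\<And>i j. i < j \<Longrightarrow> j \<le> k \<Longrightarrow> S i \<inter> S j = {}"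
  shows "nonempty_prod U (\<lambda>j. symbol_value a (S j) (c j)) k =
    symbol_value a (\<Union>j\<in>{0..k}. S j) (\<Prod>j\<in>{0..k}. c j)"
  using assms
proof (induction k)
  case (Suc k)
  have "nonempty_prod U (\<lambda>j. symbol_value a (S j) (c j)) (Suc k) =
      symbol_value a (\<Union>j\<in>{0..k}. S j) (\<Prod>j\<in>{0..k}. c j) \<otimes>\<^bsub>U\<^esub> symbol_value a (S (Suc k)) (c (Suc k))"
    using Suc by simp
  also have "\<dots> = symbol_value a ((\<Union>j\<in>{0..k}. S j) \<union> S (Suc k)) ((\<Prod>j\<in>{0..k}. c j) * c (Suc k))"
  proof (rule symbol_value_mult)
    show "(\<Union>j\<in>{0..k}. S j) \<inter> S (Suc k) = {}" 
    proof -
      have "S j \<inter> S (Suc k) = {}" if "j \<le> k" for j using Suc.prems(4)[of j "Suc k"] that by simp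
      then show ?thesis by (auto simp: disjoint_iff)
    qed
    show "vars_in (\<Union>j\<in>{0..k}. S j) (\<Prod>j\<in>{0..k}. c j)"
    proof (rule vars_in_prod)
      fix j assume "j \<in> {0..k}"
      then show "vars_in (\<Union>j\<in>{0..k}. S j) (c j)"
        by (intro vars_in_mono[OF Suc.prems(3)[of j]]) auto
    qed
  qed (use Suc.prems in \<open>auto intro!: exI[of _ 0]\<close>)
  finally show ?case by (simp add: atLeast0_atMost_Suc Un_commute mult.commute)
qed simp

text \<open>The arguments may be composite expressions, with symbols c_j in disjoint sets of
  variables. Differentiating the j-th one multiplies c_j by the sum of the variables in S_j, so the
  Leibniz formula becomes the Vandermonde determinant of these sums.\<close>

lemma wronskian_symbol_value:
  assumes S: "\<And>j. j \<le> k \<Longrightarrow> finite (S j)" "\<And>j. j \<le> k \<Longrightarrow> S j \<noteq> {}" "\<And>j. j \<le> k \<Longrightarrow> vars_in (S j) (c j)"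
    and disj: "\<And>i j. i < j \<Longrightarrow> j \<le> k \<Longrightarrow> S i \<inter> S j = {}"
    and us: "\<And>j. j \<le> k \<Longrightarrow> us ! j = symbol_value a (S j) (c j)"
  shows "wronskian U D k us = symbol_value a (\<Union>j\<in>{0..k}. S j)
    (vandermonde k (\<lambda>j. \<Sum>s\<in>S j. var s) * (\<Prod>j\<in>{0..k}. c j))"
proof -
  let ?S = "\<Union>j\<in>{0..k}. S j" and ?c = "\<lambda>\<pi> j. (\<Sum>s\<in>S j. var s) ^ \<pi> j * c j"
  have fin: "finite ?S" "?S \<noteq> {}" using S(1,2) by (auto intro!: bexI[of _ 0])
  have cong: "nonempty_prod U f m = nonempty_prod U g m" if "\<And>j. j \<le> m \<Longrightarrow> f j = g j" for f g m
    using that by (induction m) auto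
  have "nonempty_prod U (\<lambda>j. (D ^^ \<pi> j) (us ! j)) k = symbol_value a ?S (\<Prod>j\<in>{0..k}. ?c \<pi> j)" for \<pi>
  proof -
    have "nonempty_prod U (\<lambda>j. (D ^^ \<pi> j) (us ! j)) k = nonempty_prod U (\<lambda>j. symbol_value a (S j) (?c \<pi> j)) k"
      using S us by (intro cong) (simp add: funpow_D_symbol_value)
    also have "\<dots> = symbol_value a ?S (\<Prod>j\<in>{0..k}. ?c \<pi> j)"
      using S disj by (intro nonempty_prod_symbol_value)
        (auto intro!: vars_in_mult vars_in_power vars_in_sum vars_in_var)
    finally show ?thesis .
  qed
  then have "wronskian U D k us =
      symbol_value a ?S (\<Sum>\<pi> | \<pi> permutes {0..k}. of_int (sign \<pi>) * (\<Prod>j\<in>{0..k}. ?c \<pi> j))"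
    unfolding wronskian_def by (simp only: symbol_value_sum[OF fin] symbol_value_of_int_mult[OF fin])
  then show ?thesis
    by (simp add: alternant_def sum_distrib_right prod.distrib mult.assoc)
qed

lemma symbol_value_singleton_1: "symbol_value a {s} 1 = a s"
proof -
  have "symbol_value a {s} 1 = symbol_value a {s} (frag_of 0)" by simp
  also have "\<dots> = a s"
    unfolding symbol_value_frag_of[of "{s}", simplified]
    by (simp add: monomial_value_def set_prod_singleton a_closed)
  finally show ?thesis .
qed

lemma wronskian_map:
  assumes "distinct ys" "length ys = Suc l"
  shows "wronskian U D l (map a ys) = symbol_value a (set ys) (vandermonde l (\<lambda>j. var (ys ! j)))"
proof -
  have "wronskian U D l (map a ys) = symbol_value a (\<Union>j\<in>{0..l}. {ys ! j})
      (vandermonde l (\<lambda>j. \<Sum>s\<in>{ys ! j}. var s) * (\<Prod>j\<in>{0..l}. 1))"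
    using assms by (intro wronskian_symbol_value)
      (auto simp: symbol_value_singleton_1 nth_eq_iff_index_eq)
  moreover have "(\<Union>j\<in>{0..l}. {ys ! j}) = set ys"
    using assms by (auto simp: set_conv_nth less_Suc_eq_le)
  ultimately show ?thesis by simp
qed

text \<open>\<open>zs ! i\<close> merely holds the place of the inner Wronskian. It is removed from
  the set of variables and may reappear in \<open>ys\<close>.\<close>

lemma wronskian_nested:
  assumes zs: "distinct zs" "length zs = Suc k" and ys: "distinct ys" "length ys = Suc l"
    and i: "i \<le> k" and disj: "set ys \<inter> (set zs - {zs ! i}) = {}"
  shows "wronskian U D k ((map a zs)[i := wronskian U D l (map a ys)]) =
    symbol_value a (set zs - {zs ! i} \<union> set ys)
      (vandermonde k (\<lambda>j. if j = i then \<Sum>y\<in>set ys. var y else var (zs ! j)) *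
       vandermonde l (\<lambda>j. var (ys ! j)))"
proof -
  let ?S = "\<lambda>j. if j = i then set ys else {zs ! j}"
  let ?c = "\<lambda>j. if j = i then vandermonde l (\<lambda>j. var (ys ! j)) else 1"
  have ne: "ys \<noteq> []" using ys by auto
  have notin: "zs ! j \<notin> set ys" if "j \<le> k" "j \<noteq> i" for j
  proof -
    have "zs ! j \<in> set zs - {zs ! i}" using that zs i by (auto simp: nth_eq_iff_index_eq)
    then show ?thesis using disj by blast
  qed
  have "wronskian U D k ((map a zs)[i := wronskian U D l (map a ys)]) =
    symbol_value a (\<Union>j\<in>{0..k}. ?S j) (vandermonde k (\<lambda>j. \<Sum>s\<in>?S j. var s) * (\<Prod>j\<in>{0..k}. ?c j))"
  proof (rule wronskian_symbol_value)
    show "vars_in (?S j) (?c j)" for j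
      using ys by (auto intro!: vars_in_vandermonde vars_in_var)
    show "?S j \<inter> ?S j' = {}" if "j < j'" "j' \<le> k" for j j'
      using that zs i notin[of j] notin[of j'] by (auto simp: nth_eq_iff_index_eq)
    show "(map a zs)[i := wronskian U D l (map a ys)] ! j = symbol_value a (?S j) (?c j)" if "j \<le> k" for j
      using that zs i ys by (auto simp: nth_list_update wronskian_map symbol_value_singleton_1)
  qed (auto simp: ne)
  moreover have "(\<Union>j\<in>{0..k}. ?S j) = set zs - {zs ! i} \<union> set ys"
  proof -
    have "set zs - {zs ! i} = (\<lambda>j. zs ! j) ` ({0..k} - {i})"
      using zs i by (auto simp: set_conv_nth less_Suc_eq_le nth_eq_iff_index_eq)
    then show ?thesis using i by (auto split: if_splits)
  qed
  moreover have "(\<Prod>j\<in>{0..k}. ?c j) = vandermonde l (\<lambda>j. var (ys ! j))"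
    using i by simp
  moreover have "vandermonde k (\<lambda>j. \<Sum>s\<in>?S j. var s) =
      vandermonde k (\<lambda>j. if j = i then \<Sum>y\<in>set ys. var y else var (zs ! j))"
    by (rule alternant_cong) simp
  ultimately show ?thesis by simp
qed

end

section \<open>The Wronskian identities\<close>

declare upt_Suc [simp del]

section \<open>The Wronskian as a cochain\<close>

context differential_algebra
begin

lemma nonempty_prod_cong: "(\<And>j. j \<le> k \<Longrightarrow> f j = g j) \<Longrightarrow> nonempty_prod U f k = nonempty_prod U g k"
  by (induction k) auto

lemma nonempty_prod_closed: "(\<And>j. j \<le> k \<Longrightarrow> f j \<in> carrier U) \<Longrightarrow> nonempty_prod U f k \<in> carrier U"
  by (induction k) (auto simp: mult_closed)

lemma nonempty_prod_eq_set_prod: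
  "(\<And>j. j \<le> k \<Longrightarrow> f j \<in> carrier U) \<Longrightarrow> nonempty_prod U f k = set_prod U f {0..k}"
proof (induction k)
  case (Suc k)
  then have "set_prod U f (insert (Suc k) {0..k}) = f (Suc k) \<otimes>\<^bsub>U\<^esub> set_prod U f {0..k}"
    by (intro set_prod_insert) auto
  moreover have "set_prod U f {0..k} \<in> carrier U"
    using Suc.prems by (intro finprod_adjoin_unit) auto
  ultimately show ?case
    using Suc by (simp add: atLeast0_atMost_Suc mult_comm)
qed (simp add: set_prod_singleton)

lemma set_prod_permute:
  assumes "\<tau> permutes S" "f \<in> S \<rightarrow> carrier U"
  shows "set_prod U (\<lambda>s. f (\<tau> s)) S = set_prod U f S"
proof -
  interpret A: comm_monoid "adjoin_unit U" by (rule comm_monoid_adjoin_unit)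
  have "finprod (adjoin_unit U) (\<lambda>s. Some (f s)) (\<tau> ` S) = finprod (adjoin_unit U) (\<lambda>s. Some (f (\<tau> s))) S"
    using assms permutes_inj_on[OF assms(1)] permutes_image[OF assms(1)]
    by (intro A.finprod_reindex) (auto simp: adjoin_unit_simps)
  then show ?thesis using permutes_image[OF assms(1)] by (simp add: set_prod_def)
qed

lemma nonempty_prod_add:
  assumes "i \<le> k" "\<And>j. j \<le> k \<Longrightarrow> f j \<in> carrier U" "x \<in> carrier U" "y \<in> carrier U"
  shows "nonempty_prod U (f(i := x \<oplus>\<^bsub>U\<^esub> y)) k =
    nonempty_prod U (f(i := x)) k \<oplus>\<^bsub>U\<^esub> nonempty_prod U (f(i := y)) k"
  using assms(1,2)
proof (induction k)
  case (Suc k)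
  show ?case
  proof (cases "i = Suc k")
    case True
    have "nonempty_prod U (f(i := z)) k = nonempty_prod U f k" for z
      using True by (intro nonempty_prod_cong) auto
    moreover have "nonempty_prod U f k \<in> carrier U" using Suc.prems by (intro nonempty_prod_closed) auto
    ultimately show ?thesis
      using True assms by (simp add: mult_left_additive(2) del: fun_upd_apply add: fun_upd_same)
  next
    case False
    have "nonempty_prod U (f(i := z)) k \<in> carrier U" if "z \<in> carrier U" for z
      using Suc.prems that by (intro nonempty_prod_closed) auto
    then show ?thesis
      using False Suc assms by (simp add: mult_distr del: fun_upd_apply add: fun_upd_other)
  qed
qed simp

lemma nonempty_prod_smult:
  assumes "i \<le> k" "\<And>j. j \<le> k \<Longrightarrow> f j \<in> carrier U" "c \<in> carrier K" "x \<in> carrier U"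
  shows "nonempty_prod U (f(i := c \<odot>\<^bsub>U\<^esub> x)) k = c \<odot>\<^bsub>U\<^esub> nonempty_prod U (f(i := x)) k"
  using assms(1,2)
proof (induction k)
  case (Suc k)
  show ?case
  proof (cases "i = Suc k")
    case True
    have "nonempty_prod U (f(i := z)) k = nonempty_prod U f k" for z
      using True by (intro nonempty_prod_cong) auto
    moreover have "nonempty_prod U f k \<in> carrier U" using Suc.prems by (intro nonempty_prod_closed) auto
    ultimately show ?thesis
      using True assms
      by (simp add: mult_comm[of "nonempty_prod U f k"] mult_smult del: fun_upd_apply add: fun_upd_same)
  next
    case False
    have "nonempty_prod U (f(i := x)) k \<in> carrier U"
      using Suc.prems assms by (intro nonempty_prod_closed) auto
    then show ?thesis
      using False Suc assms by (simp add: mult_smult del: fun_upd_apply add: fun_upd_other)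
  qed
qed simp

lemma funpow_D_add:
  "x \<in> carrier U \<Longrightarrow> y \<in> carrier U \<Longrightarrow> (D ^^ n) (x \<oplus>\<^bsub>U\<^esub> y) = (D ^^ n) x \<oplus>\<^bsub>U\<^esub> (D ^^ n) y"
  by (induction n) (auto simp: D_add funpow_D_closed)

lemma funpow_D_smult:
  "c \<in> carrier K \<Longrightarrow> x \<in> carrier U \<Longrightarrow> (D ^^ n) (c \<odot>\<^bsub>U\<^esub> x) = c \<odot>\<^bsub>U\<^esub> (D ^^ n) x"
  by (induction n) (auto simp: D_smult funpow_D_closed)

lemma wronskian_term_closed:
  assumes "length us = Suc k" "set us \<subseteq> carrier U"
  shows "nonempty_prod U (\<lambda>j. (D ^^ \<pi> j) (us ! j)) k \<in> carrier U"
proof (rule nonempty_prod_closed)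
  fix j assume "j \<le> k"
  then have "us ! j \<in> carrier U" using assms nth_mem[of j us] by auto
  then show "(D ^^ \<pi> j) (us ! j) \<in> carrier U" by (rule funpow_D_closed)
qed

lemma wronskian_closed:
  assumes "length us = Suc k" "set us \<subseteq> carrier U"
  shows "wronskian U D k us \<in> carrier U"
  unfolding wronskian_def using wronskian_term_closed[OF assms] by (intro M.finsum_closed) auto

lemma nonempty_prod_list_update:
  assumes "length us = Suc k" "i < Suc k"
  shows "nonempty_prod U (\<lambda>j. (D ^^ \<pi> j) (us[i := z] ! j)) k =
    nonempty_prod U ((\<lambda>j. (D ^^ \<pi> j) (us ! j))(i := (D ^^ \<pi> i) z)) k"
  using assms by (intro nonempty_prod_cong) (auto simp: nth_list_update)

lemma wronskian_add:
  assumes us: "length us = Suc k" "set us \<subseteq> carrier U" and i: "i < Suc k"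
    and xy: "x \<in> carrier U" "y \<in> carrier U"
  shows "wronskian U D k (us[i := x \<oplus>\<^bsub>U\<^esub> y]) =
    wronskian U D k (us[i := x]) \<oplus>\<^bsub>U\<^esub> wronskian U D k (us[i := y])"
proof -
  let ?p = "\<lambda>us \<pi>. nonempty_prod U (\<lambda>j. (D ^^ \<pi> j) (us ! j)) k"
  have "us ! j \<in> carrier U" if "j \<le> k" for j using us that nth_mem[of j us] by auto
  then have eq: "?p (us[i := x \<oplus>\<^bsub>U\<^esub> y]) \<pi> = ?p (us[i := x]) \<pi> \<oplus>\<^bsub>U\<^esub> ?p (us[i := y]) \<pi>" for \<pi>
    unfolding nonempty_prod_list_update[OF us(1) i] using i xy
    by (simp add: funpow_D_add nonempty_prod_add funpow_D_closed)
  have closed: "?p (us[i := z]) \<pi> \<in> carrier U" if "z \<in> carrier U" for z \<pi>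
    using us that set_update_subset_insert[of us i z] by (intro wronskian_term_closed) auto
  show ?thesis
    unfolding wronskian_def eq using closed xy
    by (subst M.finsum_addf[symmetric]) (auto simp: M.add.int_pow_distrib)
qed

lemma smult_additive:
  assumes "c \<in> carrier K"
  shows "(\<lambda>x. c \<odot>\<^bsub>U\<^esub> x) \<in> carrier U \<rightarrow> carrier U"
    and "x \<in> carrier U \<Longrightarrow> y \<in> carrier U \<Longrightarrow>
      c \<odot>\<^bsub>U\<^esub> (x \<oplus>\<^bsub>U\<^esub> y) = c \<odot>\<^bsub>U\<^esub> x \<oplus>\<^bsub>U\<^esub> c \<odot>\<^bsub>U\<^esub> y"
  using assms by (auto simp: smult_r_distr)

lemma wronskian_smult:
  assumes us: "length us = Suc k" "set us \<subseteq> carrier U" and i: "i < Suc k"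
    and c: "c \<in> carrier K" and x: "x \<in> carrier U"
  shows "wronskian U D k (us[i := c \<odot>\<^bsub>U\<^esub> x]) = c \<odot>\<^bsub>U\<^esub> wronskian U D k (us[i := x])"
proof -
  let ?p = "\<lambda>us \<pi>. nonempty_prod U (\<lambda>j. (D ^^ \<pi> j) (us ! j)) k"
  have "us ! j \<in> carrier U" if "j \<le> k" for j using us that nth_mem[of j us] by auto
  then have eq: "?p (us[i := c \<odot>\<^bsub>U\<^esub> x]) \<pi> = c \<odot>\<^bsub>U\<^esub> ?p (us[i := x]) \<pi>" for \<pi>
    unfolding nonempty_prod_list_update[OF us(1) i] using i c x
    by (simp add: funpow_D_smult nonempty_prod_smult funpow_D_closed)
  have closed: "?p (us[i := x]) \<pi> \<in> carrier U" for \<pi>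
    using us x set_update_subset_insert[of us i x] by (intro wronskian_term_closed) auto
  have pow: "[n] \<cdot>\<^bsub>U\<^esub> (c \<odot>\<^bsub>U\<^esub> ?p (us[i := x]) \<pi>) = c \<odot>\<^bsub>U\<^esub> ([n] \<cdot>\<^bsub>U\<^esub> ?p (us[i := x]) \<pi>)" for n :: int and \<pi>
    using smult_additive[OF c] closed by (intro M.additive_int_pow[symmetric]) auto
  show ?thesis
    unfolding wronskian_def eq pow
    using smult_additive[OF c] closed by (intro M.additive_finsum[symmetric]) auto
qed

text \<open>K may have characteristic 2, where a change of sign proves nothing. The terms are
  cancelled explicitly instead: each even \<pi> against the odd permutation \<pi> \<circ> t, with t
  the transposition of two equal arguments.\<close>

lemma wronskian_alternating:
  assumes us: "length us = Suc k" "set us \<subseteq> carrier U" and nd: "\<not> distinct us"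
  shows "wronskian U D k us = \<zero>\<^bsub>U\<^esub>"
proof -
  obtain i j where ij: "i \<le> k" "j \<le> k" "i \<noteq> j" "us ! i = us ! j"
    using nd us(1) by (auto simp: distinct_conv_nth less_Suc_eq_le)
  let ?t = "transpose i j" and ?P = "{\<pi>. \<pi> permutes {0..k}}"
  let ?E = "{\<pi> \<in> ?P. evenperm \<pi>}" and ?O = "{\<pi> \<in> ?P. \<not> evenperm \<pi>}"
  define p where "p \<pi> = nonempty_prod U (\<lambda>j. (D ^^ \<pi> j) (us ! j)) k" for \<pi>
  have p: "p \<pi> \<in> carrier U" for \<pi> unfolding p_def by (rule wronskian_term_closed[OF us])
  have us_mem: "us ! j \<in> carrier U" if "j \<le> k" for j using us that nth_mem[of j us] by auto
  have t: "?t permutes {0..k}" using ij by (intro permutes_swap_id) auto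
  \<comment> \<open>Commutativity of U makes the product independent of the order of its factors;
    passing to \<open>set_prod\<close> makes this usable, since \<open>nonempty_prod\<close>
    multiplies in a fixed order.\<close>
  have pt: "p (\<pi> \<circ> ?t) = p \<pi>" for \<pi>
  proof -
    have "us ! j' = us ! ?t j'" for j' using ij(4) by (simp add: transpose_def)
    then have "p (\<pi> \<circ> ?t) = nonempty_prod U (\<lambda>j. (D ^^ \<pi> (?t j)) (us ! ?t j)) k"
      unfolding p_def by (intro nonempty_prod_cong) simp
    also have "\<dots> = set_prod U (\<lambda>j. (D ^^ \<pi> (?t j)) (us ! ?t j)) {0..k}"
      using permutes_in_image[OF t] us_mem by (intro nonempty_prod_eq_set_prod funpow_D_closed) auto
    also have "\<dots> = set_prod U (\<lambda>j. (D ^^ \<pi> j) (us ! j)) {0..k}"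
      using us_mem by (intro set_prod_permute[OF t]) (auto intro: funpow_D_closed)
    also have "\<dots> = p \<pi>"
      unfolding p_def using us_mem by (intro nonempty_prod_eq_set_prod[symmetric] funpow_D_closed) auto
    finally show ?thesis .
  qed
  have even: "evenperm (\<pi> \<circ> ?t) \<longleftrightarrow> \<not> evenperm \<pi>" if "\<pi> \<in> ?P" for \<pi>
    using that ij t by (subst evenperm_comp) (auto intro: permutes_imp_permutation simp: evenperm_swap)
  have O: "?O = (\<lambda>\<pi>. \<pi> \<circ> ?t) ` ?E"
  proof (intro equalityI subsetI)
    fix \<pi> assume \<pi>: "\<pi> \<in> ?O"
    then have 1: "\<pi> \<circ> ?t \<in> ?E" using even[of \<pi>] permutes_compose[OF t] by auto
    have "\<pi> = (\<lambda>\<pi>. \<pi> \<circ> ?t) (\<pi> \<circ> ?t)" by (simp add: comp_assoc)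
    from this 1 show "\<pi> \<in> (\<lambda>\<pi>. \<pi> \<circ> ?t) ` ?E" by (rule image_eqI)
  next
    fix \<pi> assume "\<pi> \<in> (\<lambda>\<pi>. \<pi> \<circ> ?t) ` ?E"
    then show "\<pi> \<in> ?O" using even permutes_compose[OF t] by auto
  qed
  have inj: "inj_on (\<lambda>\<pi>. \<pi> \<circ> ?t) ?E"
    by (rule inj_on_inverseI[where g = "\<lambda>\<pi>. \<pi> \<circ> ?t"]) (simp add: comp_assoc)
  have fin: "finite ?P" by (rule finite_permutations) simp
  have "wronskian U D k us = (\<Oplus>\<^bsub>U\<^esub>\<pi>\<in>?E \<union> ?O. [sign \<pi>] \<cdot>\<^bsub>U\<^esub> p \<pi>)"
    unfolding wronskian_def p_def by (rule M.add.finprod_cong') (use p[unfolded p_def] in auto)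
  also have "\<dots> = (\<Oplus>\<^bsub>U\<^esub>\<pi>\<in>?E. [sign \<pi>] \<cdot>\<^bsub>U\<^esub> p \<pi>) \<oplus>\<^bsub>U\<^esub> (\<Oplus>\<^bsub>U\<^esub>\<pi>\<in>?O. [sign \<pi>] \<cdot>\<^bsub>U\<^esub> p \<pi>)"
    using fin p by (intro M.finsum_Un_disjoint) auto
  also have "(\<Oplus>\<^bsub>U\<^esub>\<pi>\<in>?E. [sign \<pi>] \<cdot>\<^bsub>U\<^esub> p \<pi>) = (\<Oplus>\<^bsub>U\<^esub>\<pi>\<in>?E. p \<pi>)"
    using p by (intro M.finsum_cong') (auto simp: sign_def add_pow_int_ge)
  also have "(\<Oplus>\<^bsub>U\<^esub>\<pi>\<in>?O. [sign \<pi>] \<cdot>\<^bsub>U\<^esub> p \<pi>) = (\<Oplus>\<^bsub>U\<^esub>\<pi>\<in>?E. [sign (\<pi> \<circ> ?t)] \<cdot>\<^bsub>U\<^esub> p (\<pi> \<circ> ?t))"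
    unfolding O using p by (intro M.finsum_reindex[OF _ inj]) auto
  also have "\<dots> = (\<Oplus>\<^bsub>U\<^esub>\<pi>\<in>?E. \<ominus>\<^bsub>U\<^esub> p \<pi>)"
    using p even by (intro M.finsum_cong') (auto simp: sign_def pt add_pow_int_lt)
  also have "(\<Oplus>\<^bsub>U\<^esub>\<pi>\<in>?E. p \<pi>) \<oplus>\<^bsub>U\<^esub> (\<Oplus>\<^bsub>U\<^esub>\<pi>\<in>?E. \<ominus>\<^bsub>U\<^esub> p \<pi>) = (\<Oplus>\<^bsub>U\<^esub>\<pi>\<in>?E. p \<pi> \<oplus>\<^bsub>U\<^esub> \<ominus>\<^bsub>U\<^esub> p \<pi>)"
    using p by (intro M.finsum_addf[symmetric]) auto
  also have "\<dots> = \<zero>\<^bsub>U\<^esub>" using p by (simp add: M.r_neg)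
  finally show ?thesis .
qed

lemma wronskian_cochain: "wronskian U D k \<in> cochains K U (Suc k)"
  unfolding cochains_def multilinear_def
  by (intro CollectI conjI allI impI ballI; elim conjE)
    (simp_all only: wronskian_closed wronskian_add wronskian_smult wronskian_alternating not_False_eq_True)

end

section \<open>Symbols of the three identities\<close>

context symbol_evaluation
begin

lemma wronskian_nested_inj:
  assumes \<sigma>: "inj_on \<sigma> {1..k + q + 1}"
  shows "wronskian U D k (map (\<lambda>m. a (\<sigma> m)) [1..<k + 1] @
      [wronskian U D q (map (\<lambda>m. a (\<sigma> m)) [k + 1..<k + q + 2])]) =
    symbol_value a (\<sigma> ` {1..k + q + 1}) (nested_vandermonde k q (var \<circ> \<sigma>))"
proof -
  \<comment> \<open>The last entry \<sigma> (k + 1) of \<open>?zs\<close> is the placeholder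
    overwritten by the inner Wronskian; it also heads \<open>?ys\<close>.\<close>
  let ?zs = "map \<sigma> [1..<k + 2]" and ?ys = "map \<sigma> [k + 1..<k + q + 2]"
  have dist: "distinct ?zs" "distinct ?ys"
    using inj_on_subset[OF \<sigma>, of "{1..<k + 2}"] inj_on_subset[OF \<sigma>, of "{k + 1..<k + q + 2}"]
    by (auto simp: distinct_map subset_iff)
  have zk: "?zs ! k = \<sigma> (k + 1)" by simp
  have zs: "set ?zs - {?zs ! k} = \<sigma> ` {1..k}"
  proof -
    have "set ?zs - {?zs ! k} = \<sigma> ` {1..k + 1} - \<sigma> ` {k + 1}"
      unfolding zk by (auto simp: less_Suc_eq_le)
    also have "\<dots> = \<sigma> ` ({1..k + 1} - {k + 1})"
      by (rule inj_on_image_set_diff[OF \<sigma>, symmetric]) auto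
    also have "{1..k + 1} - {k + 1} = {1..k}" by auto
    finally show ?thesis .
  qed
  have ys: "set ?ys = \<sigma> ` {k + 1..k + q + 1}" by (auto simp: less_Suc_eq_le)
  have "\<sigma> ` {k + 1..k + q + 1} \<inter> \<sigma> ` {1..k} = \<sigma> ` ({k + 1..k + q + 1} \<inter> {1..k})"
    by (rule inj_on_image_Int[OF \<sigma>, symmetric]) auto
  then have "set ?ys \<inter> (set ?zs - {?zs ! k}) = {}" unfolding zs ys by simp
  note nested = wronskian_nested[OF dist(1) _ dist(2) _ _ this]
  have "map (\<lambda>m. a (\<sigma> m)) [1..<k + 1] @ [w] = (map a ?zs)[k := w]" for w
    by (simp add: o_def list_update_append upt_Suc)
  then have "wronskian U D k (map (\<lambda>m. a (\<sigma> m)) [1..<k + 1] @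
      [wronskian U D q (map (\<lambda>m. a (\<sigma> m)) [k + 1..<k + q + 2])]) =
      wronskian U D k ((map a ?zs)[k := wronskian U D q (map a ?ys)])"
    by (simp add: o_def)
  also have "\<dots> = symbol_value a (\<sigma> ` {1..k} \<union> \<sigma> ` {k + 1..k + q + 1})
      (vandermonde k (\<lambda>j. if j = k then \<Sum>y\<in>\<sigma> ` {k + 1..k + q + 1}. var y else var (?zs ! j)) *
       vandermonde q (\<lambda>j. var (?ys ! j)))"
    unfolding zs[symmetric] ys[symmetric] by (rule nested) auto
  also have "\<sigma> ` {1..k} \<union> \<sigma> ` {k + 1..k + q + 1} = \<sigma> ` {1..k + q + 1}"
    unfolding image_Un[symmetric] by (rule arg_cong[where f = "image \<sigma>"]) auto
  also have "vandermonde k (\<lambda>j. if j = k then \<Sum>y\<in>\<sigma> ` {k + 1..k + q + 1}. var y else var (?zs ! j)) =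
      vandermonde k (\<lambda>j. if j < k then (var \<circ> \<sigma>) (Suc j) else \<Sum>m\<in>{k + 1..k + q + 1}. (var \<circ> \<sigma>) m)"
  proof (rule alternant_cong)
    fix j assume "j \<le> k"
    moreover have "(\<Sum>y\<in>\<sigma> ` {k + 1..k + q + 1}. var y) = (\<Sum>m\<in>{k + 1..k + q + 1}. (var \<circ> \<sigma>) m)"
      by (rule sum.reindex) (rule inj_on_subset[OF \<sigma>], auto)
    ultimately show "(if j = k then \<Sum>y\<in>\<sigma> ` {k + 1..k + q + 1}. var y else var (?zs ! j)) =
        (if j < k then (var \<circ> \<sigma>) (Suc j) else \<Sum>m\<in>{k + 1..k + q + 1}. (var \<circ> \<sigma>) m)"
      by simp
  qed
  also have "vandermonde q (\<lambda>j. var (?ys ! j)) = vandermonde q (\<lambda>m. (var \<circ> \<sigma>) (k + 1 + m))"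
    by (rule alternant_cong) simp
  finally show ?thesis unfolding nested_vandermonde_def .
qed

lemma signed_sum_symbol_value:
  assumes "finite S" "S \<noteq> {}" "\<And>\<sigma>. \<sigma> \<in> I \<Longrightarrow> w \<sigma> = symbol_value a S (f \<sigma>)"
  shows "(\<Oplus>\<^bsub>U\<^esub>\<sigma>\<in>I. [sign \<sigma>] \<cdot>\<^bsub>U\<^esub> w \<sigma>) = symbol_value a S (\<Sum>\<sigma>\<in>I. of_int (sign \<sigma>) * f \<sigma>)"
proof -
  have "(\<Oplus>\<^bsub>U\<^esub>\<sigma>\<in>I. [sign \<sigma>] \<cdot>\<^bsub>U\<^esub> w \<sigma>) = (\<Oplus>\<^bsub>U\<^esub>\<sigma>\<in>I. symbol_value a S (of_int (sign \<sigma>) * f \<sigma>))"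
    using assms by (intro M.finsum_cong') (auto simp: symbol_value_of_int_mult symbol_value_closed)
  then show ?thesis by (simp add: symbol_value_sum[OF assms(1,2)])
qed

lemma shuffle_sum_eq_0:
  assumes "k > 0" "q > 0"
  shows "(\<Oplus>\<^bsub>U\<^esub>\<sigma>\<in>shuffle_perms k (q + 1). [sign \<sigma>] \<cdot>\<^bsub>U\<^esub>
      wronskian U D k (map (\<lambda>m. a (\<sigma> m)) [1..<k + 1] @
        [wronskian U D q (map (\<lambda>m. a (\<sigma> m)) [k + 1..<k + q + 2])])) = \<zero>\<^bsub>U\<^esub>"
  (is "?lhs = _")
proof -
  have eq: "wronskian U D k (map (\<lambda>m. a (\<sigma> m)) [1..<k + 1] @
        [wronskian U D q (map (\<lambda>m. a (\<sigma> m)) [k + 1..<k + q + 2])]) =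
      symbol_value a {1..k + q + 1} (nested_vandermonde k q (var \<circ> \<sigma>))"
    if "\<sigma> \<in> shuffle_perms k (q + 1)" for \<sigma>
  proof -
    have "\<sigma> permutes {1..k + q + 1}" using that by (simp add: shuffle_perms_def)
    then show ?thesis
      using wronskian_nested_inj[of \<sigma> k q, OF permutes_inj_on] by (simp only: permutes_image)
  qed
  have "?lhs = symbol_value a {1..k + q + 1}
      (\<Sum>\<sigma>\<in>shuffle_perms k (q + 1). of_int (sign \<sigma>) * nested_vandermonde k q (var \<circ> \<sigma>))"
    by (rule signed_sum_symbol_value) (simp, simp, rule eq)
  then show ?thesis
    by (simp only: nested_vandermonde_shuffle_sum[OF assms] symbol_value_0)
qed

lemma left_commutative_sum:
  "(\<Oplus>\<^bsub>U\<^esub>\<sigma>\<in>{\<sigma>. \<sigma> permutes {1..2 * k}}. [sign \<sigma>] \<cdot>\<^bsub>U\<^esub>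
      wronskian U D k (map (\<lambda>m. a (\<sigma> m)) [1..<k + 1] @
        [wronskian U D k (map (\<lambda>m. a (\<sigma> m)) [k + 1..<2 * k + 1] @ [a (2 * k + 1)])])) =
    symbol_value a {1..2 * k + 1}
      (\<Sum>\<sigma> | \<sigma> permutes {1..2 * k}. of_int (sign \<sigma>) * nested_vandermonde k k (var \<circ> \<sigma>))"
proof (rule signed_sum_symbol_value)
  fix \<sigma> assume "\<sigma> \<in> {\<sigma>. \<sigma> permutes {1..2 * k}}"
  then have \<sigma>: "\<sigma> permutes {1..2 * k}" by simp
  then have \<sigma>': "\<sigma> permutes {1..k + k + 1}" by (rule permutes_subset) auto
  \<comment> \<open>The unpermuted argument is treated as the last permuted one under a \<sigma>
    that fixes its index, which brings the term into the form of
    \<open>wronskian_nested_inj\<close>.\<close>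
  have "\<sigma> (2 * k + 1) = 2 * k + 1" using permutes_not_in[OF \<sigma>] by simp
  then have "map (\<lambda>m. a (\<sigma> m)) [k + 1..<2 * k + 1] @ [a (2 * k + 1)] =
      map (\<lambda>m. a (\<sigma> m)) [k + 1..<k + k + 2]"
    by (simp add: mult_2 upt_Suc)
  moreover have "{1..k + k + 1} = {1..2 * k + 1}" by auto
  ultimately show "wronskian U D k (map (\<lambda>m. a (\<sigma> m)) [1..<k + 1] @
        [wronskian U D k (map (\<lambda>m. a (\<sigma> m)) [k + 1..<2 * k + 1] @ [a (2 * k + 1)])]) =
      symbol_value a {1..2 * k + 1} (nested_vandermonde k k (var \<circ> \<sigma>))"
    using wronskian_nested_inj[of \<sigma> k k, OF permutes_inj_on[OF \<sigma>'], unfolded permutes_image[OF \<sigma>']]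
    by (simp only:)
qed auto

text \<open>Variables 0, ..., k - 1 belong to \<open>as\<close> and k, ..., 2k to \<open>bs\<close>.
  That \<open>var k\<close> appears both as s_k and as t_0 does no harm: \<open>lie_defect\<close>
  overwrites entry k of s.\<close>

lemma wronskian_lie_defect:
  assumes "k > 0"
  defines "as \<equiv> map a [0..<k]" and "bs \<equiv> map a [k..<2 * k + 1]"
  shows "wronskian U D k (as @ [wronskian U D k bs]) \<ominus>\<^bsub>U\<^esub>
      (\<Oplus>\<^bsub>U\<^esub>i\<in>{..<k + 1}. wronskian U D k (bs[i := wronskian U D k (as @ [bs ! i])])) =
    symbol_value a {0..2 * k} (lie_defect k var (\<lambda>j. var (k + j)))"
proof -
  let ?s = "var" and ?t = "\<lambda>j. var (k + j)"
  have fin: "finite {0..2 * k}" "{0..2 * k} \<noteq> {}" by auto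
  have sum_t: "(\<Sum>y\<in>{k..2 * k}. var y) = (\<Sum>j\<in>{0..k}. ?t j)"
    using sum.shift_bounds_cl_nat_ivl[of var 0 k k] by (simp add: mult_2 add.commute)
  have "as @ [w] = (map a [0..<k + 1])[k := w]" for w
    by (simp add: as_def list_update_append upt_Suc)
  then have "wronskian U D k (as @ [wronskian U D k bs]) =
      wronskian U D k ((map a [0..<k + 1])[k := wronskian U D k (map a [k..<2 * k + 1])])"
    by (simp add: bs_def)
  also have "\<dots> = symbol_value a (set [0..<k + 1] - {[0..<k + 1] ! k} \<union> set [k..<2 * k + 1])
      (vandermonde k (\<lambda>j. if j = k then \<Sum>y\<in>set [k..<2 * k + 1]. var y else var ([0..<k + 1] ! j)) *
       vandermonde k (\<lambda>j. var ([k..<2 * k + 1] ! j)))"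
    by (rule wronskian_nested) auto
  also have "set [0..<k + 1] - {[0..<k + 1] ! k} \<union> set [k..<2 * k + 1] = {0..2 * k}"
    by auto
  also have "set [k..<2 * k + 1] = {k..2 * k}" by auto
  also have "vandermonde k (\<lambda>j. if j = k then \<Sum>y\<in>{k..2 * k}. var y else var ([0..<k + 1] ! j)) =
      vandermonde k (?s(k := \<Sum>j\<in>{0..k}. ?t j))"
    unfolding sum_t by (rule alternant_cong) auto
  also have "vandermonde k (\<lambda>j. var ([k..<2 * k + 1] ! j)) = vandermonde k ?t"
    by (rule alternant_cong) auto
  finally have 1: "wronskian U D k (as @ [wronskian U D k bs]) = symbol_value a {0..2 * k}
      (vandermonde k (?s(k := \<Sum>j\<in>{0..k}. ?t j)) * vandermonde k ?t)" .
  have 2: "wronskian U D k (bs[i := wronskian U D k (as @ [bs ! i])]) = symbol_value a {0..2 * k}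
      (vandermonde k (?t(i := ?t i + (\<Sum>j\<in>{0..<k}. ?s j))) * vandermonde k (?s(k := ?t i)))"
    if "i \<in> {..<k + 1}" for i
  proof -
    have i: "i \<le> k" using that by auto
    have zi: "[k..<2 * k + 1] ! i = k + i" using i by simp
    have "wronskian U D k (bs[i := wronskian U D k (as @ [bs ! i])]) =
        wronskian U D k ((map a [k..<2 * k + 1])[i := wronskian U D k (map a ([0..<k] @ [k + i]))])"
      using i by (simp add: bs_def as_def)
    also have "\<dots> = symbol_value a (set [k..<2 * k + 1] - {[k..<2 * k + 1] ! i} \<union> set ([0..<k] @ [k + i]))
        (vandermonde k (\<lambda>j. if j = i then \<Sum>y\<in>set ([0..<k] @ [k + i]). var y else var ([k..<2 * k + 1] ! j)) *
         vandermonde k (\<lambda>j. var (([0..<k] @ [k + i]) ! j)))"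
      by (rule wronskian_nested) (use i in auto)
    also have "set [k..<2 * k + 1] - {[k..<2 * k + 1] ! i} \<union> set ([0..<k] @ [k + i]) = {0..2 * k}"
      unfolding zi using i by auto
    also have "vandermonde k (\<lambda>j. if j = i then \<Sum>y\<in>set ([0..<k] @ [k + i]). var y else var ([k..<2 * k + 1] ! j)) =
        vandermonde k (?t(i := ?t i + (\<Sum>j\<in>{0..<k}. ?s j)))"
      by (rule alternant_cong) auto
    also have "vandermonde k (\<lambda>j. var (([0..<k] @ [k + i]) ! j)) = vandermonde k (?s(k := ?t i))"
      by (rule alternant_cong) (auto simp: nth_append)
    finally show ?thesis .
  qed
  let ?B = "\<lambda>i. vandermonde k (?t(i := ?t i + (\<Sum>j\<in>{0..<k}. ?s j))) * vandermonde k (?s(k := ?t i))"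
  have 3: "(\<Oplus>\<^bsub>U\<^esub>i\<in>{..<k + 1}. wronskian U D k (bs[i := wronskian U D k (as @ [bs ! i])])) =
      symbol_value a {0..2 * k} (\<Sum>i\<in>{..<k + 1}. ?B i)"
    unfolding symbol_value_sum[OF fin]
    by (rule M.finsum_cong'[OF refl _ 2]) (rule Pi_I, rule symbol_value_closed[OF fin])
  have set: "{0..k} = {..<k + 1}" by auto
  have "lie_defect k ?s ?t =
      vandermonde k (?s(k := \<Sum>j\<in>{0..k}. ?t j)) * vandermonde k ?t - (\<Sum>i\<in>{..<k + 1}. ?B i)"
    unfolding lie_defect_def set ..
  then show ?thesis by (simp only: symbol_value_diff[OF fin] 1 3)
qed

text \<open>A p-fold multiple in U is multiplication by the scalar p of K, which is 0. For p = 0 the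
  hypothesis says c = 0.\<close>

lemma symbol_value_dvd:
  assumes p: "has_characteristic K p" and S: "finite S" "S \<noteq> {}" and dvd: "of_nat p dvd c"
  shows "symbol_value a S c = \<zero>\<^bsub>U\<^esub>"
proof -
  obtain d where "c = of_nat p * d" using dvd by (rule dvdE)
  then have "symbol_value a S c = [int p] \<cdot>\<^bsub>U\<^esub> symbol_value a S d"
    using symbol_value_of_int_mult[OF S, of "int p" d] by simp
  also have "\<dots> = [p] \<cdot>\<^bsub>U\<^esub> symbol_value a S d" by (simp add: add_pow_int_ge)
  also have "\<dots> = ([p] \<cdot>\<^bsub>K\<^esub> \<one>\<^bsub>K\<^esub>) \<odot>\<^bsub>U\<^esub> symbol_value a S d"
  proof -
    have "[n] \<cdot>\<^bsub>U\<^esub> x = ([n] \<cdot>\<^bsub>K\<^esub> \<one>\<^bsub>K\<^esub>) \<odot>\<^bsub>U\<^esub> x" if "x \<in> carrier U" for n :: nat and x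
      using that by (induction n) (auto simp: smult_l_distr smult_l_null)
    then show ?thesis by (simp add: symbol_value_closed[OF S])
  qed
  also have "[p] \<cdot>\<^bsub>K\<^esub> \<one>\<^bsub>K\<^esub> = \<zero>\<^bsub>K\<^esub>" using p by (simp add: has_characteristic_def)
  finally show ?thesis by (simp add: smult_l_null symbol_value_closed[OF S])
qed

end

section \<open>The positive results for an arbitrary differential algebra\<close>

context differential_algebra
begin

text \<open>The identities give arguments on a finite index set only, whereas
  \<open>symbol_evaluation\<close> assumes a total assignment; zero fills the rest.\<close>

lemma symbol_evaluation_extend:
  assumes "a \<in> I \<rightarrow> carrier U"
  obtains b where "symbol_evaluation K U D b" "\<And>s. s \<in> I \<Longrightarrow> b s = a s"
proof -
  define b where "b s = (if s \<in> I then a s else \<zero>\<^bsub>U\<^esub>)" for s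
  have "b s \<in> carrier U" for s unfolding b_def using assms by auto
  then have "symbol_evaluation K U D b"
    by (intro symbol_evaluation.intro symbol_evaluation_axioms.intro differential_algebra_axioms)
  moreover have "\<And>s. s \<in> I \<Longrightarrow> b s = a s" by (simp add: b_def)
  ultimately show ?thesis by (rule that)
qed

lemma shuffle_identity_wronskian:
  assumes "k > 0" "q > 0"
  shows "shuffle_identity U (k + 1) (q + 1) (wronskian U D k) (wronskian U D q)"
  unfolding shuffle_identity_def
proof
  fix a assume a: "a \<in> {1..k + 1 + (q + 1) - 1} \<rightarrow> carrier U"
  have N: "k + 1 + (q + 1) - 1 = k + q + 1" "k + 1 + (q + 1) = k + q + 2" "k + 1 - 1 = k" by simp_all
  obtain b where b: "symbol_evaluation K U D b" and ba: "\<And>s. s \<in> {1..k + q + 1} \<Longrightarrow> b s = a s"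
    by (rule symbol_evaluation_extend[OF a[unfolded N(1)]]) (rule that)
  interpret E: symbol_evaluation K U D b by (rule b)
  have eq: "map (\<lambda>m. a (\<sigma> m)) [i..<j] = map (\<lambda>m. b (\<sigma> m)) [i..<j]"
    if "\<sigma> \<in> shuffle_perms k (q + 1)" "i \<ge> 1" "j \<le> k + q + 2" for \<sigma> i j
  proof (rule map_cong[OF refl])
    fix m assume "m \<in> set [i..<j]"
    then have m: "m \<in> {1..k + q + 1}" using that by auto
    have "\<sigma> permutes {1..k + q + 1}" using that by (simp add: shuffle_perms_def)
    then have "\<sigma> m \<in> {1..k + q + 1}" using m by (simp only: permutes_in_image)
    then show "a (\<sigma> m) = b (\<sigma> m)" by (simp only: ba)
  qed
  let ?w = "\<lambda>a \<sigma>. [sign \<sigma>] \<cdot>\<^bsub>U\<^esub> wronskian U D k (map (\<lambda>m. a (\<sigma> m)) [1..<k + 1] @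
      [wronskian U D q (map (\<lambda>m. a (\<sigma> m)) [k + 1..<k + q + 2])])"
  have "(\<Oplus>\<^bsub>U\<^esub>\<sigma>\<in>shuffle_perms k (q + 1). ?w a \<sigma>) = (\<Oplus>\<^bsub>U\<^esub>\<sigma>\<in>shuffle_perms k (q + 1). ?w b \<sigma>)"
  proof (rule M.finsum_cong')
    fix \<sigma> assume \<sigma>: "\<sigma> \<in> shuffle_perms k (q + 1)"
    have "map (\<lambda>m. a (\<sigma> m)) [1..<k + 1] = map (\<lambda>m. b (\<sigma> m)) [1..<k + 1]"
      "map (\<lambda>m. a (\<sigma> m)) [k + 1..<k + q + 2] = map (\<lambda>m. b (\<sigma> m)) [k + 1..<k + q + 2]"
      by (rule eq[OF \<sigma>]; simp)+
    then show "?w a \<sigma> = ?w b \<sigma>" by (simp only:)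
  next
    have "?w b \<sigma> \<in> carrier U" for \<sigma>
    proof (rule M.add.int_pow_closed)
      have "wronskian U D q (map (\<lambda>m. b (\<sigma> m)) [k + 1..<k + q + 2]) \<in> carrier U"
        by (intro wronskian_closed) (auto simp: E.a_closed)
      then show "wronskian U D k (map (\<lambda>m. b (\<sigma> m)) [1..<k + 1] @
          [wronskian U D q (map (\<lambda>m. b (\<sigma> m)) [k + 1..<k + q + 2])]) \<in> carrier U"
        by (intro wronskian_closed) (auto simp: E.a_closed)
    qed
    then show "?w b \<in> shuffle_perms k (q + 1) \<rightarrow> carrier U" by blast
  qed (rule refl)
  also have "\<dots> = \<zero>\<^bsub>U\<^esub>" by (rule E.shuffle_sum_eq_0[OF assms])
  finally show "(\<Oplus>\<^bsub>U\<^esub>\<sigma>\<in>shuffle_perms (k + 1 - 1) (q + 1). [sign \<sigma>] \<cdot>\<^bsub>U\<^esub>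
      wronskian U D k (map (\<lambda>m. a (\<sigma> m)) [1..<k + 1] @
        [wronskian U D q (map (\<lambda>m. a (\<sigma> m)) [k + 1..<k + 1 + (q + 1)])])) = \<zero>\<^bsub>U\<^esub>"
    unfolding N .
qed

end

context differential_algebra
begin

lemma homotopical_n_lie_wronskian:
  assumes "k > 0"
  shows "homotopical_n_lie K U (k + 1) (wronskian U D k)"
  unfolding homotopical_n_lie_def
  using wronskian_cochain[of k] shuffle_identity_wronskian[OF assms assms] by simp

lemma zero_cochain: "(\<lambda>us. \<zero>\<^bsub>U\<^esub>) \<in> cochains K U n"
  by (simp add: cochains_def multilinear_def smult_r_null)

lemma smult_wronskian_cochain:
  assumes c: "c \<in> carrier K"
  shows "(\<lambda>us. c \<odot>\<^bsub>U\<^esub> wronskian U D k us) \<in> cochains K U (Suc k)"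
proof -
  have upd: "wronskian U D k (us[i := x]) \<in> carrier U"
    if "length us = Suc k" "set us \<subseteq> carrier U" "x \<in> carrier U" for us i x
    using that set_update_subset_insert[of us i x] by (intro wronskian_closed) auto
  have comm: "c \<odot>\<^bsub>U\<^esub> (d \<odot>\<^bsub>U\<^esub> x) = d \<odot>\<^bsub>U\<^esub> (c \<odot>\<^bsub>U\<^esub> x)" if "d \<in> carrier K" "x \<in> carrier U" for d x
    using that c by (simp add: smult_assoc1[symmetric] R.m_comm)
  show ?thesis
    unfolding cochains_def multilinear_def
    by (intro CollectI conjI allI impI ballI; elim conjE)
      (simp_all only: wronskian_closed wronskian_add wronskian_smult wronskian_alternating
        not_False_eq_True smult_closed c smult_r_null smult_r_distr upd comm)
qed

lemma shuffle_identity_zero_left: "shuffle_identity U i j (\<lambda>us. \<zero>\<^bsub>U\<^esub>) \<omega>"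
  by (simp add: shuffle_identity_def M.add.int_pow_one)

text \<open>This covers i \<ge> 2, j = 1 when the unary operation is zero. The disjunction lets
  \<omega> be known on proper argument lists only.\<close>

lemma shuffle_identity_zero_right:
  assumes "\<And>us. \<omega> (us @ [\<zero>\<^bsub>U\<^esub>]) = \<zero>\<^bsub>U\<^esub> \<or> length us \<noteq> i - 1 \<or> \<not> set us \<subseteq> carrier U"
    and "i \<ge> 1" "j \<ge> 1"
  shows "shuffle_identity U i j \<omega> (\<lambda>us. \<zero>\<^bsub>U\<^esub>)"
  unfolding shuffle_identity_def
proof
  fix a assume a: "a \<in> {1..i + j - 1} \<rightarrow> carrier U"
  have "\<omega> (map (\<lambda>m. a (\<sigma> m)) [1..<i] @ [\<zero>\<^bsub>U\<^esub>]) = \<zero>\<^bsub>U\<^esub>" if "\<sigma> \<in> shuffle_perms (i - 1) j" for \<sigma>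
  proof -
    have "\<sigma> permutes {1..i + j - 1}" using that assms(2) by (simp add: shuffle_perms_def)
    then have "a (\<sigma> m) \<in> carrier U" if "m \<in> {1..i + j - 1}" for m
      using a that by (auto simp: Pi_iff permutes_in_image simp del: atLeastAtMost_iff)
    then have "set (map (\<lambda>m. a (\<sigma> m)) [1..<i]) \<subseteq> carrier U" using assms(3) by auto
    then show ?thesis using assms(1)[of "map (\<lambda>m. a (\<sigma> m)) [1..<i]"] by auto
  qed
  then have "(\<Oplus>\<^bsub>U\<^esub>\<sigma>\<in>shuffle_perms (i - 1) j. [sign \<sigma>] \<cdot>\<^bsub>U\<^esub>
      \<omega> (map (\<lambda>m. a (\<sigma> m)) [1..<i] @ [\<zero>\<^bsub>U\<^esub>])) = (\<Oplus>\<^bsub>U\<^esub>\<sigma>\<in>shuffle_perms (i - 1) j. \<zero>\<^bsub>U\<^esub>)"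
    by (intro M.finsum_cong') (simp_all add: M.add.int_pow_one)
  then show "(\<Oplus>\<^bsub>U\<^esub>\<sigma>\<in>shuffle_perms (i - 1) j. [sign \<sigma>] \<cdot>\<^bsub>U\<^esub>
      \<omega> (map (\<lambda>m. a (\<sigma> m)) [1..<i] @ [\<zero>\<^bsub>U\<^esub>])) = \<zero>\<^bsub>U\<^esub>" by simp
qed

lemma wronskian_smult_last:
  assumes "length us = k" "set us \<subseteq> carrier U" "c \<in> carrier K" "x \<in> carrier U"
  shows "wronskian U D k (us @ [c \<odot>\<^bsub>U\<^esub> x]) = c \<odot>\<^bsub>U\<^esub> wronskian U D k (us @ [x])"
  using wronskian_smult[of "us @ [x]" k k c x] assms by (simp add: list_update_append)

text \<open>The shuffle sum is linear in each of the two operations: d leaves the last argument of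
  the outer Wronskian, and c d then factors out.\<close>

lemma shuffle_identity_smult:
  assumes "k > 0" "q > 0" and c: "c \<in> carrier K" and d: "d \<in> carrier K"
  shows "shuffle_identity U (k + 1) (q + 1)
    (\<lambda>us. c \<odot>\<^bsub>U\<^esub> wronskian U D k us) (\<lambda>us. d \<odot>\<^bsub>U\<^esub> wronskian U D q us)"
  unfolding shuffle_identity_def
proof
  fix a assume a: "a \<in> {1..k + 1 + (q + 1) - 1} \<rightarrow> carrier U"
  let ?w = "\<lambda>\<sigma>. wronskian U D q (map (\<lambda>m. a (\<sigma> m)) [k + 1..<k + 1 + (q + 1)])"
  let ?xs = "\<lambda>\<sigma>. map (\<lambda>m. a (\<sigma> m)) [1..<k + 1]"
  let ?S = "shuffle_perms (k + 1 - 1) (q + 1)"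
  have cd: "c \<otimes>\<^bsub>K\<^esub> d \<in> carrier K" using c d by simp
  have mem: "a (\<sigma> m) \<in> carrier U" if "\<sigma> \<in> ?S" "m \<in> {1..k + q + 1}" for \<sigma> m
  proof -
    have "\<sigma> permutes {1..k + q + 1}" using that by (simp add: shuffle_perms_def)
    then have "\<sigma> m \<in> {1..k + q + 1}" using that by (simp only: permutes_in_image)
    then show ?thesis using a by auto
  qed
  have pow: "(c \<otimes>\<^bsub>K\<^esub> d) \<odot>\<^bsub>U\<^esub> ([n] \<cdot>\<^bsub>U\<^esub> x) = [n] \<cdot>\<^bsub>U\<^esub> ((c \<otimes>\<^bsub>K\<^esub> d) \<odot>\<^bsub>U\<^esub> x)"
    if "x \<in> carrier U" for n :: int and x
    by (rule M.additive_int_pow[OF smult_additive(1)[OF cd] _ that]) (rule smult_additive(2)[OF cd])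
  have xs: "set (?xs \<sigma>) \<subseteq> carrier U" if "\<sigma> \<in> ?S" for \<sigma> using mem[OF that] by auto
  have w: "?w \<sigma> \<in> carrier U" if "\<sigma> \<in> ?S" for \<sigma>
    using mem[OF that] by (intro wronskian_closed) auto
  have W: "wronskian U D k (?xs \<sigma> @ [?w \<sigma>]) \<in> carrier U" if "\<sigma> \<in> ?S" for \<sigma>
    using xs[OF that] w[OF that] by (intro wronskian_closed) auto
  have "(\<Oplus>\<^bsub>U\<^esub>\<sigma>\<in>?S. [sign \<sigma>] \<cdot>\<^bsub>U\<^esub> (c \<odot>\<^bsub>U\<^esub> wronskian U D k (?xs \<sigma> @ [d \<odot>\<^bsub>U\<^esub> ?w \<sigma>]))) =
      (\<Oplus>\<^bsub>U\<^esub>\<sigma>\<in>?S. (c \<otimes>\<^bsub>K\<^esub> d) \<odot>\<^bsub>U\<^esub> ([sign \<sigma>] \<cdot>\<^bsub>U\<^esub> wronskian U D k (?xs \<sigma> @ [?w \<sigma>])))"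
  proof (rule M.finsum_cong'[OF refl])
    fix \<sigma> assume \<sigma>: "\<sigma> \<in> ?S"
    have "c \<odot>\<^bsub>U\<^esub> wronskian U D k (?xs \<sigma> @ [d \<odot>\<^bsub>U\<^esub> ?w \<sigma>]) = (c \<otimes>\<^bsub>K\<^esub> d) \<odot>\<^bsub>U\<^esub> wronskian U D k (?xs \<sigma> @ [?w \<sigma>])"
      using wronskian_smult_last[OF _ xs[OF \<sigma>] d w[OF \<sigma>], of k] smult_assoc1[OF c d W[OF \<sigma>]] by simp
    then show "[sign \<sigma>] \<cdot>\<^bsub>U\<^esub> (c \<odot>\<^bsub>U\<^esub> wronskian U D k (?xs \<sigma> @ [d \<odot>\<^bsub>U\<^esub> ?w \<sigma>])) =
        (c \<otimes>\<^bsub>K\<^esub> d) \<odot>\<^bsub>U\<^esub> ([sign \<sigma>] \<cdot>\<^bsub>U\<^esub> wronskian U D k (?xs \<sigma> @ [?w \<sigma>]))"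
      using pow[OF W[OF \<sigma>], of "sign \<sigma>"] by (simp only:)
  next
    show "(\<lambda>\<sigma>. (c \<otimes>\<^bsub>K\<^esub> d) \<odot>\<^bsub>U\<^esub> ([sign \<sigma>] \<cdot>\<^bsub>U\<^esub> wronskian U D k (?xs \<sigma> @ [?w \<sigma>]))) \<in> ?S \<rightarrow> carrier U"
      by (intro Pi_I smult_closed cd M.add.int_pow_closed W)
  qed
  also have "\<dots> = (c \<otimes>\<^bsub>K\<^esub> d) \<odot>\<^bsub>U\<^esub> (\<Oplus>\<^bsub>U\<^esub>\<sigma>\<in>?S. [sign \<sigma>] \<cdot>\<^bsub>U\<^esub> wronskian U D k (?xs \<sigma> @ [?w \<sigma>]))"
  proof (rule M.additive_finsum[symmetric])
    show "(\<lambda>x. (c \<otimes>\<^bsub>K\<^esub> d) \<odot>\<^bsub>U\<^esub> x) \<in> carrier U \<rightarrow> carrier U" by (rule smult_additive(1)[OF cd])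
    show "(\<lambda>\<sigma>. [sign \<sigma>] \<cdot>\<^bsub>U\<^esub> wronskian U D k (?xs \<sigma> @ [?w \<sigma>])) \<in> ?S \<rightarrow> carrier U"
      by (intro Pi_I M.add.int_pow_closed W)
  qed (rule smult_additive(2)[OF cd])
  also have "(\<Oplus>\<^bsub>U\<^esub>\<sigma>\<in>?S. [sign \<sigma>] \<cdot>\<^bsub>U\<^esub> wronskian U D k (?xs \<sigma> @ [?w \<sigma>])) = \<zero>\<^bsub>U\<^esub>"
    using shuffle_identity_wronskian[OF assms(1,2)] a unfolding shuffle_identity_def by blast
  finally show "(\<Oplus>\<^bsub>U\<^esub>\<sigma>\<in>?S. [sign \<sigma>] \<cdot>\<^bsub>U\<^esub> (c \<odot>\<^bsub>U\<^esub> wronskian U D k (?xs \<sigma> @ [d \<odot>\<^bsub>U\<^esub> ?w \<sigma>]))) = \<zero>\<^bsub>U\<^esub>"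
    using cd by (simp only: smult_r_null)
qed

text \<open>The operation of arity i is built on the Wronskian of index i - 1. Arity 1 has to be
  excluded: with \<omega>_1 = c id the identity for i = j = 1 would read c^2 a = 0.\<close>

lemma homotopical_lie_wronskian:
  assumes l: "l \<in> {2..} \<rightarrow> carrier K"
  shows "homotopical_lie K U (\<lambda>i us. if i \<le> 1 then \<zero>\<^bsub>U\<^esub> else l i \<odot>\<^bsub>U\<^esub> wronskian U D (i - 1) us)"
    (is "homotopical_lie K U ?\<omega>")
  unfolding homotopical_lie_def
proof (intro conjI allI impI)
  have \<omega>1: "?\<omega> 1 = (\<lambda>us. \<zero>\<^bsub>U\<^esub>)" by simp
  have \<omega>Suc: "?\<omega> (k + 1) = (\<lambda>us. l (k + 1) \<odot>\<^bsub>U\<^esub> wronskian U D k us)" if "k > 0" for k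
    using that by simp
  have lk: "l (k + 1) \<in> carrier K" if "k > 0" for k using l that by auto
  show cochain: "?\<omega> k \<in> cochains K U k" if "k \<ge> 1" for k
  proof (cases "k = 1")
    case True
    show ?thesis unfolding True \<omega>1 by (rule zero_cochain)
  next
    case False
    define m where "m = k - 1"
    have m: "k = m + 1" "m > 0" using that False by (auto simp: m_def)
    show ?thesis unfolding m(1) \<omega>Suc[OF m(2)] using smult_wronskian_cochain[OF lk[OF m(2)]] by simp
  qed
  fix i j :: nat assume i: "i \<ge> 1" and j: "j \<ge> 1"
  consider "i = 1" | "i \<noteq> 1" "j = 1" | "i \<noteq> 1" "j \<noteq> 1" by blast
  then show "shuffle_identity U i j (?\<omega> i) (?\<omega> j)"
  proof cases
    case 1
    show ?thesis unfolding 1 \<omega>1 by (rule shuffle_identity_zero_left)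
  next
    case 2
    have "?\<omega> i (us @ [\<zero>\<^bsub>U\<^esub>]) = \<zero>\<^bsub>U\<^esub>" if us: "length us = i - 1" "set us \<subseteq> carrier U" for us
    proof -
      have "wronskian U D (i - 1) (us @ [\<zero>\<^bsub>K\<^esub> \<odot>\<^bsub>U\<^esub> \<zero>\<^bsub>U\<^esub>]) = \<zero>\<^bsub>K\<^esub> \<odot>\<^bsub>U\<^esub> wronskian U D (i - 1) (us @ [\<zero>\<^bsub>U\<^esub>])"
        using us by (intro wronskian_smult_last) auto
      also have "\<dots> = \<zero>\<^bsub>U\<^esub>" using us by (intro smult_l_null wronskian_closed) auto
      finally have "wronskian U D (i - 1) (us @ [\<zero>\<^bsub>U\<^esub>]) = \<zero>\<^bsub>U\<^esub>" by (simp add: smult_l_null)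
      moreover have "l i \<in> carrier K" using l 2 i by auto
      ultimately show ?thesis by (simp add: smult_r_null)
    qed
    then show ?thesis unfolding 2(2) \<omega>1 using i by (intro shuffle_identity_zero_right) auto
  next
    case 3
    define k q where "k = i - 1" and "q = j - 1"
    have k: "i = k + 1" "k > 0" and q: "j = q + 1" "q > 0"
      using 3 i j by (auto simp: k_def q_def)
    show ?thesis
      unfolding k(1) q(1) \<omega>Suc[OF k(2)] \<omega>Suc[OF q(2)]
      by (rule shuffle_identity_smult[OF k(2) q(2) lk[OF k(2)] lk[OF q(2)]])
  qed
qed

lemma left_commutative_wronskian:
  assumes p: "has_characteristic K p"
    and dvd: "of_nat p dvd (\<Sum>\<sigma> | \<sigma> permutes {1..2 * k}. of_int (sign \<sigma>) * nested_vandermonde k k (var \<circ> \<sigma>))"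
  shows "left_commutative U k (wronskian U D k)"
  unfolding left_commutative_def
proof
  fix a assume a: "a \<in> {1..2 * k + 1} \<rightarrow> carrier U"
  obtain b where b: "symbol_evaluation K U D b" and ba: "\<And>s. s \<in> {1..2 * k + 1} \<Longrightarrow> b s = a s"
    by (rule symbol_evaluation_extend[OF a]) (rule that)
  interpret E: symbol_evaluation K U D b by (rule b)
  let ?w = "\<lambda>a \<sigma>. [sign \<sigma>] \<cdot>\<^bsub>U\<^esub> wronskian U D k (map (\<lambda>i. a (\<sigma> i)) [1..<k + 1] @
      [wronskian U D k (map (\<lambda>i. a (\<sigma> i)) [k + 1..<2 * k + 1] @ [a (2 * k + 1)])])"
  have "(\<Oplus>\<^bsub>U\<^esub>\<sigma>\<in>{\<sigma>. \<sigma> permutes {1..2 * k}}. ?w a \<sigma>) = (\<Oplus>\<^bsub>U\<^esub>\<sigma>\<in>{\<sigma>. \<sigma> permutes {1..2 * k}}. ?w b \<sigma>)"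
  proof (rule M.finsum_cong'[OF refl])
    fix \<sigma> assume "\<sigma> \<in> {\<sigma>. \<sigma> permutes {1..2 * k}}"
    then have \<sigma>: "\<sigma> permutes {1..2 * k}" by simp
    have "map (\<lambda>m. a (\<sigma> m)) [i..<j] = map (\<lambda>m. b (\<sigma> m)) [i..<j]" if "i \<ge> 1" "j \<le> 2 * k + 1" for i j
    proof (rule map_cong[OF refl])
      fix m assume "m \<in> set [i..<j]"
      then have "m \<in> {1..2 * k}" using that by auto
      then have "\<sigma> m \<in> {1..2 * k}" using \<sigma> by (simp only: permutes_in_image)
      then show "a (\<sigma> m) = b (\<sigma> m)" by (intro ba[symmetric]) auto
    qed
    from this[of 1 "k + 1"] this[of "k + 1" "2 * k + 1"]
    have "map (\<lambda>i. a (\<sigma> i)) [1..<k + 1] = map (\<lambda>i. b (\<sigma> i)) [1..<k + 1]"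
      "map (\<lambda>i. a (\<sigma> i)) [k + 1..<2 * k + 1] = map (\<lambda>i. b (\<sigma> i)) [k + 1..<2 * k + 1]" by linarith+
    moreover have "a (2 * k + 1) = b (2 * k + 1)" by (rule ba[symmetric]) simp
    ultimately show "?w a \<sigma> = ?w b \<sigma>" by (simp only:)
  next
    have "?w b \<sigma> \<in> carrier U" for \<sigma>
    proof (rule M.add.int_pow_closed)
      have "wronskian U D k (map (\<lambda>i. b (\<sigma> i)) [k + 1..<2 * k + 1] @ [b (2 * k + 1)]) \<in> carrier U"
        by (intro wronskian_closed) (auto simp: E.a_closed)
      then show "wronskian U D k (map (\<lambda>i. b (\<sigma> i)) [1..<k + 1] @
          [wronskian U D k (map (\<lambda>i. b (\<sigma> i)) [k + 1..<2 * k + 1] @ [b (2 * k + 1)])]) \<in> carrier U"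
        by (intro wronskian_closed) (auto simp: E.a_closed)
    qed
    then show "?w b \<in> {\<sigma>. \<sigma> permutes {1..2 * k}} \<rightarrow> carrier U" by blast
  qed
  also have "\<dots> = \<zero>\<^bsub>U\<^esub>"
    unfolding E.left_commutative_sum by (rule E.symbol_value_dvd[OF p _ _ dvd]) auto
  finally show "(\<Oplus>\<^bsub>U\<^esub>\<sigma>\<in>{\<sigma>. \<sigma> permutes {1..2 * k}}. ?w a \<sigma>) = \<zero>\<^bsub>U\<^esub>" .
qed

lemma eq_if_minus_eq_0:
  assumes "x \<ominus>\<^bsub>U\<^esub> y = \<zero>\<^bsub>U\<^esub>" "x \<in> carrier U" "y \<in> carrier U"
  shows "x = y"
proof -
  have "x = x \<ominus>\<^bsub>U\<^esub> y \<oplus>\<^bsub>U\<^esub> y" using assms(2,3) by (simp add: a_minus_def M.a_assoc M.l_neg)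
  also have "\<dots> = y" unfolding assms(1) using assms(3) by simp
  finally show ?thesis .
qed

lemma n_lie_wronskian:
  assumes p: "has_characteristic K p" and k: "k > 0"
    and dvd: "of_nat p dvd lie_defect k var (\<lambda>j. var (k + j))"
  shows "n_lie K U (k + 1) (wronskian U D k)"
  unfolding n_lie_def
proof (intro conjI allI impI; (elim conjE)?)
  show "wronskian U D k \<in> cochains K U (k + 1)" using wronskian_cochain[of k] by simp
  fix as bs
  assume as: "length as = k + 1 - 1" "set as \<subseteq> carrier U" and bs: "length bs = k + 1" "set bs \<subseteq> carrier U"
  have "(\<lambda>s. (as @ bs) ! s) \<in> {0..2 * k} \<rightarrow> carrier U"
  proof
    fix s assume "s \<in> {0..2 * k}"
    then have "(as @ bs) ! s \<in> set (as @ bs)" using as bs by (intro nth_mem) auto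
    then show "(as @ bs) ! s \<in> carrier U" using as bs by auto
  qed
  then obtain a where a: "symbol_evaluation K U D a" and ab: "\<And>s. s \<in> {0..2 * k} \<Longrightarrow> a s = (as @ bs) ! s"
    by (rule symbol_evaluation_extend) (rule that)
  interpret E: symbol_evaluation K U D a by (rule a)
  have 1: "map a [0..<k] = as" using as by (intro nth_equalityI) (auto simp: ab nth_append)
  have 2: "map a [k..<2 * k + 1] = bs" using as bs by (intro nth_equalityI) (auto simp: ab nth_append)
  have w: "wronskian U D k (as @ [x]) \<in> carrier U" if "x \<in> carrier U" for x
    using as that by (intro wronskian_closed) auto
  let ?X = "wronskian U D k (as @ [wronskian U D k bs])"
  let ?Y = "\<Oplus>\<^bsub>U\<^esub>i\<in>{..<k + 1}. wronskian U D k (bs[i := wronskian U D k (as @ [bs ! i])])"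
  have "?X \<ominus>\<^bsub>U\<^esub> ?Y = \<zero>\<^bsub>U\<^esub>"
    using E.wronskian_lie_defect[OF k] E.symbol_value_dvd[OF p _ _ dvd, of "{0..2 * k}"]
    unfolding 1 2 by simp
  moreover have "?X \<in> carrier U" using bs by (intro w wronskian_closed) auto
  moreover have "?Y \<in> carrier U"
  proof (rule M.finsum_closed, rule Pi_I)
    fix i assume "i \<in> {..<k + 1}"
    then have "bs ! i \<in> carrier U" using bs nth_mem[of i bs] by auto
    then show "wronskian U D k (bs[i := wronskian U D k (as @ [bs ! i])]) \<in> carrier U"
      using w bs set_update_subset_insert[of bs i "wronskian U D k (as @ [bs ! i])"]
      by (intro wronskian_closed) auto
  qed
  ultimately show "?X = ?Y" by (rule eq_if_minus_eq_0)
qed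

end

section \<open>Divided powers\<close>

text \<open>\<open>x n\<close> plays the role of x^n / n!. By \<open>x_faithful\<close>, vanishing
  can be detected for multiples of \<open>x 0\<close>, so the evaluations below are arranged to end
  there.\<close>

locale divided_powers = differential_algebra +
  fixes x :: "nat \<Rightarrow> 'c"
  assumes x_closed: "x n \<in> carrier U"
    and D_x_0: "D (x 0) = \<zero>\<^bsub>U\<^esub>"
    and D_x_Suc: "D (x (Suc n)) = x n"
    and x_mult: "x m \<otimes>\<^bsub>U\<^esub> x n = [((m + n) choose n)] \<cdot>\<^bsub>U\<^esub> x (m + n)"
    and x_faithful: "[c] \<cdot>\<^bsub>U\<^esub> x 0 = \<zero>\<^bsub>U\<^esub> \<Longrightarrow> [(c::nat)] \<cdot>\<^bsub>K\<^esub> \<one>\<^bsub>K\<^esub> = \<zero>\<^bsub>K\<^esub>"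

text \<open>
  The Hurwitz product of sequences, for which the shift is a derivation; in closed form the
  \<open>n\<close>-th entry is the sum of \<open>(n choose i) f\<^sub>i g\<^sub>n\<^sub>-\<^sub>i\<close>.
\<close>

fun hurwitz_mult :: "('k, 'm) ring_scheme \<Rightarrow> nat \<Rightarrow> (nat \<Rightarrow> 'k) \<Rightarrow> (nat \<Rightarrow> 'k) \<Rightarrow> 'k" where
  "hurwitz_mult K 0 f g = f 0 \<otimes>\<^bsub>K\<^esub> g 0"
| "hurwitz_mult K (Suc n) f g =
    hurwitz_mult K n (\<lambda>i. f (Suc i)) g \<oplus>\<^bsub>K\<^esub> hurwitz_mult K n f (\<lambda>i. g (Suc i))"

text \<open>Finite support makes a sequence recoverable from a list over K, so that the algebra fits
  into any type into which such lists embed.\<close>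

definition finite_sequences :: "('k, 'm) ring_scheme \<Rightarrow> (nat \<Rightarrow> 'k) set" where
  "finite_sequences K = {f. (\<forall>n. f n \<in> carrier K) \<and> (\<exists>N. \<forall>n\<ge>N. f n = \<zero>\<^bsub>K\<^esub>)}"

section \<open>The Hurwitz algebra of finite sequences\<close>

context cring
begin

lemma hurwitz_mult_closed:
  "(\<And>n. f n \<in> carrier R) \<Longrightarrow> (\<And>n. g n \<in> carrier R) \<Longrightarrow> hurwitz_mult R n f g \<in> carrier R"
  by (induction n arbitrary: f g) auto

lemma hurwitz_mult_comm:
  assumes "\<And>n. f n \<in> carrier R" "\<And>n. g n \<in> carrier R"
  shows "hurwitz_mult R n f g = hurwitz_mult R n g f"
  using assms
proof (induction n arbitrary: f g)
  case 0
  then show ?case by (simp add: m_comm)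
next
  case (Suc n)
  have "hurwitz_mult R (Suc n) f g =
      hurwitz_mult R n g (\<lambda>i. f (Suc i)) \<oplus> hurwitz_mult R n (\<lambda>i. g (Suc i)) f"
    using Suc.IH[of "\<lambda>i. f (Suc i)" g] Suc.IH[of f "\<lambda>i. g (Suc i)"] Suc.prems by simp
  then show ?case using Suc.prems by (simp add: a_comm hurwitz_mult_closed)
qed

lemma hurwitz_mult_add_left:
  assumes "\<And>n. f n \<in> carrier R" "\<And>n. g n \<in> carrier R" "\<And>n. h n \<in> carrier R"
  shows "hurwitz_mult R n (\<lambda>i. f i \<oplus> g i) h = hurwitz_mult R n f h \<oplus> hurwitz_mult R n g h"
  using assms
proof (induction n arbitrary: f g h)
  case 0
  then show ?case by (simp add: l_distr)
next
  case (Suc n)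
  then show ?case
    using Suc.IH[of "\<lambda>i. f (Suc i)" "\<lambda>i. g (Suc i)" h] Suc.IH[of f g "\<lambda>i. h (Suc i)"]
    by (simp add: a_ac hurwitz_mult_closed)
qed

lemma hurwitz_mult_add_right:
  assumes "\<And>n. f n \<in> carrier R" "\<And>n. g n \<in> carrier R" "\<And>n. h n \<in> carrier R"
  shows "hurwitz_mult R n h (\<lambda>i. f i \<oplus> g i) = hurwitz_mult R n h f \<oplus> hurwitz_mult R n h g"
  using assms hurwitz_mult_add_left[of f g h n]
  by (simp add: hurwitz_mult_comm[of h])

lemma hurwitz_mult_smult_left:
  assumes "c \<in> carrier R" "\<And>n. f n \<in> carrier R" "\<And>n. g n \<in> carrier R"
  shows "hurwitz_mult R n (\<lambda>i. c \<otimes> f i) g = c \<otimes> hurwitz_mult R n f g"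
  using assms
proof (induction n arbitrary: f g)
  case 0
  then show ?case by (simp add: m_assoc)
next
  case (Suc n)
  then show ?case
    using Suc.IH[of "\<lambda>i. f (Suc i)" g] Suc.IH[of f "\<lambda>i. g (Suc i)"]
    by (simp add: r_distr hurwitz_mult_closed)
qed

text \<open>Both sides obey the same Leibniz recursion under the shift, which spares any identity
  between products of binomial coefficients.\<close>

lemma hurwitz_mult_assoc:
  assumes "\<And>n. f n \<in> carrier R" "\<And>n. g n \<in> carrier R" "\<And>n. h n \<in> carrier R"
  shows "hurwitz_mult R n (\<lambda>i. hurwitz_mult R i f g) h = hurwitz_mult R n f (\<lambda>i. hurwitz_mult R i g h)"
  using assms
proof (induction n arbitrary: f g h)
  case 0
  then show ?case by (simp add: m_assoc)
next
  case (Suc n)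
  note closed = Suc.prems hurwitz_mult_closed
  have "hurwitz_mult R (Suc n) (\<lambda>i. hurwitz_mult R i f g) h =
      (hurwitz_mult R n (\<lambda>i. hurwitz_mult R i (\<lambda>i. f (Suc i)) g) h \<oplus>
       hurwitz_mult R n (\<lambda>i. hurwitz_mult R i f (\<lambda>i. g (Suc i))) h) \<oplus>
      hurwitz_mult R n (\<lambda>i. hurwitz_mult R i f g) (\<lambda>i. h (Suc i))"
    by (simp add: hurwitz_mult_add_left closed)
  also have "\<dots> = (hurwitz_mult R n (\<lambda>i. f (Suc i)) (\<lambda>i. hurwitz_mult R i g h) \<oplus>
       hurwitz_mult R n f (\<lambda>i. hurwitz_mult R i (\<lambda>i. g (Suc i)) h)) \<oplus>
      hurwitz_mult R n f (\<lambda>i. hurwitz_mult R i g (\<lambda>i. h (Suc i)))"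
    using Suc.IH[of "\<lambda>i. f (Suc i)" g h] Suc.IH[of f "\<lambda>i. g (Suc i)" h] Suc.IH[of f g "\<lambda>i. h (Suc i)"]
      Suc.prems by simp
  also have "\<dots> = hurwitz_mult R (Suc n) f (\<lambda>i. hurwitz_mult R i g h)"
    by (simp add: hurwitz_mult_add_right closed a_assoc)
  finally show ?case .
qed

lemma hurwitz_mult_zero:
  "(\<And>n. g n \<in> carrier R) \<Longrightarrow> hurwitz_mult R n (\<lambda>i. \<zero>) g = \<zero>"
  by (induction n arbitrary: g) auto

text \<open>Keeps products finite. The bound a + b suits the induction: shifting a factor lowers its
  own bound by one, and n drops by one as well.\<close>

lemma hurwitz_mult_eq_0:
  assumes "\<And>n. f n \<in> carrier R" "\<And>n. g n \<in> carrier R"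
    and "\<And>n. n \<ge> a \<Longrightarrow> f n = \<zero>" "\<And>n. n \<ge> b \<Longrightarrow> g n = \<zero>" and "n \<ge> a + b"
  shows "hurwitz_mult R n f g = \<zero>"
  using assms
proof (induction n arbitrary: f g a b)
  case 0
  then show ?case by simp
next
  case (Suc n)
  show ?case
  proof (cases "a = 0 \<or> b = 0")
    case True
    then consider "f = (\<lambda>i. \<zero>)" | "g = (\<lambda>i. \<zero>)" using Suc.prems(3,4) by fastforce
    then show ?thesis
    proof cases
      case 1
      then show ?thesis using hurwitz_mult_zero[OF Suc.prems(2)] by simp
    next
      case 2
      then show ?thesis using hurwitz_mult_zero[OF Suc.prems(1)] Suc.prems(1)
        by (simp only: hurwitz_mult_comm[of f "\<lambda>i. \<zero>"] zero_closed)
    qed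
  next
    case False
    have "hurwitz_mult R n (\<lambda>i. f (Suc i)) g = \<zero>"
      using False Suc.prems by (intro Suc.IH[where a = "a - 1" and b = b]) auto
    moreover have "hurwitz_mult R n f (\<lambda>i. g (Suc i)) = \<zero>"
      using False Suc.prems by (intro Suc.IH[where a = a and b = "b - 1"]) auto
    ultimately show ?thesis by simp
  qed
qed

text \<open>The shift lowers the index of a unit sequence and kills the one at 0, so the Leibniz
  recursion turns into Pascal's rule.\<close>

lemma hurwitz_mult_unit_sequences:
  "hurwitz_mult R r (\<lambda>i. if i = m then \<one> else \<zero>) (\<lambda>i. if i = n then \<one> else \<zero>) =
    (if r = m + n then [((m + n) choose n)] \<cdot> \<one> else \<zero>)"
proof (induction r arbitrary: m n)
  case 0
  show ?case by auto
next
  case (Suc r)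
  have shift: "(\<lambda>i. if Suc i = m then \<one> else \<zero>) =
      (case m of 0 \<Rightarrow> (\<lambda>i. \<zero>) | Suc m' \<Rightarrow> (\<lambda>i. if i = m' then \<one> else \<zero>))" for m
    by (auto split: nat.splits)
  have zero: "hurwitz_mult R r (\<lambda>i. if i = m then \<one> else \<zero>) (\<lambda>i. \<zero>) = \<zero>" for m
    by (subst hurwitz_mult_comm) (auto intro!: hurwitz_mult_zero)
  show ?case
    by (cases m; cases n)
      (simp_all add: shift Suc zero hurwitz_mult_zero add.nat_pow_mult add.commute)
qed

end

text \<open>The finite sequences with the Hurwitz product and the shift as derivation, transported
  along an injection into the given type.\<close>

lemma (in cring) ex_divided_powers:
  fixes e :: "'a list \<Rightarrow> 'u"
  assumes e: "inj e"
  shows "\<exists>(U :: ('a, 'u) module) D x. divided_powers R U D x"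
proof -
  let ?F = "finite_sequences R"
  define len where "len f = (LEAST N. \<forall>n\<ge>N. f n = \<zero>)" for f :: "nat \<Rightarrow> 'a"
  \<comment> \<open>A sequence is encoded by the list of its entries below the least index from
    which on it vanishes.\<close>
  define J where "J f = e (map f [0..<len f])" for f
  have len: "f n = \<zero>" if "f \<in> ?F" "n \<ge> len f" for f n
  proof -
    have "\<exists>N. \<forall>n\<ge>N. f n = \<zero>" using that by (simp add: finite_sequences_def)
    then have "\<forall>n\<ge>len f. f n = \<zero>" unfolding len_def by (rule LeastI_ex)
    then show ?thesis using that(2) by blast
  qed
  have "inj_on J ?F"
  proof (rule inj_onI)
    fix f g assume f: "f \<in> ?F" and g: "g \<in> ?F" and "J f = J g"
    then have eq: "map f [0..<len f] = map g [0..<len g]" using e by (simp add: J_def inj_eq)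
    then have l: "len f = len g" using map_eq_imp_length_eq by fastforce
    have "f n = g n" for n
    proof (cases "n < len f")
      case True
      then show ?thesis using eq l by (auto simp: map_eq_conv)
    next
      case False
      then show ?thesis using len[OF f, of n] len[OF g, of n] l by simp
    qed
    then show "f = g" by blast
  qed
  define I where "I = inv_into ?F J"
  have IJ: "I (J f) = f" if "f \<in> ?F" for f
    unfolding I_def using \<open>inj_on J ?F\<close> that by (rule inv_into_f_f)
  define U :: "('a, 'u) module" where
    "U = \<lparr>carrier = J ` ?F, monoid.mult = (\<lambda>u v. J (\<lambda>n. hurwitz_mult R n (I u) (I v))), one = undefined,
      zero = J (\<lambda>n. \<zero>), add = (\<lambda>u v. J (\<lambda>n. I u n \<oplus> I v n)), smult = (\<lambda>c u. J (\<lambda>n. c \<otimes> I u n))\<rparr>"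
  define D where "D u = J (\<lambda>n. I u (Suc n))" for u
  have F_closed: "f n \<in> carrier R" if "f \<in> ?F" for f n using that by (simp add: finite_sequences_def)
  have FI: "f \<in> ?F" if "\<And>n. f n \<in> carrier R" "\<And>n. n \<ge> N \<Longrightarrow> f n = \<zero>" for f N
    using that by (auto simp: finite_sequences_def)
  have F_zero: "(\<lambda>n. \<zero>) \<in> ?F" by (rule FI[of _ 0]) auto
  have F_add: "(\<lambda>n. f n \<oplus> g n) \<in> ?F" if "f \<in> ?F" "g \<in> ?F" for f g
    by (rule FI[of _ "max (len f) (len g)"])
      (simp_all add: len[OF that(1)] len[OF that(2)] F_closed[OF that(1)] F_closed[OF that(2)])
  have F_minus: "(\<lambda>n. \<ominus> f n) \<in> ?F" if "f \<in> ?F" for f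
    by (rule FI[of _ "len f"]) (simp_all add: len[OF that] F_closed[OF that])
  have F_smult: "(\<lambda>n. c \<otimes> f n) \<in> ?F" if "f \<in> ?F" "c \<in> carrier R" for f c
    by (rule FI[of _ "len f"]) (simp_all add: len[OF that(1)] F_closed[OF that(1)] that(2))
  have F_mult: "(\<lambda>n. hurwitz_mult R n f g) \<in> ?F" if "f \<in> ?F" "g \<in> ?F" for f g
  proof (rule FI)
    note closed = F_closed[OF that(1)] F_closed[OF that(2)]
    show "hurwitz_mult R n f g \<in> carrier R" for n by (rule hurwitz_mult_closed) (rule closed)+
    show "hurwitz_mult R n f g = \<zero>" if "len f + len g \<le> n" for n
      using closed len[OF \<open>f \<in> ?F\<close>] len[OF \<open>g \<in> ?F\<close>] that by (rule hurwitz_mult_eq_0)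
  qed
  have F_shift: "(\<lambda>n. f (Suc n)) \<in> ?F" if "f \<in> ?F" for f
    by (rule FI[of _ "len f"]) (simp_all add: len[OF that] F_closed[OF that])
  have carrier_U: "u \<in> carrier U \<longleftrightarrow> (\<exists>f\<in>?F. u = J f)" for u by (auto simp: U_def)
  have J_closed: "J f \<in> carrier U" if "f \<in> ?F" for f using that by (auto simp: carrier_U)
  have add_J: "J f \<oplus>\<^bsub>U\<^esub> J g = J (\<lambda>n. f n \<oplus> g n)" if "f \<in> ?F" "g \<in> ?F" for f g
    using that by (simp add: U_def IJ)
  have mult_J: "J f \<otimes>\<^bsub>U\<^esub> J g = J (\<lambda>n. hurwitz_mult R n f g)" if "f \<in> ?F" "g \<in> ?F" for f g
    using that by (simp add: U_def IJ)
  have smult_J: "c \<odot>\<^bsub>U\<^esub> J f = J (\<lambda>n. c \<otimes> f n)" if "f \<in> ?F" for c f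
    using that by (simp add: U_def IJ)
  have D_J: "D (J f) = J (\<lambda>n. f (Suc n))" if "f \<in> ?F" for f using that by (simp add: D_def IJ)
  have zero_J: "\<zero>\<^bsub>U\<^esub> = J (\<lambda>n. \<zero>)" by (simp add: U_def)
  note J_simps = add_J mult_J smult_J D_J zero_J J_closed F_add F_mult F_smult F_shift F_zero F_closed
  have "abelian_group U"
  proof (rule abelian_groupI)
    fix u assume "u \<in> carrier U"
    then obtain f where f: "f \<in> ?F" "u = J f" by (auto simp: carrier_U)
    show "\<exists>v\<in>carrier U. v \<oplus>\<^bsub>U\<^esub> u = \<zero>\<^bsub>U\<^esub>"
      by (rule bexI[of _ "J (\<lambda>n. \<ominus> f n)"]) (use f F_minus in \<open>simp_all add: J_simps l_neg\<close>)
  qed (auto simp: carrier_U J_simps a_ac)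
  then have "module R U"
    by (intro moduleI is_cring)
      (auto simp: carrier_U J_simps l_distr r_distr m_assoc)
  then have "assoc_comm_algebra R U"
  proof (rule assoc_comm_algebra.intro, unfold_locales)
    fix u v assume "u \<in> carrier U" "v \<in> carrier U"
    then obtain f g where f: "f \<in> ?F" "u = J f" and g: "g \<in> ?F" "v = J g" by (auto simp: carrier_U)
    show "u \<otimes>\<^bsub>U\<^esub> v \<in> carrier U" using f g by (simp add: J_simps)
    have "hurwitz_mult R n f g = hurwitz_mult R n g f" for n
      by (rule hurwitz_mult_comm) (rule F_closed, rule f g)+
    then show "u \<otimes>\<^bsub>U\<^esub> v = v \<otimes>\<^bsub>U\<^esub> u" using f g by (simp add: J_simps)
  qed (auto simp: carrier_U J_simps hurwitz_mult_assoc hurwitz_mult_add_left hurwitz_mult_smult_left)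
  then have "differential_algebra R U D"
    by (intro differential_algebra.intro differential_algebra_axioms.intro)
      (auto simp: carrier_U J_simps)
  then interpret U: differential_algebra R U D .
  \<comment> \<open>The unit sequence at m is the divided power of index m.\<close>
  define \<delta> where "\<delta> m n = (if n = m then \<one> else \<zero>)" for m n :: nat
  have F_\<delta>: "(\<lambda>n. if n = m then c else \<zero>) \<in> ?F" if "c \<in> carrier R" for m c
    by (rule FI[of _ "Suc m"]) (use that in auto)
  have \<delta>: "\<delta> m \<in> ?F" for m unfolding \<delta>_def by (rule F_\<delta>) simp
  have pow: "[c] \<cdot>\<^bsub>U\<^esub> J (\<delta> m) = J (\<lambda>n. if n = m then [c] \<cdot> \<one> else \<zero>)" for c m :: nat
  proof (induction c)
    case 0
    have "(\<lambda>n. if n = m then [(0::nat)] \<cdot> \<one> else \<zero>) = (\<lambda>n. \<zero>)" by (auto simp: add.nat_pow_0)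
    then show ?case by (simp only: U.M.add.nat_pow_0 zero_J)
  next
    case (Suc c)
    have "(\<lambda>n. (if n = m then [c] \<cdot> \<one> else \<zero>) \<oplus> \<delta> m n) = (\<lambda>n. if n = m then [Suc c] \<cdot> \<one> else \<zero>)"
      by (auto simp: \<delta>_def)
    then show ?case using Suc by (simp add: add_J F_\<delta> \<delta>)
  qed
  have "divided_powers_axioms R U D (\<lambda>n. J (\<delta> n))"
  proof
    fix m n c :: nat
    show "J (\<delta> n) \<in> carrier U" by (rule J_closed[OF \<delta>])
    show "D (J (\<delta> 0)) = \<zero>\<^bsub>U\<^esub>" unfolding D_J[OF \<delta>] zero_J by (simp add: \<delta>_def)
    show "D (J (\<delta> (Suc n))) = J (\<delta> n)" unfolding D_J[OF \<delta>] by (simp add: \<delta>_def[abs_def])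
    show "J (\<delta> m) \<otimes>\<^bsub>U\<^esub> J (\<delta> n) = [((m + n) choose n)] \<cdot>\<^bsub>U\<^esub> J (\<delta> (m + n))"
      unfolding pow mult_J[OF \<delta> \<delta>] unfolding \<delta>_def[abs_def] hurwitz_mult_unit_sequences ..
    assume "[c] \<cdot>\<^bsub>U\<^esub> J (\<delta> 0) = \<zero>\<^bsub>U\<^esub>"
    then have "I (J (\<lambda>n. if n = 0 then [c] \<cdot> \<one> else \<zero>)) = I (J (\<lambda>n. \<zero>))"
      unfolding pow zero_J by (rule arg_cong)
    moreover have "[c] \<cdot> \<one> \<in> carrier R" by simp
    ultimately have "(\<lambda>n::nat. if n = 0 then [c] \<cdot> \<one> else \<zero>) = (\<lambda>n. \<zero>)"
      by (simp only: IJ F_\<delta> F_zero)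
    from fun_cong[OF this, of 0] show "[c] \<cdot> \<one> = \<zero>" by simp
  qed
  then have "divided_powers R U D (\<lambda>n. J (\<delta> n))"
    by (intro divided_powers.intro U.differential_algebra_axioms)
  then show ?thesis by blast
qed

section \<open>Integer coefficients of Wronskians of divided powers\<close>

primrec multinomial_coeff :: "(nat \<Rightarrow> nat) \<Rightarrow> nat \<Rightarrow> nat" where
  "multinomial_coeff d 0 = 1"
| "multinomial_coeff d (Suc k) = multinomial_coeff d k * (sum d {..Suc k} choose d (Suc k))"

text \<open>The condition discards terms in which some x_e is differentiated more than e times. For
  increasing \<open>es\<close> this is the determinantal formula for the number of standard Young
  tableaux whose shape has the rows \<open>es ! j - j\<close>.\<close>

definition wronskian_coeff :: "nat \<Rightarrow> nat list \<Rightarrow> int" where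
  "wronskian_coeff k es = (\<Sum>\<pi> | \<pi> permutes {0..k}. sign \<pi> *
    (if \<forall>j\<le>k. \<pi> j \<le> es ! j then int (multinomial_coeff (\<lambda>j. es ! j - \<pi> j) k) else 0))"

lemma multinomial_coeff_eq_1: "(\<And>j. j < k \<Longrightarrow> d j = 0) \<Longrightarrow> multinomial_coeff d k = 1"
proof (induction k)
  case (Suc k)
  then have "sum d {..k} = 0" by simp
  then have "sum d {..Suc k} = d (Suc k)" by simp
  then show ?case using Suc by simp
qed simp

lemma multinomial_coeff_last_two:
  assumes "\<And>j. j < m \<Longrightarrow> d j = 0"
  shows "multinomial_coeff d (Suc m) = (d m + d (Suc m) choose d (Suc m))"
    and "multinomial_coeff d (Suc (Suc m)) = (d m + d (Suc m) choose d (Suc m)) *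
      (d m + d (Suc m) + d (Suc (Suc m)) choose d (Suc (Suc m)))"
proof -
  have "{..m} = insert m {..<m}" by auto
  then have s: "sum d {..m} = d m" using assms by simp
  show *: "multinomial_coeff d (Suc m) = (d m + d (Suc m) choose d (Suc m))"
    using multinomial_coeff_eq_1[of m d] assms s by simp
  show "multinomial_coeff d (Suc (Suc m)) = (d m + d (Suc m) choose d (Suc m)) *
      (d m + d (Suc m) + d (Suc (Suc m)) choose d (Suc (Suc m)))"
    unfolding multinomial_coeff.simps(2)[of d "Suc m"] * using s by simp
qed

text \<open>The bound leaves only 0 for \<pi> 0, and injectivity then forces \<pi> j = j for one j <
  q after the other.\<close>

lemma permutes_le_imp_permutes_atLeastAtMost:
  fixes \<pi> :: "nat \<Rightarrow> nat"
  assumes \<pi>: "\<pi> permutes {0..k}" and le: "\<And>j. j < q \<Longrightarrow> \<pi> j \<le> j"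
  shows "\<pi> permutes {q..k}"
proof -
  have "\<pi> j = j" if "j < q" for j
    using that
  proof (induction j rule: less_induct)
    case (less j)
    show ?case
    proof (rule ccontr)
      assume "\<pi> j \<noteq> j"
      then have lt: "\<pi> j < j" using le[OF less.prems] by simp
      then have "\<pi> (\<pi> j) = \<pi> j" using less by auto
      then show False using permutes_inj[OF \<pi>] lt by (auto dest: injD)
    qed
  qed
  then show ?thesis by (intro permutes_superset[OF \<pi>]) auto
qed

text \<open>An initial segment 0, ..., q - 1 of exponents can only be differentiated in its own
  order. This is why the test exponents start with such a segment: with three further entries, six
  permutations remain.\<close>

lemma wronskian_coeff_triangular:
  assumes es: "\<And>j. j < q \<Longrightarrow> es ! j = j" and q: "q \<le> Suc k"
  shows "wronskian_coeff k es = (\<Sum>\<pi> | \<pi> permutes {q..k}. sign \<pi> *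
    (if \<forall>j\<in>{q..k}. \<pi> j \<le> es ! j then int (multinomial_coeff (\<lambda>j. es ! j - \<pi> j) k) else 0))"
proof -
  let ?f = "\<lambda>\<pi>. sign \<pi> * (if \<forall>j\<le>k. \<pi> j \<le> es ! j then int (multinomial_coeff (\<lambda>j. es ! j - \<pi> j) k) else 0)"
  have fin: "finite {\<pi>. \<pi> permutes {0..k}}" by (rule finite_permutations) simp
  have sub: "{\<pi>. \<pi> permutes {q..k}} \<subseteq> {\<pi>. \<pi> permutes {0..k}}" by (auto intro: permutes_subset)
  have "wronskian_coeff k es = (\<Sum>\<pi> | \<pi> permutes {q..k}. ?f \<pi>)"
    unfolding wronskian_coeff_def
  proof (rule sum.mono_neutral_right[OF fin sub], rule ballI)
    fix \<pi> assume \<pi>: "\<pi> \<in> {\<pi>. \<pi> permutes {0..k}} - {\<pi>. \<pi> permutes {q..k}}"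
    have "\<not> (\<forall>j\<le>k. \<pi> j \<le> es ! j)"
    proof
      assume "\<forall>j\<le>k. \<pi> j \<le> es ! j"
      then have "\<pi> j \<le> j" if "j < q" for j using es[OF that] that q by (metis less_Suc_eq_le order_less_le_trans)
      then show False using permutes_le_imp_permutes_atLeastAtMost[of \<pi> k q] \<pi> by auto
    qed
    then show "?f \<pi> = 0" by (simp only: if_False mult_zero_right)
  qed
  also have "\<dots> = (\<Sum>\<pi> | \<pi> permutes {q..k}. sign \<pi> *
      (if \<forall>j\<in>{q..k}. \<pi> j \<le> es ! j then int (multinomial_coeff (\<lambda>j. es ! j - \<pi> j) k) else 0))"
  proof (rule sum.cong[OF refl])
    fix \<pi> assume "\<pi> \<in> {\<pi>. \<pi> permutes {q..k}}"
    then have "\<pi> j = j" if "j < q" for j using permutes_not_in[of \<pi> "{q..k}" j] that by auto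
    then have "(\<forall>j\<le>k. \<pi> j \<le> es ! j) \<longleftrightarrow> (\<forall>j\<in>{q..k}. \<pi> j \<le> es ! j)"
      using es by (metis atLeastAtMost_iff le_refl not_less)
    then show "?f \<pi> = sign \<pi> * (if \<forall>j\<in>{q..k}. \<pi> j \<le> es ! j
        then int (multinomial_coeff (\<lambda>j. es ! j - \<pi> j) k) else 0)" by simp
  qed
  finally show ?thesis .
qed

text \<open>Applied repeatedly, this expands a signed sum over the permutations of a small explicit
  set into its individual terms.\<close>

lemma sum_sign_permutes_insert:
  fixes f :: "('a \<Rightarrow> 'a) \<Rightarrow> int"
  assumes S: "finite S" "a \<notin> S"
  shows "(\<Sum>\<sigma> | \<sigma> permutes insert a S. sign \<sigma> * f \<sigma>) =
    (\<Sum>b\<in>insert a S. (if a = b then 1 else - 1) * (\<Sum>q | q permutes S. sign q * f (transpose a b \<circ> q)))"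
  unfolding sum_over_permutations_insert[OF S] sum_distrib_left
proof (intro sum.cong refl)
  fix b q assume b: "b \<in> insert a S" and "q \<in> {q. q permutes S}"
  then have "sign (transpose a b \<circ> q) = sign (transpose a b) * sign q"
    using S by (intro sign_compose) (auto intro: permutes_imp_permutation permutation_swap_id)
  then show "sign (transpose a b \<circ> q) * f (transpose a b \<circ> q) =
      (if a = b then 1 else - 1) * (sign q * f (transpose a b \<circ> q))"
    by (simp add: sign_swap_id)
qed

lemma wronskian_coeff_last: "wronskian_coeff k ([0..<k] @ [n]) = (if k \<le> n then 1 else 0)"
proof -
  have "multinomial_coeff (\<lambda>j. ([0..<k] @ [n]) ! j - id j) k = 1"
    by (rule multinomial_coeff_eq_1) (simp add: nth_append)
  then show ?thesis
    by (subst wronskian_coeff_triangular[of k]) (auto simp: nth_append)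
qed

lemma wronskian_coeff_last_two:
  "wronskian_coeff (Suc m) ([0..<m] @ [u, v]) =
    (if m \<le> u \<and> Suc m \<le> v then int ((u - m) + (v - Suc m) choose (v - Suc m)) else 0) -
    (if Suc m \<le> u \<and> m \<le> v then int ((u - Suc m) + (v - m) choose (v - m)) else 0)"
proof -
  let ?es = "[0..<m] @ [u, v]"
  have set: "{m..Suc m} = insert m {Suc m}" by auto
  have mc: "multinomial_coeff (\<lambda>j. ?es ! j - \<pi> j) (Suc m) =
      (u - \<pi> m) + (v - \<pi> (Suc m)) choose (v - \<pi> (Suc m))" if "\<pi> permutes insert m {Suc m}" for \<pi>
  proof -
    have "\<pi> j = j" if "j < m" for j using permutes_not_in[OF \<open>\<pi> permutes _\<close>, of j] that by auto
    then show ?thesis by (subst multinomial_coeff_last_two(1)) (auto simp: nth_append)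
  qed
  have "wronskian_coeff (Suc m) ?es = (\<Sum>\<pi> | \<pi> permutes insert m {Suc m}. sign \<pi> *
      (if \<pi> m \<le> u \<and> \<pi> (Suc m) \<le> v then int ((u - \<pi> m) + (v - \<pi> (Suc m)) choose (v - \<pi> (Suc m))) else 0))"
  proof -
    have nth: "?es ! m = u" "?es ! Suc m = v" by (simp_all add: nth_append)
    have "wronskian_coeff (Suc m) ?es = (\<Sum>\<pi> | \<pi> permutes {m..Suc m}. sign \<pi> *
        (if \<forall>j\<in>{m..Suc m}. \<pi> j \<le> ?es ! j then int (multinomial_coeff (\<lambda>j. ?es ! j - \<pi> j) (Suc m)) else 0))"
      by (rule wronskian_coeff_triangular) (auto simp: nth_append)
    also have "\<dots> = (\<Sum>\<pi> | \<pi> permutes insert m {Suc m}. sign \<pi> *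
        (if \<pi> m \<le> u \<and> \<pi> (Suc m) \<le> v then int ((u - \<pi> m) + (v - \<pi> (Suc m)) choose (v - \<pi> (Suc m))) else 0))"
      unfolding set
    proof (rule sum.cong[OF refl])
      fix \<pi> assume "\<pi> \<in> {\<pi>. \<pi> permutes insert m {Suc m}}"
      then show "sign \<pi> * (if \<forall>j\<in>insert m {Suc m}. \<pi> j \<le> ?es ! j
          then int (multinomial_coeff (\<lambda>j. ?es ! j - \<pi> j) (Suc m)) else 0) = sign \<pi> *
          (if \<pi> m \<le> u \<and> \<pi> (Suc m) \<le> v
          then int ((u - \<pi> m) + (v - \<pi> (Suc m)) choose (v - \<pi> (Suc m))) else 0)"
        using mc[of \<pi>] by (simp add: nth del: multinomial_coeff.simps)
    qed
    finally show ?thesis .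
  qed
  then show ?thesis
    by (subst (asm) sum_sign_permutes_insert) auto
qed

text \<open>\<open>t a b c\<close> is the term of the permutation sending m, m + 1, m + 2 to a, b,
  c; the six terms form a 3 x 3 determinant.\<close>

lemma wronskian_coeff_last_three:
  fixes u v w :: nat
  defines "t \<equiv> \<lambda>a b c. if a \<le> u \<and> b \<le> v \<and> c \<le> w
    then int (((u - a) + (v - b) choose (v - b)) * ((u - a) + (v - b) + (w - c) choose (w - c))) else 0"
  shows "wronskian_coeff (Suc (Suc m)) ([0..<m] @ [u, v, w]) =
    t m (Suc m) (Suc (Suc m)) - t m (Suc (Suc m)) (Suc m) -
    t (Suc m) m (Suc (Suc m)) + t (Suc m) (Suc (Suc m)) m +
    t (Suc (Suc m)) m (Suc m) - t (Suc (Suc m)) (Suc m) m"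
proof -
  let ?es = "[0..<m] @ [u, v, w]" and ?S = "insert m (insert (Suc m) {Suc (Suc m)})"
  have set: "{m..Suc (Suc m)} = ?S" by auto
  have mc: "int (multinomial_coeff (\<lambda>j. ?es ! j - \<pi> j) (Suc (Suc m))) =
      t (\<pi> m) (\<pi> (Suc m)) (\<pi> (Suc (Suc m)))"
    if "\<pi> permutes ?S" "\<pi> m \<le> u \<and> \<pi> (Suc m) \<le> v \<and> \<pi> (Suc (Suc m)) \<le> w" for \<pi>
  proof -
    have "\<pi> j = j" if "j < m" for j using permutes_not_in[OF \<open>\<pi> permutes _\<close>, of j] that by auto
    then show ?thesis unfolding t_def using that(2)
      by (subst multinomial_coeff_last_two(2)) (auto simp: nth_append)
  qed
  have zero: "t a b c = 0" if "\<not> (a \<le> u \<and> b \<le> v \<and> c \<le> w)" for a b c using that by (auto simp: t_def)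
  have "wronskian_coeff (Suc (Suc m)) ?es =
      (\<Sum>\<pi> | \<pi> permutes ?S. sign \<pi> * t (\<pi> m) (\<pi> (Suc m)) (\<pi> (Suc (Suc m))))"
  proof -
    have nth: "?es ! m = u" "?es ! Suc m = v" "?es ! Suc (Suc m) = w" by (simp_all add: nth_append)
    have "wronskian_coeff (Suc (Suc m)) ?es = (\<Sum>\<pi> | \<pi> permutes {m..Suc (Suc m)}. sign \<pi> *
        (if \<forall>j\<in>{m..Suc (Suc m)}. \<pi> j \<le> ?es ! j
          then int (multinomial_coeff (\<lambda>j. ?es ! j - \<pi> j) (Suc (Suc m))) else 0))"
      by (rule wronskian_coeff_triangular) (auto simp: nth_append)
    also have "\<dots> = (\<Sum>\<pi> | \<pi> permutes ?S. sign \<pi> * t (\<pi> m) (\<pi> (Suc m)) (\<pi> (Suc (Suc m))))"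
      unfolding set
    proof (rule sum.cong[OF refl])
      fix \<pi> assume "\<pi> \<in> {\<pi>. \<pi> permutes ?S}"
      then show "sign \<pi> * (if \<forall>j\<in>?S. \<pi> j \<le> ?es ! j
          then int (multinomial_coeff (\<lambda>j. ?es ! j - \<pi> j) (Suc (Suc m))) else 0) =
          sign \<pi> * t (\<pi> m) (\<pi> (Suc m)) (\<pi> (Suc (Suc m)))"
        using mc[of \<pi>] zero[of "\<pi> m" "\<pi> (Suc m)" "\<pi> (Suc (Suc m))"]
        by (simp add: nth del: multinomial_coeff.simps)
    qed
    finally show ?thesis .
  qed
  then show ?thesis
    by (subst (asm) sum_sign_permutes_insert, simp, simp,
        subst (asm) sum_sign_permutes_insert, simp, simp,
        subst (asm) sum_sign_permutes_insert, simp, simp,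
        subst (asm) sum_sign_permutes_insert, simp, simp) (auto simp: transpose_def)
qed


lemma sum_list_upt_excess:
  "sum_list ([0..<m] @ [u]) - \<Sum>{0..m} = u - m"
  "sum_list ([0..<m] @ [u, v]) - \<Sum>{0..Suc m} = u + v - (m + Suc m)"
  "sum_list ([0..<m] @ [u, v, w]) - \<Sum>{0..Suc (Suc m)} = u + v + w - (m + Suc m + Suc (Suc m))"
proof -
  have 1: "sum_list [0..<m] = \<Sum>{0..<m}" by (simp add: sum_list_distinct_conv_sum_set)
  have 2: "\<Sum>{0..m} = \<Sum>{0..<m} + m"
    by (simp add: atLeastLessThanSuc_atLeastAtMost[symmetric])
  show "sum_list ([0..<m] @ [u]) - \<Sum>{0..m} = u - m"
    "sum_list ([0..<m] @ [u, v]) - \<Sum>{0..Suc m} = u + v - (m + Suc m)"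
    "sum_list ([0..<m] @ [u, v, w]) - \<Sum>{0..Suc (Suc m)} = u + v + w - (m + Suc m + Suc (Suc m))"
    by (simp_all add: 1 2 sum.atLeast0_atMost_Suc)
qed

lemma (in abelian_group) finsum_int_pow:
  assumes "y \<in> carrier G"
  shows "(\<Oplus>i\<in>A. [(f i :: int)] \<cdot> y) = [(sum f A)] \<cdot> y"
  by (induction A rule: infinite_finite_induct) (auto simp: assms add.int_pow_mult add_pow_int_ge)

section \<open>Wronskians of divided powers\<close>

context divided_powers
begin

lemma D_zero: "D \<zero>\<^bsub>U\<^esub> = \<zero>\<^bsub>U\<^esub>"
  by (rule M.additive_zero) (auto simp: D_closed D_add)

lemma funpow_D_x: "(D ^^ r) (x n) = (if r \<le> n then x (n - r) else \<zero>\<^bsub>U\<^esub>)"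
proof (induction r)
  case (Suc r)
  consider "n < r" | "n = r" | m where "n = r + Suc m" by (metis less_iff_Suc_add linorder_neqE_nat add_Suc_right)
  then show ?case by cases (use Suc in \<open>auto simp: D_zero D_x_0 D_x_Suc Suc_diff_le\<close>)
qed simp

lemma nonempty_prod_x: "nonempty_prod U (\<lambda>j. x (d j)) k = [int (multinomial_coeff d k)] \<cdot>\<^bsub>U\<^esub> x (sum d {..k})"
proof (induction k)
  case 0
  show ?case by (simp add: add_pow_int_ge x_closed)
next
  case (Suc k)
  let ?s = "sum d {..k}" and ?c = "int (multinomial_coeff d k)"
  have "nonempty_prod U (\<lambda>j. x (d j)) (Suc k) = ([?c] \<cdot>\<^bsub>U\<^esub> x ?s) \<otimes>\<^bsub>U\<^esub> x (d (Suc k))"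
    using Suc by simp
  also have "\<dots> = x (d (Suc k)) \<otimes>\<^bsub>U\<^esub> ([?c] \<cdot>\<^bsub>U\<^esub> x ?s)"
    by (rule mult_comm) (auto simp: x_closed)
  also have "\<dots> = [?c] \<cdot>\<^bsub>U\<^esub> (x (d (Suc k)) \<otimes>\<^bsub>U\<^esub> x ?s)"
    by (rule M.additive_int_pow) (auto simp: mult_left_additive x_closed mult_closed)
  also have "x (d (Suc k)) \<otimes>\<^bsub>U\<^esub> x ?s = x ?s \<otimes>\<^bsub>U\<^esub> x (d (Suc k))"
    by (rule mult_comm) (auto simp: x_closed)
  also have "\<dots> = [int (?s + d (Suc k) choose d (Suc k))] \<cdot>\<^bsub>U\<^esub> x (?s + d (Suc k))"
    by (simp add: x_mult add_pow_int_ge)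
  also have "[?c] \<cdot>\<^bsub>U\<^esub> \<dots> = [int (multinomial_coeff d (Suc k))] \<cdot>\<^bsub>U\<^esub> x (sum d {..Suc k})"
    by (simp add: M.add.int_pow_pow x_closed mult.commute)
  finally show ?case .
qed

lemma nonempty_prod_zero:
  assumes "\<And>j. j \<le> k \<Longrightarrow> f j \<in> carrier U" "i \<le> k" "f i = \<zero>\<^bsub>U\<^esub>"
  shows "nonempty_prod U f k = \<zero>\<^bsub>U\<^esub>"
proof -
  have f: "f = f(i := \<zero>\<^bsub>K\<^esub> \<odot>\<^bsub>U\<^esub> \<zero>\<^bsub>U\<^esub>)" using assms(3) by (auto simp: smult_l_null)
  have "nonempty_prod U f k = \<zero>\<^bsub>K\<^esub> \<odot>\<^bsub>U\<^esub> nonempty_prod U (f(i := \<zero>\<^bsub>U\<^esub>)) k"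
    by (subst f, rule nonempty_prod_smult) (use assms in auto)
  also have "\<dots> = \<zero>\<^bsub>U\<^esub>"
    by (rule smult_l_null, rule nonempty_prod_closed) (use assms in auto)
  finally show ?thesis .
qed

text \<open>Every permutation distributes the same total order 0 + 1 + ... + k of differentiation,
  so all terms are multiples of one divided power. If the total exponent is smaller than that order,
  the subtraction truncates, but then the coefficient is 0.\<close>

lemma wronskian_x:
  assumes "length es = Suc k"
  shows "wronskian U D k (map x es) = [wronskian_coeff k es] \<cdot>\<^bsub>U\<^esub> x (sum_list es - \<Sum>{0..k})"
proof -
  let ?s = "sum_list es - \<Sum>{0..k}"
  let ?c = "\<lambda>\<pi>. if \<forall>j\<le>k. \<pi> j \<le> es ! j then int (multinomial_coeff (\<lambda>j. es ! j - \<pi> j) k) else 0"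
  have *: "nonempty_prod U (\<lambda>j. (D ^^ \<pi> j) (map x es ! j)) k = [?c \<pi>] \<cdot>\<^bsub>U\<^esub> x ?s"
    if \<pi>: "\<pi> permutes {0..k}" for \<pi>
  proof (cases "\<forall>j\<le>k. \<pi> j \<le> es ! j")
    case True
    have "nonempty_prod U (\<lambda>j. (D ^^ \<pi> j) (map x es ! j)) k = nonempty_prod U (\<lambda>j. x (es ! j - \<pi> j)) k"
      by (rule nonempty_prod_cong) (use True assms in \<open>simp add: funpow_D_x\<close>)
    also have "\<dots> = [?c \<pi>] \<cdot>\<^bsub>U\<^esub> x (\<Sum>j\<le>k. es ! j - \<pi> j)"
      unfolding nonempty_prod_x using True by simp
    also have "(\<Sum>j\<le>k. es ! j - \<pi> j) = (\<Sum>j\<le>k. es ! j) - (\<Sum>j\<le>k. \<pi> j)"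
      using True by (intro sum_subtractf_nat) auto
    also have "(\<Sum>j\<le>k. es ! j) = sum_list es"
      unfolding sum_list_sum_nth assms by (simp add: atLeastLessThanSuc_atLeastAtMost atLeast0AtMost)
    also have "(\<Sum>j\<le>k. \<pi> j) = \<Sum>{0..k}"
      using sum.permute[OF \<pi>, of id] by (simp add: atLeast0AtMost)
    finally show ?thesis .
  next
    case False
    then obtain i where i: "i \<le> k" "es ! i < \<pi> i" by (auto simp: not_le)
    have "nonempty_prod U (\<lambda>j. (D ^^ \<pi> j) (map x es ! j)) k = \<zero>\<^bsub>U\<^esub>"
      by (rule nonempty_prod_zero[of _ _ i]) (use i assms in \<open>auto simp: funpow_D_x intro: x_closed\<close>)
    moreover have "?c \<pi> = 0" using False by (simp only: if_False)
    ultimately show ?thesis by (simp only:) (simp add: add_pow_int_ge)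
  qed
  have "wronskian U D k (map x es) = (\<Oplus>\<^bsub>U\<^esub>\<pi>\<in>{\<pi>. \<pi> permutes {0..k}}. [(sign \<pi> * ?c \<pi>)] \<cdot>\<^bsub>U\<^esub> x ?s)"
    unfolding wronskian_def
  proof (rule M.finsum_cong'[OF refl])
    fix \<pi> assume "\<pi> \<in> {\<pi>. \<pi> permutes {0..k}}"
    then have "nonempty_prod U (\<lambda>j. (D ^^ \<pi> j) (map x es ! j)) k = [?c \<pi>] \<cdot>\<^bsub>U\<^esub> x ?s" by (intro *) simp
    then show "[sign \<pi>] \<cdot>\<^bsub>U\<^esub> nonempty_prod U (\<lambda>j. (D ^^ \<pi> j) (map x es ! j)) k = [(sign \<pi> * ?c \<pi>)] \<cdot>\<^bsub>U\<^esub> x ?s"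
      by (simp only: M.add.int_pow_pow x_closed mult.commute[of "sign \<pi>"])
  qed (intro Pi_I M.add.int_pow_closed x_closed)
  then show ?thesis unfolding wronskian_coeff_def M.finsum_int_pow[OF x_closed] .
qed

lemma wronskian_int_pow:
  assumes us: "length us = Suc k" "set us \<subseteq> carrier U" and i: "i < Suc k" and v: "v \<in> carrier U"
  shows "wronskian U D k (us[i := [(c::int)] \<cdot>\<^bsub>U\<^esub> v]) = [c] \<cdot>\<^bsub>U\<^esub> wronskian U D k (us[i := v])"
proof (rule M.additive_int_pow[where \<phi> = "\<lambda>v. wronskian U D k (us[i := v])"])
  show "(\<lambda>v. wronskian U D k (us[i := v])) \<in> carrier U \<rightarrow> carrier U"
    using us set_update_subset_insert[of us i] by (intro Pi_I wronskian_closed) (auto 4 4)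
qed (use wronskian_add[OF us i] v in auto)

lemma int_pow_x_eq_0:
  assumes "has_characteristic K p" "[(c::int)] \<cdot>\<^bsub>U\<^esub> x 0 = \<zero>\<^bsub>U\<^esub>"
  shows "int p dvd c"
proof -
  have "[(nat \<bar>c\<bar>)] \<cdot>\<^bsub>U\<^esub> x 0 = \<zero>\<^bsub>U\<^esub>"
  proof (cases "c \<ge> 0")
    case True
    then show ?thesis using assms(2) by (simp add: add_pow_int_ge)
  next
    case False
    then have "\<ominus>\<^bsub>U\<^esub> ([(nat (- c))] \<cdot>\<^bsub>U\<^esub> x 0) = \<zero>\<^bsub>U\<^esub>" using assms(2) by (simp add: add_pow_int_lt)
    then have "[(nat (- c))] \<cdot>\<^bsub>U\<^esub> x 0 = \<zero>\<^bsub>U\<^esub>"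
      using M.add.inv_eq_1_iff[of "[(nat (- c))] \<cdot>\<^bsub>U\<^esub> x 0"] x_closed by simp
    then show ?thesis using False by simp
  qed
  then have "p dvd nat \<bar>c\<bar>"
    using x_faithful assms(1) unfolding has_characteristic_def by blast
  then have "int p dvd int (nat \<bar>c\<bar>)" by (simp only: int_dvd_int_iff)
  then show ?thesis by simp
qed


text \<open>On divided powers V(x_0, ..., x_{k-1}, -) acts as \<open>D ^^ k\<close>.\<close>

lemma wronskian_x_last:
  "wronskian U D k (map x [0..<k] @ [x n]) = [(if k \<le> n then 1 else 0 :: int)] \<cdot>\<^bsub>U\<^esub> x (n - k)"
  using wronskian_x[of "[0..<k] @ [n]" k] unfolding wronskian_coeff_last sum_list_upt_excess by simp

text \<open>On divided powers the operator is x_1 \<open>D ^^ (m + 1)\<close> -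
  \<open>D ^^ m\<close>. Here x_1 times x_{n-m-1} is (n - m) x_{n-m}, whence the factor n - m - 1;
  at n = m only the second summand remains.\<close>

lemma wronskian_x_skip_last:
  "wronskian U D (Suc m) (map x ([0..<m] @ [Suc m]) @ [x n]) =
    [(if m \<le> n then int n - int m - 1 else 0)] \<cdot>\<^bsub>U\<^esub> x (n - m)"
proof -
  have c: "wronskian_coeff (Suc m) ([0..<m] @ [Suc m, n]) = (if m \<le> n then int n - int m - 1 else 0)"
  proof (cases "Suc m \<le> n")
    case True
    then have "1 + (n - Suc m) = Suc (n - Suc m)" "int (Suc (n - Suc m)) = int n - int m" by auto
    then show ?thesis using True by (simp add: wronskian_coeff_last_two)
  qed (auto simp: wronskian_coeff_last_two)
  have "Suc m + n - (m + Suc m) = n - m" by simp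
  then show ?thesis
    using wronskian_x[of "[0..<m] @ [Suc m, n]" "Suc m"] unfolding c sum_list_upt_excess by simp
qed

text \<open>
  The \<open>n\<close>-Lie identity for divided powers; \<open>ad\<close> and \<open>d\<close> describe the operator
  \<open>V (a\<^sub>1, \<dots>, a\<^sub>k, -)\<close>, which sends \<open>x n\<close> to \<open>ad n\<close> times \<open>x (d n)\<close>.
\<close>

lemma n_lie_x:
  fixes ad :: "nat \<Rightarrow> int"
  assumes lie: "n_lie K U (k + 1) (wronskian U D k)"
    and as: "length as = k" "set as \<subseteq> carrier U" "\<And>n. wronskian U D k (as @ [x n]) = [(ad n)] \<cdot>\<^bsub>U\<^esub> x (d n)"
    and es: "length es = Suc k" and s: "s = sum_list es - \<Sum>{0..k}"
  shows "[(wronskian_coeff k es * ad s)] \<cdot>\<^bsub>U\<^esub> x (d s) =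
    (\<Oplus>\<^bsub>U\<^esub>i\<in>{..<k + 1}. [(ad (es ! i))] \<cdot>\<^bsub>U\<^esub> wronskian U D k (map x (es[i := d (es ! i)])))"
proof -
  have bs: "length (map x es) = k + 1" "set (map x es) \<subseteq> carrier U" using es by (auto simp: x_closed)
  have "wronskian U D k (as @ [wronskian U D k (map x es)]) =
      (\<Oplus>\<^bsub>U\<^esub>i\<in>{..<k + 1}. wronskian U D k ((map x es)[i := wronskian U D k (as @ [map x es ! i])]))"
    using lie as bs unfolding n_lie_def by simp
  moreover have "wronskian U D k (as @ [wronskian U D k (map x es)]) =
      [(wronskian_coeff k es * ad s)] \<cdot>\<^bsub>U\<^esub> x (d s)"
  proof -
    have "wronskian U D k (as @ [wronskian U D k (map x es)]) =
        wronskian U D k ((as @ [x s])[k := [(wronskian_coeff k es)] \<cdot>\<^bsub>U\<^esub> x s])"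
      unfolding wronskian_x[OF es] s using as(1) by (simp add: list_update_append)
    also have "\<dots> = [(wronskian_coeff k es)] \<cdot>\<^bsub>U\<^esub> wronskian U D k ((as @ [x s])[k := x s])"
      using as by (intro wronskian_int_pow) (auto simp: x_closed)
    also have "(as @ [x s])[k := x s] = as @ [x s]" using as(1) by (simp add: list_update_append)
    finally show ?thesis unfolding as(3) by (simp add: M.add.int_pow_pow x_closed mult.commute)
  qed
  moreover have "wronskian U D k ((map x es)[i := wronskian U D k (as @ [map x es ! i])]) =
      [(ad (es ! i))] \<cdot>\<^bsub>U\<^esub> wronskian U D k (map x (es[i := d (es ! i)]))" if i: "i \<in> {..<k + 1}" for i
  proof -
    have "map x es ! i = x (es ! i)" using i es by simp
    then have "wronskian U D k ((map x es)[i := wronskian U D k (as @ [map x es ! i])]) =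
        wronskian U D k ((map x es)[i := [(ad (es ! i))] \<cdot>\<^bsub>U\<^esub> x (d (es ! i))])"
      using as(3) by (simp only:)
    also have "\<dots> = [(ad (es ! i))] \<cdot>\<^bsub>U\<^esub> wronskian U D k ((map x es)[i := x (d (es ! i))])"
      using bs i by (intro wronskian_int_pow) (auto simp: x_closed)
    finally show ?thesis by (simp only: map_update)
  qed
  then have "(\<Oplus>\<^bsub>U\<^esub>i\<in>{..<k + 1}. wronskian U D k ((map x es)[i := wronskian U D k (as @ [map x es ! i])])) =
      (\<Oplus>\<^bsub>U\<^esub>i\<in>{..<k + 1}. [(ad (es ! i))] \<cdot>\<^bsub>U\<^esub> wronskian U D k (map x (es[i := d (es ! i)])))"
    using es by (intro M.finsum_cong'[OF refl])
      (auto intro!: M.add.int_pow_closed wronskian_closed simp: x_closed simp del: map_update)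
  ultimately show ?thesis by (simp only:)
qed

section \<open>Divisibility conditions forced by the n-Lie identity\<close>

lemma int_pow_wronskian_repeated:
  assumes "length es = Suc k" "c = 0 \<or> \<not> distinct es"
  shows "[(c::int)] \<cdot>\<^bsub>U\<^esub> wronskian U D k (map x es) = \<zero>\<^bsub>U\<^esub>"
proof (cases "c = 0")
  case True
  then show ?thesis by (simp add: add_pow_int_ge)
next
  case False
  then have "\<not> distinct (map x es)" using assms by (auto simp: distinct_map)
  then have "wronskian U D k (map x es) = \<zero>\<^bsub>U\<^esub>"
    using assms by (intro wronskian_alternating) (auto simp: x_closed)
  then show ?thesis by (simp add: M.add.int_pow_one)
qed

lemma not_distinct_list_update:
  assumes "i < length es" "j < length es" "i \<noteq> j" "es ! j = v"
  shows "\<not> distinct (es[i := v])"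
  using assms nth_eq_iff_index_eq[of "es[i := v]" i j] by auto

text \<open>Tested with the operator \<open>D ^^ k\<close> and m = k - 1. The left side is m x_0. On
  the right, \<open>D ^^ k\<close> kills x_j for j < m and sends x_{m+1} to x_0, which is already
  present, so only the last argument contributes, namely - x_0. Hence m + 1 = k is 0 modulo
  p.\<close>

lemma n_lie_imp_dvd_arity:
  assumes lie: "n_lie K U (k + 1) (wronskian U D k)" and p: "has_characteristic K p" and k: "k \<ge> 2"
  shows "int p dvd int k"
proof -
  define m where "m = k - 1"
  have k: "k = Suc m" "m \<ge> 1" using k by (auto simp: m_def)
  \<comment> \<open>The last exponent is the one that \<open>D ^^ k\<close> lowers to the missing
    exponent m. The shape is (m, 1), with m standard tableaux.\<close>
  let ?es = "[0..<m] @ [Suc m, 2 * m + 1]" and ?ad = "\<lambda>n. if k \<le> n then 1 else 0 :: int"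
  have es: "length ?es = Suc k" by (simp add: k)
  have s: "k = sum_list ?es - \<Sum>{0..k}" unfolding k(1) sum_list_upt_excess by simp
  have wc: "wronskian_coeff k ?es = int m"
  proof -
    have "(1 + m choose m) = m + 1" by simp
    then show ?thesis unfolding k(1) wronskian_coeff_last_two using k(2) by simp
  qed
  let ?f = "\<lambda>i. [(?ad (?es ! i))] \<cdot>\<^bsub>U\<^esub> wronskian U D k (map x (?es[i := ?es ! i - k]))"
  have "[(wronskian_coeff k ?es * ?ad k)] \<cdot>\<^bsub>U\<^esub> x (k - k) = (\<Oplus>\<^bsub>U\<^esub>i\<in>{..<k + 1}. ?f i)"
    using lie wronskian_x_last es s
    by (intro n_lie_x[where as = "map x [0..<k]" and d = "\<lambda>n. n - k" and ad = ?ad]) (auto simp: x_closed)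
  also have "\<dots> = (\<Oplus>\<^bsub>U\<^esub>i\<in>{..<k + 1}. if Suc m = i then ?f i else \<zero>\<^bsub>U\<^esub>)"
  proof (rule M.finsum_cong'[OF refl])
    show "(\<lambda>i. if Suc m = i then ?f i else \<zero>\<^bsub>U\<^esub>) \<in> {..<k + 1} \<rightarrow> carrier U"
      using es by (auto intro!: M.add.int_pow_closed wronskian_closed simp: x_closed simp del: map_append map_update)
    fix i assume "i \<in> {..<k + 1}"
    then consider "i < m" | "i = m" | "i = Suc m" using k by force
    then show "?f i = (if Suc m = i then ?f i else \<zero>\<^bsub>U\<^esub>)"
    proof cases
      case 1
      then have "?ad (?es ! i) = 0" by (simp add: nth_append k)
      then have "?f i = \<zero>\<^bsub>U\<^esub>" using es by (intro int_pow_wronskian_repeated) auto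
      then show ?thesis using 1 by simp
    next
      case 2
      have "\<not> distinct (?es[i := ?es ! i - k])"
        by (rule not_distinct_list_update[of _ _ 0]) (use 2 k in \<open>auto simp: nth_append\<close>)
      then have "?f i = \<zero>\<^bsub>U\<^esub>" using es by (intro int_pow_wronskian_repeated) auto
      then show ?thesis using 2 by simp
    qed simp
  qed
  also have "\<dots> = ?f (Suc m)"
    using es k by (intro M.add.finprod_singleton)
      (auto intro!: M.add.int_pow_closed wronskian_closed simp: x_closed simp del: map_append map_update)
  also have "\<dots> = [(- 1 :: int)] \<cdot>\<^bsub>U\<^esub> x 0"
  proof -
    have 1: "?es ! Suc m = 2 * m + 1" by (simp add: nth_append)
    have 2: "?es[Suc m := m] = [0..<m] @ [Suc m, m]" by (simp add: list_update_append)
    have 3: "2 * m + 1 - k = m" using k by simp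
    have "wronskian U D k (map x ([0..<m] @ [Suc m, m])) = [(- 1 :: int)] \<cdot>\<^bsub>U\<^esub> x 0"
      unfolding k(1) by (subst wronskian_x, simp, unfold wronskian_coeff_last_two sum_list_upt_excess) simp
    then show ?thesis unfolding 1 3 2 using k by (simp add: add_pow_int_ge x_closed)
  qed
  finally have "[(int m)] \<cdot>\<^bsub>U\<^esub> x 0 = [(- 1 :: int)] \<cdot>\<^bsub>U\<^esub> x 0" unfolding wc by simp
  then have "[(int m + 1)] \<cdot>\<^bsub>U\<^esub> x 0 = [(- 1 + 1 :: int)] \<cdot>\<^bsub>U\<^esub> x 0"
    by (simp only: M.add.int_pow_mult[OF x_closed])
  then have "[(int k)] \<cdot>\<^bsub>U\<^esub> x 0 = \<zero>\<^bsub>U\<^esub>" by (simp add: k add_pow_int_ge add.commute)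
  then show ?thesis by (rule int_pow_x_eq_0[OF p])
qed

text \<open>The operator of \<open>wronskian_x_skip_last\<close> has the factor -1 at x_m, so the
  left side is minus the Wronskian coefficient times x_0. On the right each term has a zero factor
  or, by the hypothesis on collisions, a repeated argument.\<close>

lemma n_lie_skip_imp_dvd:
  assumes lie: "n_lie K U (k + 1) (wronskian U D k)" and p: "has_characteristic K p"
    and k: "k = Suc m" and es: "length es = Suc k" and s: "sum_list es - \<Sum>{0..k} = m"
    and repeated: "\<And>i. i \<le> k \<Longrightarrow> m \<le> es ! i \<Longrightarrow> \<exists>j\<le>k. j \<noteq> i \<and> es ! j = es ! i - m"
  shows "int p dvd wronskian_coeff k es"
proof -
  let ?ad = "\<lambda>n. if m \<le> n then int n - int m - 1 else 0"
  let ?f = "\<lambda>i. [(?ad (es ! i))] \<cdot>\<^bsub>U\<^esub> wronskian U D k (map x (es[i := es ! i - m]))"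
  have "[(wronskian_coeff k es * ?ad m)] \<cdot>\<^bsub>U\<^esub> x (m - m) = (\<Oplus>\<^bsub>U\<^esub>i\<in>{..<k + 1}. ?f i)"
    using lie wronskian_x_skip_last[of m] es s
    by (intro n_lie_x[where as = "map x ([0..<m] @ [Suc m])" and d = "\<lambda>n. n - m" and ad = ?ad])
      (auto simp: x_closed k)
  also have "\<dots> = (\<Oplus>\<^bsub>U\<^esub>i\<in>{..<k + 1}. \<zero>\<^bsub>U\<^esub>)"
  proof (rule M.finsum_cong'[OF refl])
    fix i assume "i \<in> {..<k + 1}"
    then have i: "i \<le> k" by simp
    show "?f i = \<zero>\<^bsub>U\<^esub>"
    proof (rule int_pow_wronskian_repeated)
      show "?ad (es ! i) = 0 \<or> \<not> distinct (es[i := es ! i - m])"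
      proof (cases "m \<le> es ! i")
        case True
        then obtain j where "j \<le> k" "j \<noteq> i" "es ! j = es ! i - m" using repeated[OF i] by blast
        then have "\<not> distinct (es[i := es ! i - m])"
          using i es by (intro not_distinct_list_update[of _ _ j]) auto
        then show ?thesis ..
      qed simp
    qed (simp add: es)
  qed simp
  finally have "[(- wronskian_coeff k es)] \<cdot>\<^bsub>U\<^esub> x 0 = \<zero>\<^bsub>U\<^esub>" by simp
  then have "int p dvd - wronskian_coeff k es" by (rule int_pow_x_eq_0[OF p])
  then show ?thesis by simp
qed

text \<open>The two rows are those of the shape (m - 2, 2) with m = k - 1, which has m (m - 3) / 2
  standard tableaux. Doubling removes the fraction.\<close>

lemma n_lie_imp_dvd_two_rows:
  assumes lie: "n_lie K U (k + 1) (wronskian U D k)" and p: "has_characteristic K p" and k: "k \<ge> 5"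
  shows "int p dvd (int k - 1) * (int k - 4)"
proof -
  define m where "m = k - 1"
  have k: "k = Suc m" "m \<ge> 4" using k by (auto simp: m_def)
  \<comment> \<open>Lowered by m, the last two exponents become 2 and m - 1, both already among 0,
    ..., m - 1.\<close>
  let ?es = "[0..<m] @ [m + 2, 2 * m - 1]"
  have "int p dvd wronskian_coeff k ?es"
  proof (rule n_lie_skip_imp_dvd[OF lie p k(1)])
    show "length ?es = Suc k" by (simp add: k)
    show "sum_list ?es - \<Sum>{0..k} = m" unfolding k(1) sum_list_upt_excess using k(2) by simp
    fix i assume "i \<le> k" "m \<le> ?es ! i"
    then consider "i = m" | "i = Suc m" using k by (force simp: nth_append)
    then show "\<exists>j\<le>k. j \<noteq> i \<and> ?es ! j = ?es ! i - m"
    proof cases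
      case 1
      then show ?thesis using k by (intro exI[of _ 2]) (auto simp: nth_append)
    next
      case 2
      then show ?thesis using k by (intro exI[of _ "m - 1"]) (auto simp: nth_append)
    qed
  qed
  moreover have "wronskian_coeff k ?es = int (m choose 2) - int m"
  proof -
    have "m + 2 - m + (2 * m - 1 - Suc m) = m" "m + 2 - Suc m + (2 * m - 1 - m) = m"
      "2 * m - 1 - Suc m = m - 2" "2 * m - 1 - m = m - 1"
      "m \<le> m + 2" "Suc m \<le> m + 2" "m \<le> 2 * m - 1" "Suc m \<le> 2 * m - 1" using k(2) by auto
    moreover have "m choose (m - 2) = m choose 2" "m choose (m - 1) = m"
      using k(2) binomial_symmetric[of 2 m] binomial_symmetric[of 1 m] by auto
    ultimately show ?thesis
      unfolding k(1) wronskian_coeff_last_two by (simp only: simp_thms if_True)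
  qed
  moreover have "2 * (int (m choose 2) - int m) = (int k - 1) * (int k - 4)"
  proof -
    have "2 * (m choose 2) = m * (m - 1)" by (cases m) (simp_all add: choose_two)
    then have "2 * int (m choose 2) = int (m * (m - 1))" by (metis of_nat_mult of_nat_numeral)
    also have "\<dots> = int m * (int m - 1)" by (cases m) (simp_all add: algebra_simps)
    finally have "2 * int (m choose 2) = int m * (int m - 1)" .
    then show ?thesis by (simp add: k algebra_simps)
  qed
  ultimately show ?thesis by (metis dvd_mult)
qed

text \<open>The shape (r - 2, 2, 1) with r = k - 2 has n (n - 2) (n - 4) / 3 standard tableaux,
  where n = k - 1. Only its parity is recorded, because the result is applied once p = 2 is
  known.\<close>

lemma n_lie_imp_dvd_three_rows:
  assumes lie: "n_lie K U (k + 1) (wronskian U D k)" and p: "has_characteristic K p" and k: "k \<ge> 6"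
  shows "\<exists>c. int p dvd 2 * c + (int k - 1)"
proof -
  define r where "r = k - 2"
  have k: "k = Suc (Suc r)" "r \<ge> 4" using k by (auto simp: r_def)
  \<comment> \<open>Lowered by r + 1, the last three exponents become 0, 2 and r - 1. The bound r
    \<ge> 4 gives r + 3 < 2r, so the exponents are distinct.\<close>
  let ?es = "[0..<r] @ [r + 1, r + 3, 2 * r]"
  have "int p dvd wronskian_coeff k ?es"
  proof (rule n_lie_skip_imp_dvd[OF lie p k(1)])
    show "length ?es = Suc k" by (simp add: k)
    show "sum_list ?es - \<Sum>{0..k} = Suc r" unfolding k(1) sum_list_upt_excess using k(2) by simp
    fix i assume "i \<le> k" "Suc r \<le> ?es ! i"
    then consider "i = r" | "i = Suc r" | "i = Suc (Suc r)" using k by (force simp: nth_append)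
    then show "\<exists>j\<le>k. j \<noteq> i \<and> ?es ! j = ?es ! i - Suc r"
    proof cases
      case 1
      then show ?thesis using k by (intro exI[of _ 0]) (auto simp: nth_append)
    next
      case 2
      then show ?thesis using k by (intro exI[of _ 2]) (auto simp: nth_append)
    next
      case 3
      then show ?thesis using k by (intro exI[of _ "r - 1"]) (auto simp: nth_append)
    qed
  qed
  moreover have "wronskian_coeff k ?es =
      2 * (int (r + 1 choose (r - 2)) - int (r + 1 choose (r - 1))) + (int k - 1)"
  proof -
    have "2 * r - Suc (Suc r) = r - 2" "2 * r - Suc r = r - 1" "2 * r - r = r"
      "r + 1 - r = 1" "r + 3 - Suc r = 2" "r + 3 - Suc (Suc r) = 1" "r + 3 - r = 3" "r + 1 - Suc r = 0"
      using k(2) by auto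
    moreover have "1 + 2 + (r - 2) = r + 1" "1 + 1 + (r - 1) = r + 1" "0 + 3 + (r - 2) = r + 1" "0 + 1 + r = r + 1"
      using k(2) by auto
    moreover have "(1 + 2 choose 2) = 3" "(1 + 1 choose 1) = (2::nat)" "(r + 1 choose r) = r + 1"
      by (simp_all add: numeral_eq_Suc)
    moreover have "Suc (Suc (Suc (r - 2))) = Suc r" using k(2) by simp
    ultimately show ?thesis
      unfolding k(1) wronskian_coeff_last_three using k(2) by (simp add: algebra_simps)
  qed
  ultimately show ?thesis by metis
qed

lemma n_lie_wronskian_imp:
  assumes lie: "n_lie K U (k + 1) (wronskian U D k)" and p: "has_characteristic K p"
    and prime: "prime p \<or> p = 0" and k: "k > 0"
  shows "k = 1 \<and> (prime p \<or> p = 0) \<or> k = 2 \<and> p = 2 \<or> k = 3 \<and> p = 3 \<or> k = 4 \<and> p = 2"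
proof (cases "k = 1")
  case False
  then have k2: "k \<ge> 2" using k by simp
  have pk: "p dvd k" using n_lie_imp_dvd_arity[OF lie p k2] by simp
  \<comment> \<open>As k > 0, p cannot be 0 and divide k.\<close>
  then have pr: "prime p" using prime k by auto
  have p2: "p = 2" if "p dvd 2 ^ n" for n using that pr by (metis prime_dvd_power primes_dvd_imp_eq two_is_prime_nat)
  have "k < 5"
  proof (rule ccontr)
    assume "\<not> k < 5"
    then have k5: "k \<ge> 5" by simp
    \<comment> \<open>The difference is 4, which forces p = 2. Then k is even, hence at least 6, and
      the three-row coefficient is odd.\<close>
    have "int p dvd (int k - 1) * (int k - 4) - int k * (int k - 5)"
      using n_lie_imp_dvd_two_rows[OF lie p k5] pk by (intro dvd_diff) auto
    also have "(int k - 1) * (int k - 4) - int k * (int k - 5) = int (2 ^ 2)" by (simp add: algebra_simps)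
    finally have "p = 2" by (intro p2[of 2]) (simp only: int_dvd_int_iff)
    moreover from this have "even k" using pk by simp
    moreover from this have "k \<ge> 6" using k5 by (cases "k = 5") auto
    ultimately obtain c where "2 dvd 2 * c + (int k - 1)"
      using n_lie_imp_dvd_three_rows[OF lie p] by auto
    then show False using \<open>even k\<close> by simp
  qed
  then consider "k = 2" | "k = 3" | "k = 4" using k2 by linarith
  then show ?thesis
  proof cases
    case 1
    then show ?thesis using pk p2[of 1] by simp
  next
    case 2
    have "prime (3::nat)" by simp
    then show ?thesis using 2 pk pr primes_dvd_imp_eq[of p 3] by simp
  next
    case 3
    then show ?thesis using pk p2[of 2] by simp
  qed
qed (use prime in simp)


section \<open>Failure of left commutativity for k = 1 and k = 2\<close>

lemma wronskian_nested_x: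
  assumes xs: "length xs = k" and ys: "length ys = Suc q" and t: "t = sum_list ys - \<Sum>{0..q}"
  shows "wronskian U D k (map x xs @ [wronskian U D q (map x ys)]) =
    [(wronskian_coeff q ys * wronskian_coeff k (xs @ [t]))] \<cdot>\<^bsub>U\<^esub> x (sum_list (xs @ [t]) - \<Sum>{0..k})"
proof -
  have "map x xs @ [wronskian U D q (map x ys)] =
      (map x (xs @ [t]))[k := [(wronskian_coeff q ys)] \<cdot>\<^bsub>U\<^esub> x t]"
    unfolding wronskian_x[OF ys] t using xs by (simp add: list_update_append)
  moreover have "wronskian U D k ((map x (xs @ [t]))[k := [(wronskian_coeff q ys)] \<cdot>\<^bsub>U\<^esub> x t]) =
      [(wronskian_coeff q ys)] \<cdot>\<^bsub>U\<^esub> wronskian U D k ((map x (xs @ [t]))[k := x t])"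
    using xs by (intro wronskian_int_pow) (auto simp: x_closed)
  moreover have "(map x (xs @ [t]))[k := x t] = map x (xs @ [t])"
    using xs by (simp add: list_update_append)
  moreover have "wronskian U D k (map x (xs @ [t])) =
      [(wronskian_coeff k (xs @ [t]))] \<cdot>\<^bsub>U\<^esub> x (sum_list (xs @ [t]) - \<Sum>{0..k})"
    using xs by (intro wronskian_x) simp
  ultimately show ?thesis by (simp only: M.add.int_pow_pow[OF x_closed] mult.commute)
qed

text \<open>Handles the truncated subtraction in \<open>wronskian_x\<close>: with too small a total
  exponent, each permutation exceeds some entry of \<open>es\<close>.\<close>

lemma wronskian_coeff_eq_0:
  assumes "length es = Suc k" "sum_list es < \<Sum>{0..k}"
  shows "wronskian_coeff k es = 0"
  unfolding wronskian_coeff_def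
proof (rule sum.neutral, rule ballI)
  fix \<pi> assume "\<pi> \<in> {\<pi>. \<pi> permutes {0..k}}"
  then have \<pi>: "\<pi> permutes {0..k}" by simp
  have "\<not> (\<forall>j\<le>k. \<pi> j \<le> es ! j)"
  proof
    assume "\<forall>j\<le>k. \<pi> j \<le> es ! j"
    then have "(\<Sum>j\<in>{0..k}. \<pi> j) \<le> (\<Sum>j\<in>{0..k}. es ! j)" by (intro sum_mono) auto
    moreover have "(\<Sum>j\<in>{0..k}. \<pi> j) = \<Sum>{0..k}" using sum.permute[OF \<pi>, of id] by simp
    moreover have "(\<Sum>j\<in>{0..k}. es ! j) = sum_list es"
      unfolding sum_list_sum_nth assms(1) by (simp add: atLeastLessThanSuc_atLeastAtMost)
    ultimately show False using assms(2) by simp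
  qed
  then show "sign \<pi> * (if \<forall>j\<le>k. \<pi> j \<le> es ! j
      then int (multinomial_coeff (\<lambda>j. es ! j - \<pi> j) k) else 0) = 0"
    by (simp only: if_False mult_zero_right)
qed

text \<open>The total exponent is required to equal the order 2 (0 + ... + k) of the nested
  Wronskians, so that all terms are multiples of x_0 and the sum of their coefficients can be tested
  modulo p.\<close>

lemma left_commutative_imp_dvd:
  fixes e :: "nat \<Rightarrow> nat" and k :: nat
  defines "ys \<equiv> \<lambda>\<sigma>. map (\<lambda>i. e (\<sigma> i)) [k + 1..<2 * k + 1] @ [e (2 * k + 1)]"
    and "xs \<equiv> \<lambda>\<sigma>. map (\<lambda>i. e (\<sigma> i)) [1..<k + 1]"
  assumes lc: "left_commutative U k (wronskian U D k)" and p: "has_characteristic K p"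
    and e: "(\<Sum>i\<in>{1..2 * k}. e i) + e (2 * k + 1) = 2 * \<Sum>{0..k}"
  shows "int p dvd (\<Sum>\<sigma> | \<sigma> permutes {1..2 * k}. sign \<sigma> *
    (wronskian_coeff k (ys \<sigma>) * wronskian_coeff k (xs \<sigma> @ [sum_list (ys \<sigma>) - \<Sum>{0..k}])))"
proof (rule int_pow_x_eq_0[OF p])
  let ?h = "\<lambda>\<sigma>. wronskian_coeff k (ys \<sigma>) * wronskian_coeff k (xs \<sigma> @ [sum_list (ys \<sigma>) - \<Sum>{0..k}])"
  let ?w = "\<lambda>\<sigma>. wronskian U D k (map (\<lambda>i. x (e (\<sigma> i))) [1..<k + 1] @
      [wronskian U D k (map (\<lambda>i. x (e (\<sigma> i))) [k + 1..<2 * k + 1] @ [x (e (2 * k + 1))])])"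
  have "[(\<Sum>\<sigma> | \<sigma> permutes {1..2 * k}. sign \<sigma> * ?h \<sigma>)] \<cdot>\<^bsub>U\<^esub> x 0 =
      (\<Oplus>\<^bsub>U\<^esub>\<sigma>\<in>{\<sigma>. \<sigma> permutes {1..2 * k}}. [(sign \<sigma> * ?h \<sigma>)] \<cdot>\<^bsub>U\<^esub> x 0)"
    by (rule M.finsum_int_pow[OF x_closed, symmetric])
  also have "\<dots> = (\<Oplus>\<^bsub>U\<^esub>\<sigma>\<in>{\<sigma>. \<sigma> permutes {1..2 * k}}. [sign \<sigma>] \<cdot>\<^bsub>U\<^esub> ?w \<sigma>)"
  proof (rule M.finsum_cong'[OF refl])
    fix \<sigma> assume "\<sigma> \<in> {\<sigma>. \<sigma> permutes {1..2 * k}}"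
    then have \<sigma>: "\<sigma> permutes {1..2 * k}" by simp
    let ?t = "sum_list (ys \<sigma>) - \<Sum>{0..k}"
    have len: "length (xs \<sigma>) = k" "length (ys \<sigma>) = Suc k" by (simp_all add: xs_def ys_def)
    have "?w \<sigma> = [(?h \<sigma>)] \<cdot>\<^bsub>U\<^esub> x (sum_list (xs \<sigma> @ [?t]) - \<Sum>{0..k})"
      using wronskian_nested_x[OF len refl] by (simp add: xs_def ys_def o_def)
    also have "\<dots> = [(?h \<sigma>)] \<cdot>\<^bsub>U\<^esub> x 0"
    proof (cases "sum_list (ys \<sigma>) < \<Sum>{0..k}")
      case True
      then show ?thesis by (simp add: wronskian_coeff_eq_0[OF len(2)] add_pow_int_ge)
    next
      case False
      have sum_upt: "sum_list (map f [a..<b]) = (\<Sum>i\<in>{a..<b}. f i)" for f :: "nat \<Rightarrow> nat" and a b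
        by (simp add: sum_list_distinct_conv_sum_set)
      have "sum_list (xs \<sigma>) + sum_list (ys \<sigma>) =
          (\<Sum>i\<in>{1..<k + 1}. e (\<sigma> i)) + (\<Sum>i\<in>{k + 1..<2 * k + 1}. e (\<sigma> i)) + e (2 * k + 1)"
        unfolding xs_def ys_def sum_list_append sum_upt by simp
      also have "(\<Sum>i\<in>{1..<k + 1}. e (\<sigma> i)) + (\<Sum>i\<in>{k + 1..<2 * k + 1}. e (\<sigma> i)) =
          (\<Sum>i\<in>{1..<2 * k + 1}. e (\<sigma> i))"
        by (rule sum.atLeastLessThan_concat) auto
      also have "{1..<2 * k + 1} = {1..2 * k}" by auto
      also have "(\<Sum>i\<in>{1..2 * k}. e (\<sigma> i)) = (\<Sum>i\<in>{1..2 * k}. e i)"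
        using sum.permute[OF \<sigma>, of e] by (simp add: o_def)
      finally have "sum_list (xs \<sigma>) + sum_list (ys \<sigma>) = 2 * \<Sum>{0..k}" using e by simp
      then have "sum_list (xs \<sigma> @ [?t]) - \<Sum>{0..k} = 0" using False by simp
      then show ?thesis by (simp only:)
    qed
    finally show "[(sign \<sigma> * ?h \<sigma>)] \<cdot>\<^bsub>U\<^esub> x 0 = [sign \<sigma>] \<cdot>\<^bsub>U\<^esub> ?w \<sigma>"
      by (simp only: M.add.int_pow_pow[OF x_closed] mult.commute[of "sign \<sigma>"])
  next
    show "(\<lambda>\<sigma>. [sign \<sigma>] \<cdot>\<^bsub>U\<^esub> ?w \<sigma>) \<in> {\<sigma>. \<sigma> permutes {1..2 * k}} \<rightarrow> carrier U"
    proof (rule Pi_I, rule M.add.int_pow_closed)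
      fix \<sigma>
      have "wronskian U D k (map (\<lambda>i. x (e (\<sigma> i))) [k + 1..<2 * k + 1] @ [x (e (2 * k + 1))]) \<in> carrier U"
        by (rule wronskian_closed) (auto simp: x_closed)
      then show "?w \<sigma> \<in> carrier U" by (intro wronskian_closed) (auto simp: x_closed)
    qed
  qed
  also have "\<dots> = \<zero>\<^bsub>U\<^esub>"
  proof -
    have "(\<lambda>i. x (e i)) \<in> {1..2 * k + 1} \<rightarrow> carrier U" by (simp add: x_closed)
    then show ?thesis using lc unfolding left_commutative_def by (rule bspec[rotated])
  qed
  finally show "[(\<Sum>\<sigma> | \<sigma> permutes {1..2 * k}. sign \<sigma> * ?h \<sigma>)] \<cdot>\<^bsub>U\<^esub> x 0 = \<zero>\<^bsub>U\<^esub>" .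
qed

text \<open>By the Jacobi identity the left-commutative sum is the bracket [[a_1, a_2], a_3]; at
  x_2, x_0, x_0 its value is x_0.\<close>

lemma left_commutative_1_imp:
  assumes lc: "left_commutative U 1 (wronskian U D 1)" and p: "has_characteristic K p"
  shows "int p dvd 1"
proof -
  \<comment> \<open>Arguments are numbered from 1, so the entry at index 0 is padding.\<close>
  let ?e = "(!) [0, 2, 0, 0 :: nat]"
  have "int p dvd (\<Sum>\<sigma> | \<sigma> permutes {1..2 * 1}. sign \<sigma> *
      (wronskian_coeff 1 [?e (\<sigma> 2), 0] * wronskian_coeff 1 [?e (\<sigma> 1), ?e (\<sigma> 2) - 1]))"
    using left_commutative_imp_dvd[OF lc p, of ?e] by (simp add: atLeast0AtMost_numerals numeral_2_eq_2 upt_rec)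
  also have "(\<Sum>\<sigma> | \<sigma> permutes {1..2 * 1}. sign \<sigma> *
      (wronskian_coeff 1 [?e (\<sigma> 2), 0] * wronskian_coeff 1 [?e (\<sigma> 1), ?e (\<sigma> 2) - 1])) = 1"
  proof -
    have set: "{1..2 * 1} = insert 1 (insert 2 ({} :: nat set))" by auto
    have wc: "wronskian_coeff 1 [0, 0] = 0" "wronskian_coeff 1 [2, 0] = - 1" "wronskian_coeff 1 [0, 1] = 1"
      using wronskian_coeff_last_two[of 0] by simp_all
    show ?thesis
      unfolding set by (subst sum_sign_permutes_insert, simp, simp)+ (simp add: wc[unfolded One_nat_def])
  qed
  finally show ?thesis .
qed


text \<open>The symbol has degree 6 and is antisymmetric in four variables, hence a constant
  multiple of their Vandermonde determinant. The arguments x_0, x_1, x_2, x_3, x_0 read off the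
  constant, which is 8.\<close>

lemma left_commutative_2_imp:
  assumes lc: "left_commutative U 2 (wronskian U D 2)" and p: "has_characteristic K p"
  shows "int p dvd 8"
proof -
  let ?e = "(!) [0, 0, 1, 2, 3, 0 :: nat]"
  let ?f = "\<lambda>a b c d. wronskian_coeff 2 [c, d, 0] * wronskian_coeff 2 [a, b, c + d - 3]"
  have upt: "[1..<2 + 1] = [1, 2]" "[2 + 1..<2 * 2 + 1] = [3, 4]" by (simp_all add: upt_rec)
  have sum3: "\<Sum>{0..2::nat} = 3" by (simp add: atLeast0AtMost_numerals)
  have set: "{1..2 * 2} = insert 1 (insert 2 (insert 3 (insert 4 ({} :: nat set))))" by auto
  have "int p dvd (\<Sum>\<sigma> | \<sigma> permutes {1..2 * 2}. sign \<sigma> * ?f (?e (\<sigma> 1)) (?e (\<sigma> 2)) (?e (\<sigma> 3)) (?e (\<sigma> 4)))"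
  proof -
    have "(\<Sum>i\<in>{1..2 * 2}. ?e i) + ?e (2 * 2 + 1) = 2 * \<Sum>{0..2}" unfolding set sum3 by simp
    from left_commutative_imp_dvd[OF lc p this] show ?thesis unfolding upt sum3 by simp
  qed
  also have "(\<Sum>\<sigma> | \<sigma> permutes {1..2 * 2}. sign \<sigma> * ?f (?e (\<sigma> 1)) (?e (\<sigma> 2)) (?e (\<sigma> 3)) (?e (\<sigma> 4))) = 8"
  proof -
    have wc: "wronskian_coeff 2 [u, v, w] =
        (let t = (\<lambda>a b c. if a \<le> u \<and> b \<le> v \<and> c \<le> w
          then int (((u - a) + (v - b) choose (v - b)) * ((u - a) + (v - b) + (w - c) choose (w - c))) else 0)
        in t 0 1 2 - t 0 2 1 - t 1 0 2 + t 1 2 0 + t 2 0 1 - t 2 1 0)" for u v w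
      using wronskian_coeff_last_three[of 0 u v w] by (simp add: Let_def numeral_2_eq_2)
    \<comment> \<open>Eight of the 24 values are nonzero, each equal to the sign of its arrangement,
      so they add up to 8.\<close>
    have vals: "?f 0 1 2 3 = 1" "?f 0 1 3 2 = - 1" "?f 0 2 1 3 = - 1" "?f 0 2 3 1 = 1"
      "?f 0 3 1 2 = 0" "?f 0 3 2 1 = 0" "?f 1 0 2 3 = - 1" "?f 1 0 3 2 = 1"
      "?f 1 2 0 3 = 0" "?f 1 2 3 0 = 0" "?f 1 3 0 2 = 0" "?f 1 3 2 0 = 0"
      "?f 2 0 1 3 = 1" "?f 2 0 3 1 = - 1" "?f 2 1 0 3 = 0" "?f 2 1 3 0 = 0"
      "?f 2 3 0 1 = 0" "?f 2 3 1 0 = 0" "?f 3 0 1 2 = 0" "?f 3 0 2 1 = 0"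
      "?f 3 1 0 2 = 0" "?f 3 1 2 0 = 0" "?f 3 2 0 1 = 0" "?f 3 2 1 0 = 0"
      unfolding wc by code_simp+
    have perm: "(\<Sum>\<sigma> | \<sigma> permutes {1..2 * 2}. sign \<sigma> * g (\<sigma> 1) (\<sigma> 2) (\<sigma> 3) (\<sigma> 4)) =
      g 1 2 3 4 - g 1 2 4 3 - g 1 3 2 4 + g 1 3 4 2 + g 1 4 2 3 - g 1 4 3 2 -
      g 2 1 3 4 + g 2 1 4 3 + g 2 3 1 4 - g 2 3 4 1 - g 2 4 1 3 + g 2 4 3 1 +
      g 3 1 2 4 - g 3 1 4 2 - g 3 2 1 4 + g 3 2 4 1 + g 3 4 1 2 - g 3 4 2 1 -
      g 4 1 2 3 + g 4 1 3 2 + g 4 2 1 3 - g 4 2 3 1 - g 4 3 1 2 + (g 4 3 2 1 :: int)"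
      for g :: "nat \<Rightarrow> nat \<Rightarrow> nat \<Rightarrow> nat \<Rightarrow> int"
      unfolding set by (simp add: sum_sign_permutes_insert)
    have nth: "?e 1 = 0" "?e 2 = 1" "?e 3 = 2" "?e 4 = 3" by simp_all
    show ?thesis
      unfolding perm[of "\<lambda>a b c d. ?f (?e a) (?e b) (?e c) (?e d)"] nth vals by simp
  qed
  finally show ?thesis .
qed

end

section \<open>The final equivalences\<close>

lemma (in field) has_characteristic_prime:
  assumes p: "has_characteristic R p"
  shows "prime p \<or> p = 0"
proof (rule disjCI)
  assume p0: "p \<noteq> 0"
  have iff: "[m] \<cdot> \<one> = \<zero> \<longleftrightarrow> p dvd m" for m :: nat using p by (simp add: has_characteristic_def)
  have "p \<noteq> 1" using iff[of 1] by auto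
  moreover have "n = 1 \<or> n = p" if n: "n dvd p" for n
  proof -
    obtain m where m: "p = n * m" using n by (rule dvdE)
    have "([n] \<cdot> \<one>) \<otimes> ([m] \<cdot> \<one>) = [n] \<cdot> (\<one> \<otimes> ([m] \<cdot> \<one>))" by (rule add_pow_ldistr) auto
    also have "\<dots> = [p] \<cdot> \<one>" by (simp add: add.nat_pow_pow m mult.commute)
    finally have "([n] \<cdot> \<one>) \<otimes> ([m] \<cdot> \<one>) = \<zero>" using iff[of p] by simp
    then have "[n] \<cdot> \<one> = \<zero> \<or> [m] \<cdot> \<one> = \<zero>" by (intro integral) auto
    then have "p dvd n \<or> p dvd m" by (simp only: iff)
    then show ?thesis
    proof
      assume "p dvd n"
      then show ?thesis using n dvd_antisym by blast
    next
      assume "p dvd m"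
      then have "m = p" using m dvd_antisym by (metis dvd_triv_right)
      then show ?thesis using m p0 by simp
    qed
  qed
  ultimately show "prime p" using p0 by (simp add: prime_nat_iff)
qed

lemma (in differential_algebra) left_commutative_wronskian_if:
  assumes p: "has_characteristic K p" and k: "k > 0" "k \<noteq> 1" "k \<noteq> 2 \<or> p = 2"
  shows "left_commutative U k (wronskian U D k)"
proof (rule left_commutative_wronskian[OF p])
  let ?S = "\<lambda>k. \<Sum>\<sigma> | \<sigma> permutes {1..2 * k}. of_int (sign \<sigma>) * nested_vandermonde k k (var \<circ> \<sigma>)"
  show "of_nat p dvd ?S k"
  proof (cases "k = 2")
    case True
    then show ?thesis using k nested_vandermonde_left_commutative_2[of var] by simp
  next
    case False
    then have "k \<ge> 3" using k by simp
    then show ?thesis by (simp only: nested_vandermonde_left_commutative dvd_0_right)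
  qed
qed

lemma (in differential_algebra) n_lie_wronskian_if:
  assumes p: "has_characteristic K p"
    and k: "k = 1 \<or> k = 2 \<and> p = 2 \<or> k = 3 \<and> p = 3 \<or> k = 4 \<and> p = 2"
  shows "n_lie K U (k + 1) (wronskian U D k)"
proof (rule n_lie_wronskian[OF p])
  show "k > 0" using k by auto
  show "of_nat p dvd lie_defect k var (\<lambda>j. var (k + j))"
    using k
  proof (elim disjE conjE)
    assume "k = 1"
    then show ?thesis by (simp only: lie_defect_1 dvd_0_right)
  next
    assume "k = 2" "p = 2"
    then show ?thesis using dvd_lie_defect_2[of var] by simp
  next
    assume "k = 3" "p = 3"
    then show ?thesis using dvd_lie_defect_3[of var] by simp
  next
    assume "k = 4" "p = 2"
    then show ?thesis using dvd_lie_defect_4[of var] by simp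
  qed
qed

text \<open>The positive results hold over every type; a large universe is assumed for the
  equivalences, whose converse halves require the divided powers algebra to exist in the type. The
  condition in (ii) differs from k \<noteq> 2 in two cases. For k = 1 left commutativity would make
  all brackets [[a_1, a_2], a_3] vanish, which fails over every field. For k = 2 the antisymmetrized
  symbol is divisible by 2, so the identity does hold in characteristic 2.\<close>

theorem theorem1p1:
  fixes K :: "('k, 'm) ring_scheme" and p :: nat
  assumes "field K" and "has_characteristic K p"
  shows
    "(\<forall>(U :: ('k, 'u) module) D. differential_algebra K U D \<longrightarrow>
        (\<forall>k>0. homotopical_n_lie K U (k + 1) (wronskian U D k)) \<and>
        (\<forall>l\<in>{2..} \<rightarrow> carrier K.
          homotopical_lie K U
            (\<lambda>i us. if i \<le> 1 then \<zero>\<^bsub>U\<^esub> else l i \<odot>\<^bsub>U\<^esub> wronskian U D (i - 1) us)))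
     \<and>
     (\<forall>k>0.
        (k \<noteq> 1 \<and> (k \<noteq> 2 \<or> p = 2) \<longrightarrow>
          (\<forall>(U :: ('k, 'u) module) D. differential_algebra K U D \<longrightarrow>
             left_commutative U k (wronskian U D k))) \<and>
        (large_universe TYPE('k) TYPE('u) \<longrightarrow>
          ((\<forall>(U :: ('k, 'u) module) D. differential_algebra K U D \<longrightarrow>
             left_commutative U k (wronskian U D k))
           \<longleftrightarrow> k \<noteq> 1 \<and> (k \<noteq> 2 \<or> p = 2))))
     \<and>
     (\<forall>k>0.
        (k = 1 \<and> (prime p \<or> p = 0) \<or> k = 2 \<and> p = 2 \<or> k = 3 \<and> p = 3 \<or> k = 4 \<and> p = 2 \<longrightarrow>
          (\<forall>(U :: ('k, 'u) module) D. differential_algebra K U D \<longrightarrow>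
             n_lie K U (k + 1) (wronskian U D k))) \<and>
        (large_universe TYPE('k) TYPE('u) \<longrightarrow>
          ((\<forall>(U :: ('k, 'u) module) D. differential_algebra K U D \<longrightarrow>
             n_lie K U (k + 1) (wronskian U D k))
           \<longleftrightarrow> k = 1 \<and> (prime p \<or> p = 0) \<or> k = 2 \<and> p = 2 \<or> k = 3 \<and> p = 3 \<or> k = 4 \<and> p = 2)))"
proof (intro conjI)
  interpret K: field K by fact
  have prime: "prime p \<or> p = 0" using K.has_characteristic_prime assms(2) .
  have ex: "\<exists>(U :: ('k, 'u) module) D x. divided_powers K U D x" if "large_universe TYPE('k) TYPE('u)"
    using that K.ex_divided_powers unfolding large_universe_def by blast
  show "\<forall>(U :: ('k, 'u) module) D. differential_algebra K U D \<longrightarrow>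
      (\<forall>k>0. homotopical_n_lie K U (k + 1) (wronskian U D k)) \<and>
      (\<forall>l\<in>{2..} \<rightarrow> carrier K. homotopical_lie K U
        (\<lambda>i us. if i \<le> 1 then \<zero>\<^bsub>U\<^esub> else l i \<odot>\<^bsub>U\<^esub> wronskian U D (i - 1) us))"
    by (intro allI impI conjI ballI differential_algebra.homotopical_n_lie_wronskian
        differential_algebra.homotopical_lie_wronskian)
  show "\<forall>k>0. (k \<noteq> 1 \<and> (k \<noteq> 2 \<or> p = 2) \<longrightarrow>
        (\<forall>(U :: ('k, 'u) module) D. differential_algebra K U D \<longrightarrow>
           left_commutative U k (wronskian U D k))) \<and>
      (large_universe TYPE('k) TYPE('u) \<longrightarrow>
        ((\<forall>(U :: ('k, 'u) module) D. differential_algebra K U D \<longrightarrow>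
           left_commutative U k (wronskian U D k))
         \<longleftrightarrow> k \<noteq> 1 \<and> (k \<noteq> 2 \<or> p = 2)))"
  proof (intro allI impI)
    fix k :: nat assume k: "k > 0"
    let ?lc = "\<forall>(U :: ('k, 'u) module) D. differential_algebra K U D \<longrightarrow>
      left_commutative U k (wronskian U D k)"
    have "?lc" if "k \<noteq> 1 \<and> (k \<noteq> 2 \<or> p = 2)"
      using that k differential_algebra.left_commutative_wronskian_if[OF _ assms(2)] by blast
    moreover have "k \<noteq> 1 \<and> (k \<noteq> 2 \<or> p = 2)" if large: "large_universe TYPE('k) TYPE('u)" and all: "?lc"
    proof -
      obtain U :: "('k, 'u) module" and D x where dp: "divided_powers K U D x" using ex[OF large] by blast
      interpret divided_powers K U D x by (rule dp)
      have lc: "left_commutative U k (wronskian U D k)" using all differential_algebra_axioms by blast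
      have "\<not> int p dvd 1" using prime by auto
      \<comment> \<open>A characteristic is 0 or a prime, so it never divides 1; for k = 2 the
        divisor of 8 below must be 2.\<close>
      then have "k \<noteq> 1" using lc left_commutative_1_imp[OF _ assms(2)] by auto
      moreover have "p = 2" if "k = 2"
      proof -
        have "int p dvd int (2 ^ 3)" using lc left_commutative_2_imp[OF _ assms(2)] that by simp
        then have "p dvd 2 ^ 3" by (simp only: int_dvd_int_iff)
        moreover from this have "prime p" using prime by auto
        ultimately show ?thesis by (metis prime_dvd_power primes_dvd_imp_eq two_is_prime_nat)
      qed
      ultimately show ?thesis by blast
    qed
    ultimately show "(k \<noteq> 1 \<and> (k \<noteq> 2 \<or> p = 2) \<longrightarrow> ?lc) \<and>
        (large_universe TYPE('k) TYPE('u) \<longrightarrow> (?lc \<longleftrightarrow> k \<noteq> 1 \<and> (k \<noteq> 2 \<or> p = 2)))" by blast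
  qed
  show "\<forall>k>0. (k = 1 \<and> (prime p \<or> p = 0) \<or> k = 2 \<and> p = 2 \<or> k = 3 \<and> p = 3 \<or> k = 4 \<and> p = 2 \<longrightarrow>
        (\<forall>(U :: ('k, 'u) module) D. differential_algebra K U D \<longrightarrow>
           n_lie K U (k + 1) (wronskian U D k))) \<and>
      (large_universe TYPE('k) TYPE('u) \<longrightarrow>
        ((\<forall>(U :: ('k, 'u) module) D. differential_algebra K U D \<longrightarrow>
           n_lie K U (k + 1) (wronskian U D k))
         \<longleftrightarrow> k = 1 \<and> (prime p \<or> p = 0) \<or> k = 2 \<and> p = 2 \<or> k = 3 \<and> p = 3 \<or> k = 4 \<and> p = 2))"
    (is "\<forall>k>0. (?c k \<longrightarrow> ?lie k) \<and> (?large \<longrightarrow> (?lie k \<longleftrightarrow> ?c k))")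
  proof (intro allI impI)
    fix k :: nat assume k: "k > 0"
    have "?lie k" if "?c k"
      using that differential_algebra.n_lie_wronskian_if[OF _ assms(2), of _ _ k] by blast
    moreover have "?c k" if large: "?large" and all: "?lie k"
    proof -
      obtain U :: "('k, 'u) module" and D x where dp: "divided_powers K U D x" using ex[OF large] by blast
      interpret divided_powers K U D x by (rule dp)
      have "n_lie K U (k + 1) (wronskian U D k)" using all differential_algebra_axioms by blast
      then show ?thesis using assms(2) prime k by (rule n_lie_wronskian_imp)
    qed
    ultimately show "(?c k \<longrightarrow> ?lie k) \<and> (?large \<longrightarrow> (?lie k \<longleftrightarrow> ?c k))" by blast
  qed
qed

end
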